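(* Fix $r_0>r_{\mathcal{C}}$ and let $\psi$ solve $\square_g\psi=0$ on the expanding region $\mathcal{R}^+$ of Schwarzschild–de Sitter. With $X_s=r\phi^{-2}\partial_r$, for all $r_2>r_1\ge r_0$, $$E[X_s\psi](r_2)\lesssim_{\Lambda,m,r_0}E[X_s\psi](r_1)+E[\psi](r_1).$$
   Context: Fix $\Lambda>0$, $0<3m<1/\sqrt\Lambda$; $D(r)=\frac{\Lambda}{3}r^2-1+\frac{2m}{r}$, $r_{\mathcal{C}}$ its largest positive root; $\mathcal{R}^+=(r_{\mathcal{C}},\infty)_r\times\mathbb{R}_t\times\mathbb{S}^2$, $g=-D^{-1}dr^2+Ddt^2+r^2\gamma_{\mathbb{S}^2}$, $\phi=D^{-1/2}$, $\square_g\psi=\phi^2\partial_t^2\psi-r^{-2}\partial_r(r^2\phi^{-2}\partial_r\psi)+r^{-2}\Delta_{\mathbb{S}^2}\psi$. For a function $\varphi$, $E[\varphi](r)=\int_{\Sigma_r}J^{\partial_r}[\varphi]\cdot n_{\Sigma_r}d\mu_{\overline g_r}=\frac12\int_{\mathbb{R}\times\mathbb{S}^2}\big(r^2\phi^{-2}(\partial_r\varphi)^2+r^2\phi^2(\partial_t\varphi)^2+|\nabla_{\mathbb{S}^2}\varphi|^2_\gamma\big)dt\,d\mu_\gamma$. *)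

theory Defs
  imports "HOL-Analysis.Analysis"
begin

definition sdsD :: "real \<Rightarrow> real \<Rightarrow> real \<Rightarrow> real" where
  "sdsD \<Lambda> m r = \<Lambda> / 3 * r ^ 2 - 1 + 2 * m / r"

definition rC :: "real \<Rightarrow> real \<Rightarrow> real" where
  "rC \<Lambda> m = Max {r. r > 0 \<and> sdsD \<Lambda> m r = 0}"

definition pd :: "'a::euclidean_space \<Rightarrow> ('a \<Rightarrow> real) \<Rightarrow> 'a \<Rightarrow> real" where
  "pd b f x = deriv (\<lambda>s. f (x + s *\<^sub>R b)) 0"

fun Ck :: "nat \<Rightarrow> 'a::euclidean_space set \<Rightarrow> ('a \<Rightarrow> real) \<Rightarrow> bool" where
  "Ck 0 U f = continuous_on U f"
| "Ck (Suc k) U f = (continuous_on U f \<and> (\<forall>x\<in>U. f differentiable (at x))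
                      \<and> (\<forall>b\<in>Basis. Ck k U (pd b f)))"

definition Cinf_on :: "'a::euclidean_space set \<Rightarrow> ('a \<Rightarrow> real) \<Rightarrow> bool" where
  "Cinf_on U f = (\<forall>k. Ck k U f)"

text \<open>A function on (r,t,omega) with omega in S^2 is represented by
  psi r t y with y in R^3 - {0}, homogeneous of degree 0 in y
  (psi r t y = psi r t (y/|y|)).  For such functions the spherical gradient
  and the spherical Laplacian at a point omega of the unit sphere coincide
  with the ambient Euclidean gradient / Laplacian in y at omega.\<close>

type_synonym sfun = "real \<Rightarrow> real \<Rightarrow> real^3 \<Rightarrow> real"

definition d_r :: "sfun \<Rightarrow> sfun" where
  "d_r \<psi> r t y = deriv (\<lambda>s. \<psi> s t y) r"

definition d_t :: "sfun \<Rightarrow> sfun" where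
  "d_t \<psi> r t y = deriv (\<lambda>s. \<psi> r s y) t"

definition d_x :: "3 \<Rightarrow> sfun \<Rightarrow> sfun" where
  "d_x i \<psi> r t y = deriv (\<lambda>s. \<psi> r t (y + s *\<^sub>R axis i 1)) 0"

definition grad_sq :: "sfun \<Rightarrow> sfun" where
  "grad_sq \<psi> r t y = (\<Sum>i\<in>UNIV. (d_x i \<psi> r t y) ^ 2)"

definition lap :: "sfun \<Rightarrow> sfun" where
  "lap \<psi> r t y = (\<Sum>i\<in>UNIV. d_x i (d_x i \<psi>) r t y)"

definition sph :: "real \<Rightarrow> real \<Rightarrow> real^3" where
  "sph \<theta> \<phi> = vector [sin \<theta> * cos \<phi>, sin \<theta> * sin \<phi>, cos \<theta>]"

text \<open>Integral over R_t x S^2 with respect to dt d mu_gamma (round metric),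
  using spherical coordinates for d mu_gamma = sin theta d theta d phi.\<close>
definition int_tS2 :: "(real \<Rightarrow> real^3 \<Rightarrow> real) \<Rightarrow> ennreal" where
  "int_tS2 F = (\<integral>\<^sup>+ t. (\<integral>\<^sup>+ \<theta>. (\<integral>\<^sup>+ \<phi>.
      ennreal (F t (sph \<theta> \<phi>) * sin \<theta>)
      * indicator {0<..<2*pi} \<phi> \<partial>lborel) * indicator {0<..<pi} \<theta> \<partial>lborel) \<partial>lborel)"

text \<open>phi = D^(-1/2), so phi^(-2) = D and phi^2 = 1/D.\<close>
definition energy :: "real \<Rightarrow> real \<Rightarrow> sfun \<Rightarrow> real \<Rightarrow> ennreal" where
  "energy \<Lambda> m \<psi> r = int_tS2 (\<lambda>t \<omega>. 1/2 *
      (r^2 * sdsD \<Lambda> m r * (d_r \<psi> r t \<omega>)^2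
       + r^2 * (1 / sdsD \<Lambda> m r) * (d_t \<psi> r t \<omega>)^2
       + grad_sq \<psi> r t \<omega>))"

definition Xs :: "real \<Rightarrow> real \<Rightarrow> sfun \<Rightarrow> sfun" where
  "Xs \<Lambda> m \<psi> r t y = r * sdsD \<Lambda> m r * d_r \<psi> r t y"

definition sds_region :: "real \<Rightarrow> real \<Rightarrow> (real \<times> real \<times> (real^3)) set" where
  "sds_region \<Lambda> m = {rC \<Lambda> m<..} \<times> UNIV \<times> (UNIV - {0})"

definition sds_wave_solution :: "real \<Rightarrow> real \<Rightarrow> sfun \<Rightarrow> bool" where
  "sds_wave_solution \<Lambda> m \<psi> \<longleftrightarrow>
     Cinf_on (sds_region \<Lambda> m) (\<lambda>p. \<psi> (fst p) (fst (snd p)) (snd (snd p)))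
   \<and> (\<forall>r t y. r > rC \<Lambda> m \<and> y \<noteq> 0 \<longrightarrow> \<psi> r t y = \<psi> r t (sgn y))
   \<and> (\<forall>r t \<omega>. r > rC \<Lambda> m \<and> norm \<omega> = 1 \<longrightarrow>
        (1 / sdsD \<Lambda> m r) * d_t (d_t \<psi>) r t \<omega>
        - (1 / r^2) * d_r (\<lambda>s t' y. s^2 * sdsD \<Lambda> m s * d_r \<psi> s t' y) r t \<omega>
        + (1 / r^2) * lap \<psi> r t \<omega> = 0)"

end

theory Submission
  imports Defs
begin

text \<open>
  Write \<open>u = X\<^sub>s \<psi> = r D \<psi>\<^sub>r\<close>, \<open>w = 1 - 3m/r\<close>. The wave equation reads
  \<open>(r u)\<^sub>r = (r\<^sup>2/D) \<psi>\<^sub>t\<^sub>t + \<Delta>\<psi>\<close>; differentiating it in \<open>r\<close> gives an equation for \<open>u\<close> whose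
  energy identity has the good term \<open>- (r - 3m) u\<^sub>r\<^sup>2\<close> and the errors \<open>- 2 w u u\<^sub>r\<close> and \<open>2 w u\<^sub>r \<Delta>\<psi>\<close>,
  which decay too slowly to be integrated. Up to divergences both are the \<open>r\<close>-derivative of
  \<open>- w u\<^sup>2 - 2 w \<nabla>u \<cdot> \<nabla>\<psi>\<close> plus terms of relative size \<open>r\<^sup>-\<^sup>2\<close>. Hence the density
  \<open>F = e[u] + w u\<^sup>2 + 2 w \<nabla>u \<cdot> \<nabla>\<psi> + 16 e[\<psi>]\<close>, which is coercive, satisfies \<open>F\<^sub>r \<le> C r\<^sup>-\<^sup>2 F\<close> modulo
  divergences, and \<open>exp (C/r) \<integral>F\<close> does not increase. On the initial slice \<open>\<integral>u\<^sup>2\<close> is bounded by the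
  energies, uniformly in \<open>r\<close>, by testing the wave equation with \<open>u\<close>. Since nothing is assumed
  about decay in \<open>t\<close>, all integrals carry a cutoff supported in a shrinking domain of dependence.
\<close>

section \<open>Partial derivatives of smooth functions\<close>

text \<open>The factor \<open>r D\<close> in \<open>u\<close> comes from the growth of the metric.
  Since \<open>r^2 D' = 2 r D + 2 (r - 3m)\<close>, differentiating the coefficient
  \<open>r^2 D / 2\<close> of \<open>u_r^2\<close> produces \<open>2 r D u_r^2\<close> in the energy
  identity, which the term \<open>2 u_r\<close> of the commuted equation cancels exactly. What
  survives is governed by \<open>r - 3m = r w\<close>, and subextremality makes this positive
  because the cosmological horizon lies beyond \<open>3m\<close>. The error with \<Delta>\<psi>
  cannot simply be estimated: the energies of \<open>u\<close> and \<psi> bound neither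
  \<Delta>\<psi> nor the gradient of \<open>u_r\<close>. Writing it as a total
  \<open>r\<close>-derivative plus a divergence leaves only gradients of \<open>u\<close> and
  \<psi>, with the decaying factors \<open>w'\<close> and \<open>w / (r D)\<close>.

  The final constant may depend neither on the two radii nor on the width of the cutoff. The cutoffs
  are therefore left unnormalised, of height at most \<open>T^4\<close> on the slab of half-width
  \<open>T\<close>; this power is carried explicitly through the bounds and divided out before the
  width tends to infinity.\<close>

lemma pd_cong_open:
  fixes f g :: "'a::euclidean_space \<Rightarrow> real"
  assumes U: "open U" "x \<in> U" and fg: "\<And>x. x \<in> U \<Longrightarrow> f x = g x"
  shows "pd b f x = pd b g x"
  unfolding pd_def
proof (rule deriv_cong_ev)
  have "isCont (\<lambda>s. x + s *\<^sub>R b) 0" by (intro continuous_intros)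
  then have "eventually (\<lambda>s. x + s *\<^sub>R b \<in> U) (nhds 0)"
    using U by (auto simp: continuous_at eventually_nhds_conv_at dest!: topological_tendstoD)
  then show "\<forall>\<^sub>F s in nhds 0. f (x + s *\<^sub>R b) = g (x + s *\<^sub>R b)"
    by eventually_elim (use fg in auto)
qed simp

text \<open>\<open>pd\<close> is built on \<open>deriv\<close>, which is an unspecified number where
  no derivative exists, so it carries information only where differentiability is known. There the
  differential is linear, hence determined by its values on the basis, and these are the numbers
  \<open>pd b f x\<close>.\<close>

lemma pd_has_derivative:
  fixes f :: "'a::euclidean_space \<Rightarrow> real"
  assumes "f differentiable (at x)"
  shows "(f has_derivative (\<lambda>v. \<Sum>b\<in>Basis. (v \<bullet> b) * pd b f x)) (at x)"
proof -
  obtain f' where f': "(f has_derivative f') (at x)"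
    using assms by (auto simp: differentiable_def)
  have pd: "pd b f x = f' b" for b
  proof -
    have "((\<lambda>s. f (x + s *\<^sub>R b)) has_derivative (\<lambda>s. f' (s *\<^sub>R b))) (at 0)"
      by (rule has_derivative_compose[where g=f and f="\<lambda>s. x + s *\<^sub>R b"])
        (auto intro!: derivative_eq_intros f')
    then have "((\<lambda>s. f (x + s *\<^sub>R b)) has_field_derivative f' b) (at 0)"
      by (simp add: has_field_derivative_def linear_scale[OF has_derivative_linear[OF f']] mult_commute_abs)
    then show ?thesis by (simp add: pd_def DERIV_imp_deriv)
  qed
  have "f' v = (\<Sum>b\<in>Basis. (v \<bullet> b) * pd b f x)" for v
  proof -
    have "f' v = f' (\<Sum>b\<in>Basis. (v \<bullet> b) *\<^sub>R b)" by (simp add: euclidean_representation)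
    also have "\<dots> = (\<Sum>b\<in>Basis. (v \<bullet> b) * f' b)"
      by (simp add: linear_sum[OF has_derivative_linear[OF f']] linear_scale[OF has_derivative_linear[OF f']])
    finally show ?thesis by (simp add: pd)
  qed
  then have "f' = (\<lambda>v. \<Sum>b\<in>Basis. (v \<bullet> b) * pd b f x)" by (rule ext)
  with f' show ?thesis by (simp only:)
qed

lemma pd_line:
  fixes f :: "'a::euclidean_space \<Rightarrow> real"
  assumes "f differentiable (at (x + s *\<^sub>R b))" "b \<in> Basis"
  shows "((\<lambda>s. f (x + s *\<^sub>R b)) has_field_derivative pd b f (x + s *\<^sub>R b)) (at s)"
proof -
  have *: "(\<Sum>c\<in>Basis. ((h *\<^sub>R b) \<bullet> c) * pd c f y) = h * pd b f y" for h y
  proof -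
    have "(\<Sum>c\<in>Basis. ((h *\<^sub>R b) \<bullet> c) * pd c f y) = (\<Sum>c\<in>Basis. if b = c then h * pd c f y else 0)"
      using assms(2) by (intro sum.cong) (auto simp: inner_Basis)
    then show ?thesis using assms(2) by simp
  qed
  have "((\<lambda>s. f (x + s *\<^sub>R b)) has_derivative (\<lambda>h. \<Sum>c\<in>Basis. ((h *\<^sub>R b) \<bullet> c) * pd c f (x + s *\<^sub>R b))) (at s)"
    by (rule has_derivative_compose[where g=f and f="\<lambda>s. x + s *\<^sub>R b", OF _ pd_has_derivative[OF assms(1)]])
      (auto intro!: derivative_eq_intros)
  then show ?thesis by (simp only: * has_field_derivative_def mult.commute[of _ "pd b f (x + s *\<^sub>R b)"])
qed

text \<open>Needed because the sum and product rules for \<open>pd\<close> hold only at points of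
  \<open>U\<close>, where the functions are differentiable, and not as equations between functions
  on the whole space.\<close>

lemma Ck_cong:
  assumes "open U"
  shows "(\<And>x. x \<in> U \<Longrightarrow> f x = g x) \<Longrightarrow> Ck k U f \<Longrightarrow> Ck k U g"
proof (induction k arbitrary: f g)
  case 0
  then show ?case by (simp cong: continuous_on_cong)
next
  case (Suc k)
  note fg = Suc.prems(1)
  have f: "continuous_on U f" "\<And>x. x \<in> U \<Longrightarrow> f differentiable (at x)"
    "\<And>b. b \<in> Basis \<Longrightarrow> Ck k U (pd b f)"
    using Suc.prems(2) by simp_all
  have "Ck k U (pd b g)" if "b \<in> Basis" for b
    by (rule Suc.IH[OF pd_cong_open[OF assms _ fg] f(3)[OF that]])
  moreover have "g differentiable (at x)" if "x \<in> U" for x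
  proof -
    have "f differentiable (at x)" using f(2) that .
    then obtain D where "(f has_derivative D) (at x)" unfolding differentiable_def by blast
    from has_derivative_transform_within_open[OF this assms that fg] show ?thesis
      unfolding differentiable_def by blast
  qed
  moreover have "continuous_on U g" using f(1) fg by (simp cong: continuous_on_cong)
  ultimately show ?case by simp
qed

lemma Ck_decreasing: "Ck (Suc k) U f \<Longrightarrow> Ck k U f"
proof (induction k arbitrary: f)
  case (Suc k)
  from Suc.prems have "continuous_on U f" "\<forall>x\<in>U. f differentiable (at x)"
    and pd: "\<forall>b\<in>Basis. Ck (Suc k) U (pd b f)"
    unfolding Ck.simps(2)[of "Suc k" U f] by blast+
  moreover have "\<forall>b\<in>Basis. Ck k U (pd b f)" using pd Suc.IH by blast
  ultimately show ?case unfolding Ck.simps(2)[of k U f] by blast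
qed simp

lemma Ck_const: "Ck k U (\<lambda>x. c)"
proof (induction k arbitrary: c)
  case (Suc k)
  have "pd b (\<lambda>x. c) = (\<lambda>x. 0)" for b :: 'a by (auto simp: pd_def)
  with Suc show ?case by simp
qed simp

lemma Ck_inner: "Ck k U (\<lambda>x. x \<bullet> a)"
proof (cases k)
  case (Suc j)
  have "((\<lambda>s. (x + s *\<^sub>R b) \<bullet> a) has_field_derivative (b \<bullet> a)) (at 0)" for x b :: 'a
    by (auto intro!: derivative_eq_intros simp: inner_simps)
  then have "pd b (\<lambda>x. x \<bullet> a) = (\<lambda>x. b \<bullet> a)" for b :: 'a
    by (auto simp: pd_def DERIV_imp_deriv)
  then show ?thesis using Suc by (auto intro!: continuous_intros simp: Ck_const)
qed (auto intro!: continuous_intros)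

lemma Ck_add:
  assumes "open U"
  shows "Ck k U f \<Longrightarrow> Ck k U g \<Longrightarrow> Ck k U (\<lambda>x. f x + g x)"
proof (induction k arbitrary: f g)
  case (Suc k)
  have "Ck k U (pd b (\<lambda>x. f x + g x))" if b: "b \<in> Basis" for b
  proof (rule Ck_cong[OF assms _ Suc.IH[of "pd b f" "pd b g"]])
    fix x assume "x \<in> U"
    then have "f differentiable (at x)" "g differentiable (at x)" using Suc.prems by auto
    then show "pd b f x + pd b g x = pd b (\<lambda>x. f x + g x) x"
      using pd_line[of f x 0 b] pd_line[of g x 0 b] b
      by (auto simp: pd_def[of _ "\<lambda>x. f x + g x"] intro!: DERIV_imp_deriv[symmetric] derivative_eq_intros)
  qed (use Suc.prems b in auto)
  moreover have "continuous_on U (\<lambda>x. f x + g x)" "\<forall>x\<in>U. (\<lambda>x. f x + g x) differentiable (at x)"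
    using Suc.prems by (auto intro!: continuous_on_add differentiable_add)
  ultimately show ?case by simp
qed (simp add: continuous_on_add)

lemma Ck_mult:
  assumes "open U"
  shows "Ck k U f \<Longrightarrow> Ck k U g \<Longrightarrow> Ck k U (\<lambda>x. f x * g x)"
proof (induction k arbitrary: f g)
  case (Suc k)
  have "Ck k U (pd b (\<lambda>x. f x * g x))" if b: "b \<in> Basis" for b
  proof (rule Ck_cong[OF assms])
    fix x assume "x \<in> U"
    then have "f differentiable (at x)" "g differentiable (at x)" using Suc.prems by auto
    then show "pd b f x * g x + f x * pd b g x = pd b (\<lambda>x. f x * g x) x"
      using pd_line[of f x 0 b] pd_line[of g x 0 b] b
      by (auto simp: pd_def[of _ "\<lambda>x. f x * g x"] intro!: DERIV_imp_deriv[symmetric] derivative_eq_intros)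
  next
    show "Ck k U (\<lambda>x. pd b f x * g x + f x * pd b g x)"
      using Suc.prems b by (intro Ck_add[OF assms] Suc.IH) (auto intro: Ck_decreasing)
  qed
  moreover have "continuous_on U (\<lambda>x. f x * g x)" "\<forall>x\<in>U. (\<lambda>x. f x * g x) differentiable (at x)"
    using Suc.prems by (auto intro!: continuous_on_mult differentiable_mult)
  ultimately show ?case by simp
qed (simp add: continuous_on_mult)

lemma Cinf_on_cong: "open U \<Longrightarrow> (\<And>x. x \<in> U \<Longrightarrow> f x = g x) \<Longrightarrow> Cinf_on U f \<Longrightarrow> Cinf_on U g"
  unfolding Cinf_on_def using Ck_cong[of U f g] by blast

lemma Cinf_on_pd: "Cinf_on U f \<Longrightarrow> b \<in> Basis \<Longrightarrow> Cinf_on U (pd b f)"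
  unfolding Cinf_on_def using Ck.simps(2)[of _ U f] by blast

lemma Cinf_on_imp_continuous_on: "Cinf_on U f \<Longrightarrow> continuous_on U f"
  unfolding Cinf_on_def using Ck.simps(1)[of U f] by blast

lemma Cinf_on_imp_differentiable: "Cinf_on U f \<Longrightarrow> x \<in> U \<Longrightarrow> f differentiable (at x)"
  unfolding Cinf_on_def using Ck.simps(2)[of 0 U f] by blast

text \<open>Schwarz's theorem, by differentiating
  \<open>g s \<tau> - g s 0 = \<integral>\<^sub>0\<^sup>\<tau> \<partial>\<^sub>2 g s\<close> under the integral sign.\<close>

lemma mixed_partials_real:
  fixes g :: "real \<Rightarrow> real \<Rightarrow> real"
  assumes e: "0 < e"
    and g1: "\<And>s t. \<bar>s\<bar> \<le> e \<Longrightarrow> \<bar>t\<bar> \<le> e \<Longrightarrow> ((\<lambda>s. g s t) has_field_derivative g1 s t) (at s)"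
    and g2: "\<And>s t. \<bar>s\<bar> \<le> e \<Longrightarrow> \<bar>t\<bar> \<le> e \<Longrightarrow> (g s has_field_derivative g2 s t) (at t)"
    and g21: "\<And>s t. \<bar>s\<bar> \<le> e \<Longrightarrow> \<bar>t\<bar> \<le> e \<Longrightarrow> ((\<lambda>s. g2 s t) has_field_derivative g21 s t) (at s)"
    and g12: "((\<lambda>t. g1 0 t) has_field_derivative c) (at 0)"
    and cont2: "\<And>s. \<bar>s\<bar> \<le> e \<Longrightarrow> continuous_on {0..e} (g2 s)"
    and cont21: "continuous_on ({-e..e} \<times> {0..e}) (\<lambda>(s, t). g21 s t)"
  shows "c = g21 0 0"
proof -
  have g1_diff: "g1 0 \<tau> - g1 0 0 = integral {0..\<tau>} (g21 0)" if \<tau>: "\<tau> \<in> {0..e}" for \<tau>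
  proof -
    have FTC: "integral {0..\<tau>} (g2 s) = g s \<tau> - g s 0" if "\<bar>s\<bar> \<le> e" for s
      using \<tau> that
      by (intro integral_unique fundamental_theorem_of_calculus)
        (auto intro!: has_field_derivative_at_within[OF g2] simp flip: has_real_derivative_iff_has_vector_derivative)
    have "((\<lambda>s. integral (cbox 0 \<tau>) (g2 s)) has_field_derivative integral (cbox 0 \<tau>) (g21 0)) (at 0 within {-e..e})"
    proof (rule leibniz_rule_field_derivative)
      show "((\<lambda>x. g2 x t) has_field_derivative g21 x t) (at x within {- e..e})"
        if "x \<in> {-e..e}" "t \<in> cbox 0 \<tau>" for x t
        using that \<tau> by (intro has_field_derivative_at_within[OF g21]) auto
      show "g2 x integrable_on cbox 0 \<tau>" if "x \<in> {-e..e}" for x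
        using that \<tau> by (auto intro!: integrable_continuous_interval intro: continuous_on_subset[OF cont2])
      show "continuous_on ({- e..e} \<times> cbox 0 \<tau>) (\<lambda>(x, t). g21 x t)"
        by (rule continuous_on_subset[OF cont21]) (use \<tau> in auto)
    qed (use e in auto)
    then have "((\<lambda>s. g s \<tau> - g s 0) has_field_derivative integral {0..\<tau>} (g21 0)) (at 0 within {-e..e})"
      unfolding has_field_derivative_def box_real
      by (rule has_derivative_transform_within[OF _ e]) (use e FTC in auto)
    then have "((\<lambda>s. g s \<tau> - g s 0) has_field_derivative integral {0..\<tau>} (g21 0)) (at 0)"
      using e at_within_Icc_at[of "-e" 0 e] by simp
    moreover have "((\<lambda>s. g s \<tau> - g s 0) has_field_derivative (g1 0 \<tau> - g1 0 0)) (at 0)"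
      using \<tau> e by (intro DERIV_diff g1) auto
    ultimately show ?thesis using DERIV_unique by blast
  qed
  \<comment> \<open>Continuity of \<open>g21\<close> turns the integral formula into a one-sided
    derivative at 0. Comparing it with \<open>g12\<close> on \<open>{0..e}\<close> is enough, since
    derivatives within a nondegenerate interval are unique.\<close>
  have "continuous_on {0..e} (g21 0)"
  proof -
    have "continuous_on {0..e} (Pair 0)" "Pair 0 ` {0..e} \<subseteq> {-e..e} \<times> {0..e}"
      using e by (auto intro!: continuous_on_Pair continuous_on_const continuous_on_id)
    from continuous_on_compose2[OF cont21 this] show ?thesis by simp
  qed
  then have "((\<lambda>\<tau>. integral {0..\<tau>} (g21 0)) has_vector_derivative g21 0 0) (at 0 within {0..e})"
    using e by (intro integral_has_vector_derivative) auto
  then have "((\<lambda>\<tau>. g1 0 \<tau> - g1 0 0) has_vector_derivative g21 0 0) (at 0 within {0..e})"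
    by (rule has_vector_derivative_transform_within[OF _ e]) (use e g1_diff in auto)
  moreover have "((\<lambda>\<tau>. g1 0 \<tau> - g1 0 0) has_vector_derivative c) (at 0 within {0..e})"
    using has_field_derivative_at_within[OF g12]
    by (auto intro!: derivative_eq_intros simp: has_real_derivative_iff_has_vector_derivative)
  ultimately show ?thesis
    using vector_derivative_unique_within_closed_interval[of 0 e 0] e by auto
qed

lemma pd_commute:
  assumes U: "open U" "x \<in> U" and f: "Cinf_on U f" and bc: "b \<in> Basis" "c \<in> Basis"
  shows "pd b (pd c f) x = pd c (pd b f) x"
proof -
  obtain d where d: "d > 0" "cball x d \<subseteq> U" using U open_contains_cball by blast
  \<comment> \<open>Half the radius: \<open>b\<close> and \<open>c\<close> are unit vectors, so
    \<open>\<bar>s\<bar>, \<bar>t\<bar> \<le> e\<close> keeps \<open>y s t\<close> in the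
    ball.\<close>
  define e where "e = d / 2"
  define y where "y s t = x + s *\<^sub>R b + t *\<^sub>R c" for s t :: real
  have yU: "y s t \<in> U" if "\<bar>s\<bar> \<le> e" "\<bar>t\<bar> \<le> e" for s t
  proof -
    have "norm (s *\<^sub>R b + t *\<^sub>R c) \<le> \<bar>s\<bar> + \<bar>t\<bar>"
      using bc by (intro order_trans[OF norm_triangle_ineq]) auto
    also have "\<dots> \<le> d" using that by (auto simp: e_def)
    finally have "y s t \<in> cball x d"
      by (metis y_def add.assoc add_diff_cancel_left' dist_commute dist_norm mem_cball)
    then show ?thesis using d by auto
  qed
  have line_b: "((\<lambda>s. h (y s t)) has_field_derivative pd b h (y s t)) (at s)"
    if "Cinf_on U h" "\<bar>s\<bar> \<le> e" "\<bar>t\<bar> \<le> e" for h s t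
  proof -
    have eq: "y s t = (x + t *\<^sub>R c) + s *\<^sub>R b" for s by (simp add: y_def algebra_simps)
    show ?thesis unfolding eq
      by (rule pd_line) (use Cinf_on_imp_differentiable[OF that(1) yU[OF that(2,3)]] bc eq in auto)
  qed
  have line_c: "((\<lambda>t. h (y s t)) has_field_derivative pd c h (y s t)) (at t)"
    if "Cinf_on U h" "\<bar>s\<bar> \<le> e" "\<bar>t\<bar> \<le> e" for h s t
    unfolding y_def
    by (rule pd_line) (use Cinf_on_imp_differentiable[OF that(1) yU[OF that(2,3)]] bc y_def in auto)
  have cont: "continuous_on ({-e..e} \<times> {-e..e}) (\<lambda>(s, t). h (y s t))" if "Cinf_on U h" for h
    unfolding split_beta
    by (rule continuous_on_compose2[OF Cinf_on_imp_continuous_on[OF that]])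
      (use yU in \<open>auto simp: y_def abs_le_iff intro!: continuous_intros\<close>)
  note smooth = f Cinf_on_pd[OF f] Cinf_on_pd[OF Cinf_on_pd[OF f]] bc
  have "pd c (pd b f) (y 0 0) = pd b (pd c f) (y 0 0)"
  proof (rule mixed_partials_real[where e=e and g="\<lambda>s t. f (y s t)" and ?g1.0="\<lambda>s t. pd b f (y s t)"
        and ?g2.0="\<lambda>s t. pd c f (y s t)" and ?g21.0="\<lambda>s t. pd b (pd c f) (y s t)"])
    show "e > 0" using d by (simp add: e_def)
    then show "((\<lambda>t. pd b f (y 0 t)) has_real_derivative pd c (pd b f) (y 0 0)) (at 0)"
      by (intro line_c smooth) auto
    show "continuous_on {0..e} (\<lambda>t. pd c f (y s t))" if "\<bar>s\<bar> \<le> e" for s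
    proof -
      have "continuous_on {0..e} (Pair s)" "Pair s ` {0..e} \<subseteq> {-e..e} \<times> {-e..e}"
        using that by (auto intro!: continuous_on_Pair continuous_on_const continuous_on_id)
      from continuous_on_compose2[OF cont[OF smooth(2)[OF bc(2)]] this] show ?thesis by simp
    qed
    show "continuous_on ({-e..e} \<times> {0..e}) (\<lambda>(s, t). pd b (pd c f) (y s t))"
      by (rule continuous_on_subset[OF cont]) (use smooth \<open>e > 0\<close> in auto)
  qed (intro line_b line_c smooth; assumption)+
  then show ?thesis by (simp add: y_def)
qed

section \<open>Integration over the sphere and over slabs\<close>

text \<open>A gauge integral over closed parameter intervals stands in for the Lebesgue integral of
  \<open>int_tS2\<close>: for continuous integrands Leibniz' rule and the fundamental theorem of
  calculus apply to it directly. \<open>nn_integral_sphere\<close> matches the two again.\<close>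

definition sphere_int :: "(real^3 \<Rightarrow> real) \<Rightarrow> real" where
  "sphere_int f = integral {0..pi} (\<lambda>\<theta>. integral {0..2*pi} (\<lambda>\<phi>. f (sph \<theta> \<phi>) * sin \<theta>))"

lemma sph_nth [simp]:
  "sph \<theta> \<phi> $ 1 = sin \<theta> * cos \<phi>" "sph \<theta> \<phi> $ 2 = sin \<theta> * sin \<phi>" "sph \<theta> \<phi> $ 3 = cos \<theta>"
  by (simp_all add: sph_def)

lemma norm_sph [simp]: "norm (sph \<theta> \<phi>) = 1"
proof -
  have "(sin \<theta> * cos \<phi>)\<^sup>2 + (sin \<theta> * sin \<phi>)\<^sup>2 + (cos \<theta>)\<^sup>2 = (sin \<theta>)\<^sup>2 * ((sin \<phi>)\<^sup>2 + (cos \<phi>)\<^sup>2) + (cos \<theta>)\<^sup>2"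
    by (simp only: distrib_left power_mult_distrib add.commute[of "(sin \<theta>)\<^sup>2 * (cos \<phi>)\<^sup>2"])
  also have "\<dots> = 1" by (simp only: sin_cos_squared_add mult_1_right)
  finally show ?thesis
    by (simp add: norm_vec_def L2_set_def sum_3)
qed

lemma continuous_on_sph:
  fixes S :: "'a::t2_space set"
  assumes "continuous_on S f" "continuous_on S g"
  shows "continuous_on S (\<lambda>x. sph (f x) (g x))"
proof -
  have "sph \<theta> \<phi> = (\<chi> i. if i = 1 then sin \<theta> * cos \<phi> else if i = 2 then sin \<theta> * sin \<phi> else cos \<theta>)" for \<theta> \<phi>
    by (simp add: vec_eq_iff forall_3)
  moreover have "continuous_on S (\<lambda>x. if i = 1 then sin (f x) * cos (g x)
      else if i = 2 then sin (f x) * sin (g x) else cos (f x))" for i :: 3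
    using assms by (cases "i = 1"; cases "i = 2") (simp_all add: continuous_on_sin continuous_on_cos continuous_on_mult)
  ultimately show ?thesis by (simp add: continuous_on_vec_lambda)
qed

lemma continuous_on_sphere_integrand:
  fixes Z :: "'a::t2_space set"
  assumes "continuous_on (Z \<times> sphere 0 1) (\<lambda>(z, y). f z y)"
  shows "continuous_on (Z \<times> UNIV) (\<lambda>(z, \<theta>, \<phi>). f z (sph \<theta> \<phi>) * sin \<theta>)"
proof -
  have "continuous_on (Z \<times> UNIV) (\<lambda>p. (fst p, sph (fst (snd p)) (snd (snd p))))"
    by (intro continuous_on_Pair continuous_on_sph continuous_intros)
  from continuous_on_compose2[OF assms this]
  have "continuous_on (Z \<times> UNIV) (\<lambda>p. f (fst p) (sph (fst (snd p)) (snd (snd p))))"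
    by (simp add: split_beta image_subset_iff mem_Times_iff)
  then show ?thesis unfolding split_beta by (intro continuous_on_mult continuous_intros)
qed

lemma continuous_on_azimuthal_integral:
  fixes Z :: "'a::t2_space set"
  assumes "continuous_on (Z \<times> sphere 0 1) (\<lambda>(z, y). f z y)"
  shows "continuous_on (Z \<times> UNIV) (\<lambda>(z, \<theta>). integral {0..2*pi} (\<lambda>\<phi>. f z (sph \<theta> \<phi>) * sin \<theta>))"
proof -
  have "continuous_on ((Z \<times> UNIV) \<times> cbox 0 (2 * pi)) (\<lambda>p. (fst (fst p), snd (fst p), snd p))"
    by (intro continuous_intros)
  from continuous_on_compose2[OF continuous_on_sphere_integrand[OF assms] this]
  have "continuous_on ((Z \<times> UNIV) \<times> cbox 0 (2 * pi)) (\<lambda>(p, \<phi>). f (fst p) (sph (snd p) \<phi>) * sin (snd p))"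
    by (simp add: split_beta image_subset_iff mem_Times_iff)
  from integral_continuous_on_param[OF this] show ?thesis by (simp add: split_beta)
qed

lemma sphere_int_continuous:
  fixes Z :: "'a::t2_space set"
  assumes "continuous_on (Z \<times> sphere 0 1) (\<lambda>(z, y). f z y)"
  shows "continuous_on Z (\<lambda>z. sphere_int (f z))"
proof -
  have "continuous_on (Z \<times> cbox 0 pi) (\<lambda>(z, \<theta>). integral {0..2*pi} (\<lambda>\<phi>. f z (sph \<theta> \<phi>) * sin \<theta>))"
    by (rule continuous_on_subset[OF continuous_on_azimuthal_integral[OF assms]]) auto
  from integral_continuous_on_param[OF this] show ?thesis by (simp add: sphere_int_def)
qed

lemma
  assumes "continuous_on (sphere 0 1) f"
  shows continuous_on_meridian: "continuous_on S (\<lambda>\<phi>. f (sph \<theta> \<phi>) * sin \<theta>)"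
    and continuous_on_parallel_integral: "continuous_on S (\<lambda>\<theta>. integral {0..2*pi} (\<lambda>\<phi>. f (sph \<theta> \<phi>) * sin \<theta>))"
proof -
  have c: "continuous_on ((UNIV :: real set) \<times> sphere 0 1) (\<lambda>(z, y). f y)"
    unfolding split_beta by (rule continuous_on_compose2[OF assms]) (auto intro!: continuous_intros)
  have "continuous_on S (\<lambda>\<phi>. (0, \<theta>, \<phi>))" by (intro continuous_intros)
  from continuous_on_compose2[OF continuous_on_sphere_integrand[OF c] this]
  show "continuous_on S (\<lambda>\<phi>. f (sph \<theta> \<phi>) * sin \<theta>)" by simp
  have "continuous_on S (\<lambda>\<theta>. (0, \<theta>))" by (intro continuous_intros)
  from continuous_on_compose2[OF continuous_on_azimuthal_integral[OF c] this]
  show "continuous_on S (\<lambda>\<theta>. integral {0..2*pi} (\<lambda>\<phi>. f (sph \<theta> \<phi>) * sin \<theta>))" by simp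
qed

lemma sphere_int_cong: "(\<And>y. norm y = 1 \<Longrightarrow> f y = g y) \<Longrightarrow> sphere_int f = sphere_int g"
  by (simp add: sphere_int_def)

lemma sphere_int_add:
  assumes "continuous_on (sphere 0 1) f" "continuous_on (sphere 0 1) g"
  shows "sphere_int (\<lambda>y. f y + g y) = sphere_int f + sphere_int g"
  using assms unfolding sphere_int_def distrib_right
  by (simp only: integral_add integrable_continuous_interval continuous_on_meridian continuous_on_parallel_integral)

lemma sphere_int_cmult: "sphere_int (\<lambda>y. c * f y) = c * sphere_int f"
  by (simp add: sphere_int_def mult.assoc)

lemma sphere_int_mono:
  assumes "continuous_on (sphere 0 1) f" "continuous_on (sphere 0 1) g"
    and "\<And>y. norm y = 1 \<Longrightarrow> f y \<le> g y"
  shows "sphere_int f \<le> sphere_int g"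
  unfolding sphere_int_def
  using assms
  by (intro integral_le integrable_continuous_interval continuous_on_meridian
      continuous_on_parallel_integral mult_right_mono sin_ge_zero) auto

lemma sphere_int_nonneg:
  assumes "continuous_on (sphere 0 1) f" "\<And>y. norm y = 1 \<Longrightarrow> 0 \<le> f y"
  shows "0 \<le> sphere_int f"
  using sphere_int_mono[OF continuous_on_const assms(1), of 0] assms(2) by (simp add: sphere_int_def)

lemma sphere_int_derivative:
  fixes U :: "real set"
  assumes f: "\<And>z y. z \<in> U \<Longrightarrow> norm y = 1 \<Longrightarrow> ((\<lambda>z. f z y) has_field_derivative f' z y) (at z within U)"
    and cont: "\<And>z. z \<in> U \<Longrightarrow> continuous_on (sphere 0 1) (f z)"
    and cont': "continuous_on (U \<times> sphere 0 1) (\<lambda>(z, y). f' z y)"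
    and U: "z \<in> U" "convex U"
  shows "((\<lambda>z. sphere_int (f z)) has_field_derivative sphere_int (f' z)) (at z within U)"
proof -
  have "((\<lambda>z. integral {0..2*pi} (\<lambda>\<phi>. f z (sph \<theta> \<phi>) * sin \<theta>)) has_field_derivative
          integral {0..2*pi} (\<lambda>\<phi>. f' z (sph \<theta> \<phi>) * sin \<theta>)) (at z within U)" if "z \<in> U" for z \<theta>
    unfolding box_real[symmetric]
  proof (rule leibniz_rule_field_derivative)
    have "continuous_on (U \<times> cbox 0 (2 * pi)) (\<lambda>p. (fst p, \<theta>, snd p))" by (intro continuous_intros)
    from continuous_on_compose2[OF continuous_on_sphere_integrand[OF cont'] this]
    show "continuous_on (U \<times> cbox 0 (2 * pi)) (\<lambda>(z, \<phi>). f' z (sph \<theta> \<phi>) * sin \<theta>)"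
      by (simp add: split_beta image_subset_iff mem_Times_iff)
  qed (use that U(2) in \<open>auto intro!: DERIV_cmult_right f integrable_continuous_interval continuous_on_meridian cont\<close>)
  moreover have "continuous_on (U \<times> cbox 0 pi) (\<lambda>(z, \<theta>). integral {0..2*pi} (\<lambda>\<phi>. f' z (sph \<theta> \<phi>) * sin \<theta>))"
    by (rule continuous_on_subset[OF continuous_on_azimuthal_integral[OF cont']]) auto
  moreover have "(\<lambda>\<theta>. integral {0..2*pi} (\<lambda>\<phi>. f z (sph \<theta> \<phi>) * sin \<theta>)) integrable_on cbox 0 pi" if "z \<in> U" for z
    unfolding box_real by (intro integrable_continuous_interval continuous_on_parallel_integral cont that)
  ultimately show ?thesis
    unfolding sphere_int_def box_real[symmetric] using U
    by (intro leibniz_rule_field_derivative[where f="\<lambda>z \<theta>. integral (cbox 0 (2*pi)) (\<lambda>\<phi>. f z (sph \<theta> \<phi>) * sin \<theta>)"])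
qed

text \<open>In the orthonormal frame \<open>e\<^sub>\<theta>, e\<^sub>\<phi>\<close> one has
  \<open>sin \<theta> div V = \<partial>\<^sub>\<theta> (sin \<theta> V\<^sub>\<theta>) + \<partial>\<^sub>\<phi> V\<^sub>\<phi>\<close>; the ambient divergence exceeds the
  tangential one by the radial term \<open>\<Sum>\<^sub>i\<^sub>j W\<^sub>i\<^sub>j y\<^sub>i y\<^sub>j\<close>, which vanishes because \<open>V\<close> is tangential
  to every sphere.\<close>

lemma polar_divergence_identity:
  fixes s c p q :: real
  assumes "s\<^sup>2 + c\<^sup>2 = 1" "p\<^sup>2 + q\<^sup>2 = 1"
    and radial: "V1 * (s*q) + V2 * (s*p) + V3 * c = 0"
    and radial': "(W11 * (s*q) + W12 * (s*p) + W13 * c) * (s*q) + (W21 * (s*q) + W22 * (s*p) + W23 * c) * (s*p)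
        + (W31 * (s*q) + W32 * (s*p) + W33 * c) * c = 0"
  shows "(c * (V1 * (c*q) + V2 * (c*p) - V3 * s)
      + s * ((W11 * (c*q) + W12 * (c*p) - W13 * s) * (c*q) + (W21 * (c*q) + W22 * (c*p) - W23 * s) * (c*p)
             - (W31 * (c*q) + W32 * (c*p) - W33 * s) * s - (V1 * (s*q) + V2 * (s*p) + V3 * c)))
    + (s * ((W12 * q - W11 * p) * (- p) + (W22 * q - W21 * p) * q) - V1 * q - V2 * p)
    = (W11 + W22 + W33) * s"
proof -
  have c2: "c*c = 1 - s * s" and q2: "q*q = 1 - p*p" using assms(1,2) by (auto simp: power2_eq_square)
  have a: "(c*q)*(c*q) + p*p + (s*q)*(s*q) = 1" "(c*p)*(c*p) + q*q + (s*p)*(s*p) = 1" "s * s + c*c = 1"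
    "(c*q)*(c*p) - p*q + (s*q)*(s*p) = 0"
    using c2 q2 by algebra+
  have "c * (V1 * (c*q) + V2 * (c*p) - V3 * s) - V1 * q - V2 * p = 0"
    using c2 radial by algebra
  moreover have "(W11 * (c*q) + W12 * (c*p) - W13 * s) * (c*q) + (W21 * (c*q) + W22 * (c*p) - W23 * s) * (c*p)
      - (W31 * (c*q) + W32 * (c*p) - W33 * s) * s + ((W12 * q - W11 * p) * (- p) + (W22 * q - W21 * p) * q)
      = W11 + W22 + W33"
  proof -
    have "(W11 * (c*q) + W12 * (c*p) - W13 * s) * (c*q) + (W21 * (c*q) + W22 * (c*p) - W23 * s) * (c*p)
      - (W31 * (c*q) + W32 * (c*p) - W33 * s) * s + ((W12 * q - W11 * p) * (- p) + (W22 * q - W21 * p) * q)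
      + ((W11 * (s*q) + W12 * (s*p) + W13 * c) * (s*q) + (W21 * (s*q) + W22 * (s*p) + W23 * c) * (s*p)
        + (W31 * (s*q) + W32 * (s*p) + W33 * c) * c)
      = W11 * ((c*q)*(c*q) + p*p + (s*q)*(s*q)) + W22 * ((c*p)*(c*p) + q*q + (s*p)*(s*p)) + W33 * (s * s + c*c)
        + (W12 + W21) * ((c*q)*(c*p) - p*q + (s*q)*(s*p))"
      by (simp add: algebra_simps)
    then show ?thesis unfolding a radial' by simp
  qed
  ultimately show ?thesis using radial by algebra
qed

text \<open>No boundary term survives: \<open>V\<phi>\<close> is periodic in \<phi>, and the factor
  \<open>sin \<theta>\<close> vanishes at both poles. Since \<open>V\<close> and \<open>W\<close>
  are ambient fields evaluated along \<open>sph\<close>, the integrands stay continuous at the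
  poles, where the polar frame degenerates. Tangency is assumed off the sphere as well, because it
  is differentiated along rays.\<close>

lemma sphere_divergence_theorem:
  fixes V :: "real^3 \<Rightarrow> real^3" and W :: "real^3 \<Rightarrow> 3 \<Rightarrow> 3 \<Rightarrow> real"
  assumes V: "\<And>y i. norm y = 1 \<Longrightarrow> ((\<lambda>y. V y $ i) has_derivative (\<lambda>v. \<Sum>j\<in>UNIV. W y i j * v $ j)) (at y)"
    and W: "\<And>i j. continuous_on (sphere 0 1) (\<lambda>y. W y i j)"
    and tangential: "\<And>y. y \<noteq> 0 \<Longrightarrow> V y \<bullet> y = 0"
  shows "sphere_int (\<lambda>y. \<Sum>i\<in>UNIV. W y i i) = 0"
proof -
  have V_cont: "continuous_on (sphere 0 1) (\<lambda>y. V y $ i)" for i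
    by (intro has_derivative_continuous_on[where f'="\<lambda>y v. \<Sum>j\<in>UNIV. W y i j * v $ j"])
      (auto intro!: has_derivative_at_withinI V)
  have comp: "continuous_on S (\<lambda>p. g (sph (fst p) (snd p)))" if "continuous_on (sphere 0 1) g"
    for g :: "real^3 \<Rightarrow> real" and S
    by (rule continuous_on_compose2[OF that]) (auto intro!: continuous_on_sph continuous_intros)
  \<comment> \<open>The chain rule along a curve that meets the sphere at \<open>x\<close>. It
    serves the two families of coordinate curves and also the radial ray.\<close>
  have coord: "((\<lambda>x. V (\<gamma> x) $ i) has_field_derivative (\<Sum>j\<in>UNIV. W (\<gamma> x) i j * \<gamma>' $ j)) (at x)"
    if "norm (\<gamma> x) = 1" "\<And>j. ((\<lambda>x. \<gamma> x $ j) has_field_derivative \<gamma>' $ j) (at x)" for \<gamma> :: "real \<Rightarrow> real^3" and \<gamma>' x i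
  proof -
    have "((\<lambda>x. \<gamma> x \<bullet> b) has_derivative (\<lambda>h. (h *\<^sub>R \<gamma>') \<bullet> b)) (at x)" if "b \<in> Basis" for b
    proof -
      obtain j where "b = axis j 1" using \<open>b \<in> Basis\<close> by (auto simp: Basis_vec_def)
      then show ?thesis
        using \<open>\<And>j. ((\<lambda>x. \<gamma> x $ j) has_field_derivative \<gamma>' $ j) (at x)\<close>[of j]
        by (simp add: has_field_derivative_def inner_axis mult_commute_abs)
    qed
    then have "(\<gamma> has_derivative (\<lambda>h. h *\<^sub>R \<gamma>')) (at x)"
      using has_derivative_componentwise_within by blast
    from has_derivative_compose[OF this V[OF that(1)]]
    have "((\<lambda>x. V (\<gamma> x) $ i) has_derivative (\<lambda>h. \<Sum>j\<in>UNIV. W (\<gamma> x) i j * (h *\<^sub>R \<gamma>') $ j)) (at x)" .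
    moreover have "(\<lambda>h. \<Sum>j\<in>UNIV. W (\<gamma> x) i j * (h *\<^sub>R \<gamma>') $ j) = (*) (\<Sum>j\<in>UNIV. W (\<gamma> x) i j * \<gamma>' $ j)"
      by (auto simp: sum_distrib_left mult_ac)
    ultimately show ?thesis by (simp only: has_field_derivative_def)
  qed
  define V\<theta> where "V\<theta> \<theta> \<phi> = (let y = sph \<theta> \<phi> in V y $ 1 * (cos \<theta> * cos \<phi>) + V y $ 2 * (cos \<theta> * sin \<phi>) - V y $ 3 * sin \<theta>)" for \<theta> \<phi>
  define V\<phi> where "V\<phi> \<theta> \<phi> = (let y = sph \<theta> \<phi> in V y $ 2 * cos \<phi> - V y $ 1 * sin \<phi>)" for \<theta> \<phi>
  define D\<theta> where "D\<theta> \<theta> \<phi> = (let y = sph \<theta> \<phi>; W\<theta> = (\<lambda>i. W y i 1 * (cos \<theta> * cos \<phi>) + W y i 2 * (cos \<theta> * sin \<phi>) - W y i 3 * sin \<theta>) in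
     cos \<theta> * V\<theta> \<theta> \<phi> + sin \<theta> * (W\<theta> 1 * (cos \<theta> * cos \<phi>) + W\<theta> 2 * (cos \<theta> * sin \<phi>) - W\<theta> 3 * sin \<theta>
        - (V y $ 1 * (sin \<theta> * cos \<phi>) + V y $ 2 * (sin \<theta> * sin \<phi>) + V y $ 3 * cos \<theta>)))" for \<theta> \<phi>
  define D\<phi> where "D\<phi> \<theta> \<phi> = (let y = sph \<theta> \<phi>; W\<phi> = (\<lambda>i. W y i 2 * cos \<phi> - W y i 1 * sin \<phi>) in
     sin \<theta> * (W\<phi> 1 * (- sin \<phi>) + W\<phi> 2 * cos \<phi>) - V y $ 1 * cos \<phi> - V y $ 2 * sin \<phi>)" for \<theta> \<phi>
  have d\<theta>: "((\<lambda>\<theta>. sin \<theta> * V\<theta> \<theta> \<phi>) has_field_derivative D\<theta> \<theta> \<phi>) (at \<theta>)" for \<theta> \<phi>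
  proof -
    have "((\<lambda>\<theta>. V (sph \<theta> \<phi>) $ i) has_field_derivative (\<Sum>j\<in>UNIV. W (sph \<theta> \<phi>) i j * vector [cos \<theta> * cos \<phi>, cos \<theta> * sin \<phi>, - sin \<theta>] $ j)) (at \<theta>)" for i
    proof (rule coord)
      show "((\<lambda>x. sph x \<phi> $ j) has_real_derivative vector [cos \<theta> * cos \<phi>, cos \<theta> * sin \<phi>, - sin \<theta>] $ j) (at \<theta>)" for j
        using exhaust_3[of j] by (auto intro!: derivative_eq_intros)
    qed simp
    note d = this[unfolded sum_3 vector_3]
    show ?thesis unfolding V\<theta>_def D\<theta>_def Let_def
      by (rule derivative_eq_intros d refl)+ (simp add: algebra_simps)
  qed
  have d\<phi>: "(V\<phi> \<theta> has_field_derivative D\<phi> \<theta> \<phi>) (at \<phi>)" for \<theta> \<phi>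
  proof -
    have "((\<lambda>\<phi>. V (sph \<theta> \<phi>) $ i) has_field_derivative (\<Sum>j\<in>UNIV. W (sph \<theta> \<phi>) i j * vector [- (sin \<theta> * sin \<phi>), sin \<theta> * cos \<phi>, 0] $ j)) (at \<phi>)" for i
    proof (rule coord)
      show "((\<lambda>x. sph \<theta> x $ j) has_real_derivative vector [- (sin \<theta> * sin \<phi>), sin \<theta> * cos \<phi>, 0] $ j) (at \<phi>)" for j
        using exhaust_3[of j] by (auto intro!: derivative_eq_intros)
    qed simp
    note d = this[unfolded sum_3 vector_3]
    show ?thesis unfolding V\<phi>_def[abs_def] D\<phi>_def Let_def
      by (rule derivative_eq_intros d refl)+ (simp add: algebra_simps)
  qed
  have div: "D\<theta> \<theta> \<phi> + D\<phi> \<theta> \<phi> = (\<Sum>i\<in>UNIV. W (sph \<theta> \<phi>) i i) * sin \<theta>" for \<theta> \<phi>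
  proof -
    define y where "y = sph \<theta> \<phi>"
    have y: "norm y = 1" "y \<noteq> 0" by (auto simp: y_def) (metis norm_sph norm_zero zero_neq_one)
    have "((\<lambda>s. V (s *\<^sub>R y) $ i) has_field_derivative (\<Sum>j\<in>UNIV. W y i j * y $ j)) (at 1)" for i
    proof -
      have "((\<lambda>s. (s *\<^sub>R y) $ j) has_field_derivative y $ j) (at 1)" for j
        by (auto intro!: derivative_eq_intros)
      from coord[of "\<lambda>s. s *\<^sub>R y" 1 y i, OF _ this] y show ?thesis by simp
    qed
    then have "((\<lambda>s. \<Sum>i\<in>UNIV. V (s *\<^sub>R y) $ i * y $ i) has_field_derivative
       (\<Sum>i\<in>UNIV. (\<Sum>j\<in>UNIV. W y i j * y $ j) * y $ i)) (at 1)"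
      by (auto intro!: derivative_eq_intros)
    moreover have "((\<lambda>s. \<Sum>i\<in>UNIV. V (s *\<^sub>R y) $ i * y $ i) has_field_derivative 0) (at 1)"
    proof (rule DERIV_cong_ev[THEN iffD2, OF refl _ refl])
      have "(\<Sum>i\<in>UNIV. V (s *\<^sub>R y) $ i * y $ i) = 0" if "s > 0" for s
      proof -
        have "V (s *\<^sub>R y) \<bullet> y = 0" using tangential[of "s *\<^sub>R y"] that y by simp
        then show ?thesis by (simp add: inner_vec_def)
      qed
      moreover have "\<forall>\<^sub>F s in nhds 1. s > (0::real)"
        by (rule order_tendstoD[OF filterlim_ident]) simp
      ultimately show "\<forall>\<^sub>F s in nhds 1. (\<Sum>i\<in>UNIV. V (s *\<^sub>R y) $ i * y $ i) = 0"
        by (auto elim: eventually_mono)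
    qed simp
    ultimately have radial': "(\<Sum>i\<in>UNIV. (\<Sum>j\<in>UNIV. W y i j * y $ j) * y $ i) = 0"
      using DERIV_unique by blast
    have sincos: "(sin \<theta>)\<^sup>2 + (cos \<theta>)\<^sup>2 = 1" "(sin \<phi>)\<^sup>2 + (cos \<phi>)\<^sup>2 = 1" by simp_all
    show ?thesis
      unfolding D\<theta>_def D\<phi>_def V\<theta>_def Let_def sum_3
      by (rule polar_divergence_identity[OF sincos])
        (use tangential[OF y(2)] radial' in \<open>simp_all only: sum_3 inner_vec_def inner_real_def y_def sph_nth\<close>)
  qed
  note conts = comp[OF V_cont] comp[OF W]
  have D\<theta>_cont: "continuous_on S (\<lambda>(\<theta>, \<phi>). D\<theta> \<theta> \<phi>)" and D\<phi>_cont: "continuous_on S (\<lambda>(\<theta>, \<phi>). D\<phi> \<theta> \<phi>)"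
    and V\<theta>_cont: "continuous_on S (\<lambda>(\<theta>, \<phi>). sin \<theta> * V\<theta> \<theta> \<phi>)" for S
    unfolding D\<theta>_def D\<phi>_def V\<theta>_def Let_def split_beta
    by (rule conts continuous_on_add continuous_on_diff continuous_on_minus continuous_on_mult continuous_on_sin continuous_on_cos
        continuous_on_fst continuous_on_snd continuous_on_id)+
  have slice: "continuous_on S (g \<theta>)" if "\<And>S. continuous_on S (\<lambda>(\<theta>, \<phi>). g \<theta> \<phi>)" for S \<theta> and g :: "real \<Rightarrow> real \<Rightarrow> real"
  proof -
    have "continuous_on S (Pair \<theta>)" by (intro continuous_intros)
    from continuous_on_compose2[OF that this, of UNIV] show ?thesis by simp
  qed
  have "integral {0..2*pi} (\<lambda>\<phi>. (\<Sum>i\<in>UNIV. W (sph \<theta> \<phi>) i i) * sin \<theta>) = integral {0..2*pi} (D\<theta> \<theta>)" for \<theta>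
  proof -
    have "(D\<phi> \<theta> has_integral (V\<phi> \<theta> (2 * pi) - V\<phi> \<theta> 0)) {0..2*pi}"
      by (rule fundamental_theorem_of_calculus)
        (auto intro!: has_field_derivative_at_within[OF d\<phi>] simp flip: has_real_derivative_iff_has_vector_derivative)
    moreover have "V\<phi> \<theta> (2 * pi) = V\<phi> \<theta> 0" by (simp add: V\<phi>_def sph_def)
    ultimately have "integral {0..2*pi} (D\<phi> \<theta>) = 0" by (simp add: integral_unique)
    moreover have "D\<theta> \<theta> integrable_on {0..2*pi}" "D\<phi> \<theta> integrable_on {0..2*pi}"
      by (intro integrable_continuous_interval slice D\<theta>_cont D\<phi>_cont)+
    ultimately show ?thesis by (simp flip: div add: integral_add)
  qed
  then have "sphere_int (\<lambda>y. \<Sum>i\<in>UNIV. W y i i) = integral {0..pi} (\<lambda>\<theta>. integral {0..2*pi} (D\<theta> \<theta>))"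
    by (simp add: sphere_int_def)
  also have "\<dots> = 0"
  proof -
    have "((\<lambda>\<theta>. integral (cbox 0 (2*pi)) (\<lambda>\<phi>. sin \<theta> * V\<theta> \<theta> \<phi>)) has_field_derivative
        integral (cbox 0 (2*pi)) (D\<theta> \<theta>)) (at \<theta> within UNIV)" for \<theta>
      by (rule leibniz_rule_field_derivative)
        (auto intro!: d\<theta> D\<theta>_cont integrable_continuous_interval slice V\<theta>_cont)
    then have "((\<lambda>\<theta>. integral {0..2*pi} (\<lambda>\<phi>. sin \<theta> * V\<theta> \<theta> \<phi>)) has_vector_derivative
        integral {0..2*pi} (D\<theta> \<theta>)) (at \<theta> within {0..pi})" for \<theta>
      by (auto intro: has_vector_derivative_at_within simp: has_real_derivative_iff_has_vector_derivative)
    from fundamental_theorem_of_calculus[OF _ this] show ?thesis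
      by (simp add: integral_unique)
  qed
  finally show ?thesis .
qed

section \<open>Integrals over time slabs and currents on them\<close>

definition slab_int :: "real \<Rightarrow> (real \<Rightarrow> real^3 \<Rightarrow> real) \<Rightarrow> real" where
  "slab_int T f = integral {-T..T} (\<lambda>t. sphere_int (f t))"

lemma continuous_on_slices:
  fixes A :: "'a::topological_space \<Rightarrow> 'b::topological_space \<Rightarrow> 'c::topological_space \<Rightarrow> 'd::topological_space"
  assumes "continuous_on (P \<times> Q \<times> S) (\<lambda>(x, y, z). A x y z)"
  shows "x \<in> P \<Longrightarrow> continuous_on (Q \<times> S) (\<lambda>(y, z). A x y z)"
    and "y \<in> Q \<Longrightarrow> continuous_on (P \<times> S) (\<lambda>(x, z). A x y z)"
    and "continuous_on ((P \<times> Q) \<times> S) (\<lambda>(p, z). A (fst p) (snd p) z)"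
proof -
  have "continuous_on (Q \<times> S) (\<lambda>p. (x, fst p, snd p))" for x :: 'a by (intro continuous_intros)
  from continuous_on_compose2[OF assms this, of x]
  show "x \<in> P \<Longrightarrow> continuous_on (Q \<times> S) (\<lambda>(y, z). A x y z)"
    by (simp add: split_beta image_subset_iff mem_Times_iff)
  have "continuous_on (P \<times> S) (\<lambda>p. (fst p, y, snd p))" for y :: 'b by (intro continuous_intros)
  from continuous_on_compose2[OF assms this, of y]
  show "y \<in> Q \<Longrightarrow> continuous_on (P \<times> S) (\<lambda>(x, z). A x y z)"
    by (simp add: split_beta image_subset_iff mem_Times_iff)
  have "continuous_on ((P \<times> Q) \<times> S) (\<lambda>p. (fst (fst p), snd (fst p), snd p))" by (intro continuous_intros)
  from continuous_on_compose2[OF assms this]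
  show "continuous_on ((P \<times> Q) \<times> S) (\<lambda>(p, z). A (fst p) (snd p) z)"
    by (simp add: split_beta image_subset_iff mem_Times_iff)
qed

lemma continuous_on_slice:
  fixes f :: "'a::topological_space \<Rightarrow> 'b::topological_space \<Rightarrow> 'c::topological_space"
  assumes "continuous_on (P \<times> S) (\<lambda>(x, y). f x y)" "x \<in> P"
  shows "continuous_on S (f x)"
proof -
  have "continuous_on S (Pair x)" by (intro continuous_intros)
  from continuous_on_compose2[OF assms(1) this] show ?thesis using assms(2) by (simp add: image_subset_iff)
qed

lemma slab_int_add:
  assumes "continuous_on ({-T..T} \<times> sphere 0 1) (\<lambda>(t, y). f t y)"
    and "continuous_on ({-T..T} \<times> sphere 0 1) (\<lambda>(t, y). g t y)"
  shows "slab_int T (\<lambda>t y. f t y + g t y) = slab_int T f + slab_int T g"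
proof -
  have "slab_int T (\<lambda>t y. f t y + g t y) = integral {-T..T} (\<lambda>t. sphere_int (f t) + sphere_int (g t))"
    unfolding slab_int_def
    by (intro integral_cong sphere_int_add continuous_on_slice[OF assms(1)] continuous_on_slice[OF assms(2)])
  also have "\<dots> = slab_int T f + slab_int T g"
    unfolding slab_int_def
    by (intro integral_add integrable_continuous_interval sphere_int_continuous assms)
  finally show ?thesis .
qed

lemma slab_int_cmult: "slab_int T (\<lambda>t y. c * f t y) = c * slab_int T f"
  by (simp add: slab_int_def sphere_int_cmult)

lemma slab_int_mono:
  assumes "continuous_on ({-T..T} \<times> sphere 0 1) (\<lambda>(t, y). f t y)"
    and "continuous_on ({-T..T} \<times> sphere 0 1) (\<lambda>(t, y). g t y)"
    and "\<And>t y. \<bar>t\<bar> \<le> T \<Longrightarrow> norm y = 1 \<Longrightarrow> f t y \<le> g t y"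
  shows "slab_int T f \<le> slab_int T g"
  unfolding slab_int_def
proof (intro integral_le integrable_continuous_interval sphere_int_continuous assms)
  show "sphere_int (f t) \<le> sphere_int (g t)" if "t \<in> {-T..T}" for t
    using that assms(3)
    by (intro sphere_int_mono continuous_on_slice[OF assms(1)] continuous_on_slice[OF assms(2)]) auto
qed

lemma slab_int_nonneg:
  assumes "continuous_on ({-T..T} \<times> sphere 0 1) (\<lambda>(t, y). f t y)"
    and "\<And>t y. \<bar>t\<bar> \<le> T \<Longrightarrow> norm y = 1 \<Longrightarrow> 0 \<le> f t y"
  shows "0 \<le> slab_int T f"
proof -
  have "continuous_on ({-T..T} \<times> sphere 0 1) (\<lambda>(t, y :: real^3). 0 :: real)"
    unfolding split_beta by (rule continuous_on_const)
  from slab_int_mono[OF this assms] show ?thesis by (simp add: slab_int_def sphere_int_def)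
qed

text \<open>\<open>B\<close> is the time component of a current and vanishes at both ends of the
  slab; \<open>V\<close> is its spherical part, with matrix of partial derivatives \<open>W\<close>.
  The trace of \<open>W\<close> is the ambient divergence and integrates to zero over the sphere at
  each fixed time.\<close>

lemma slab_divergence_theorem:
  fixes V :: "real \<Rightarrow> real^3 \<Rightarrow> real^3" and W :: "real \<Rightarrow> real^3 \<Rightarrow> 3 \<Rightarrow> 3 \<Rightarrow> real"
  assumes T: "0 \<le> T"
    and B: "\<And>t y. \<bar>t\<bar> \<le> T \<Longrightarrow> norm y = 1 \<Longrightarrow> ((\<lambda>t. B t y) has_field_derivative B' t y) (at t)"
    and B_cont: "\<And>t. \<bar>t\<bar> \<le> T \<Longrightarrow> continuous_on (sphere 0 1) (B t)"
    and B'_cont: "continuous_on ({-T..T} \<times> sphere 0 1) (\<lambda>(t, y). B' t y)"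
    and B_ends: "\<And>y. norm y = 1 \<Longrightarrow> B T y = 0" "\<And>y. norm y = 1 \<Longrightarrow> B (-T) y = 0"
    and V: "\<And>t y i. \<bar>t\<bar> \<le> T \<Longrightarrow> norm y = 1 \<Longrightarrow>
       ((\<lambda>y. V t y $ i) has_derivative (\<lambda>v. \<Sum>j\<in>UNIV. W t y i j * v $ j)) (at y)"
    and W: "\<And>i j. continuous_on ({-T..T} \<times> sphere 0 1) (\<lambda>(t, y). W t y i j)"
    and tangential: "\<And>t y. \<bar>t\<bar> \<le> T \<Longrightarrow> y \<noteq> 0 \<Longrightarrow> V t y \<bullet> y = 0"
  shows "slab_int T (\<lambda>t y. B' t y + (\<Sum>i\<in>UNIV. W t y i i)) = 0"
proof -
  have W_slice: "continuous_on (sphere 0 1) (\<lambda>y. W t y i j)" if "\<bar>t\<bar> \<le> T" for t i j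
    using that by (intro continuous_on_slice[OF W]) auto
  have "slab_int T (\<lambda>t y. B' t y + (\<Sum>i\<in>UNIV. W t y i i)) = integral {-T..T} (\<lambda>t. sphere_int (B' t))"
    unfolding slab_int_def
  proof (intro integral_cong)
    fix t assume "t \<in> {-T..T}"
    then have t: "\<bar>t\<bar> \<le> T" by auto
    have "continuous_on (sphere 0 1) (B' t)"
      using t by (intro continuous_on_slice[OF B'_cont]) auto
    then have "sphere_int (\<lambda>y. B' t y + (\<Sum>i\<in>UNIV. W t y i i)) = sphere_int (B' t) + sphere_int (\<lambda>y. \<Sum>i\<in>UNIV. W t y i i)"
      by (intro sphere_int_add continuous_on_sum W_slice t)
    moreover have "sphere_int (\<lambda>y. \<Sum>i\<in>UNIV. W t y i i) = 0"
      by (rule sphere_divergence_theorem[OF V[OF t] W_slice[OF t] tangential[OF t]])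
    ultimately show "sphere_int (\<lambda>y. B' t y + (\<Sum>i\<in>UNIV. W t y i i)) = sphere_int (B' t)" by simp
  qed
  also have "\<dots> = sphere_int (B T) - sphere_int (B (-T))"
  proof (intro integral_unique fundamental_theorem_of_calculus)
    fix t assume t: "t \<in> {-T..T}"
    have "((\<lambda>t. sphere_int (B t)) has_field_derivative sphere_int (B' t)) (at t within {-T..T})"
    proof (rule sphere_int_derivative[OF _ _ B'_cont t])
      show "((\<lambda>t. B t y) has_field_derivative B' t y) (at t within {-T..T})"
        if "t \<in> {-T..T}" "norm y = 1" for t y
        using that by (intro has_field_derivative_at_within[OF B]) auto
    qed (auto intro!: B_cont)
    then show "((\<lambda>t. sphere_int (B t)) has_vector_derivative sphere_int (B' t)) (at t within {-T..T})"
      by (simp add: has_real_derivative_iff_has_vector_derivative)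
  qed (use T in auto)
  also have "\<dots> = 0"
    using sphere_int_cong[of "B T" "\<lambda>_. 0"] sphere_int_cong[of "B (-T)" "\<lambda>_. 0"] B_ends by simp
  finally show ?thesis .
qed

text \<open>The \<open>r\<close>-derivative of the density \<open>A\<close> is dominated by the
  divergence of a current along the slice. The slab is the same for all \<open>r\<close>, so
  Leibniz' rule meets no moving boundary; a shrinking domain has to be built into the functions
  themselves, which is where \<open>B_ends\<close> will come from.\<close>

lemma slab_int_current_antimono:
  fixes V :: "real \<Rightarrow> real \<Rightarrow> real^3 \<Rightarrow> real^3" and W :: "real \<Rightarrow> real \<Rightarrow> real^3 \<Rightarrow> 3 \<Rightarrow> 3 \<Rightarrow> real"
  assumes r: "r\<^sub>1 \<le> r\<^sub>2" and T: "0 \<le> T"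
    and A: "\<And>r t y. r \<in> {r\<^sub>1..r\<^sub>2} \<Longrightarrow> \<bar>t\<bar> \<le> T \<Longrightarrow> norm y = 1 \<Longrightarrow>
       ((\<lambda>r. A r t y) has_field_derivative A' r t y) (at r)"
    and A_cont: "continuous_on ({r\<^sub>1..r\<^sub>2} \<times> {-T..T} \<times> sphere 0 1) (\<lambda>(r, t, y). A r t y)"
    and A'_cont: "continuous_on ({r\<^sub>1..r\<^sub>2} \<times> {-T..T} \<times> sphere 0 1) (\<lambda>(r, t, y). A' r t y)"
    and B: "\<And>r t y. r \<in> {r\<^sub>1..r\<^sub>2} \<Longrightarrow> \<bar>t\<bar> \<le> T \<Longrightarrow> norm y = 1 \<Longrightarrow>
       ((\<lambda>t. B r t y) has_field_derivative B' r t y) (at t)"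
    and B_cont: "continuous_on ({r\<^sub>1..r\<^sub>2} \<times> {-T..T} \<times> sphere 0 1) (\<lambda>(r, t, y). B r t y)"
    and B'_cont: "continuous_on ({r\<^sub>1..r\<^sub>2} \<times> {-T..T} \<times> sphere 0 1) (\<lambda>(r, t, y). B' r t y)"
    and B_ends: "\<And>r y. r \<in> {r\<^sub>1..r\<^sub>2} \<Longrightarrow> norm y = 1 \<Longrightarrow> B r T y = 0"
      "\<And>r y. r \<in> {r\<^sub>1..r\<^sub>2} \<Longrightarrow> norm y = 1 \<Longrightarrow> B r (-T) y = 0"
    and V: "\<And>r t y i. r \<in> {r\<^sub>1..r\<^sub>2} \<Longrightarrow> \<bar>t\<bar> \<le> T \<Longrightarrow> norm y = 1 \<Longrightarrow>
       ((\<lambda>y. V r t y $ i) has_derivative (\<lambda>v. \<Sum>j\<in>UNIV. W r t y i j * v $ j)) (at y)"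
    and W: "\<And>i j. continuous_on ({r\<^sub>1..r\<^sub>2} \<times> {-T..T} \<times> sphere 0 1) (\<lambda>(r, t, y). W r t y i j)"
    and tangential: "\<And>r t y. r \<in> {r\<^sub>1..r\<^sub>2} \<Longrightarrow> \<bar>t\<bar> \<le> T \<Longrightarrow> y \<noteq> 0 \<Longrightarrow> V r t y \<bullet> y = 0"
    and le: "\<And>r t y. r \<in> {r\<^sub>1..r\<^sub>2} \<Longrightarrow> \<bar>t\<bar> \<le> T \<Longrightarrow> norm y = 1 \<Longrightarrow>
       A' r t y \<le> B' r t y + (\<Sum>i\<in>UNIV. W r t y i i)"
  shows "slab_int T (A r\<^sub>2) \<le> slab_int T (A r\<^sub>1)"
proof -
  have slice: "continuous_on (sphere 0 1) (f r t)"
    if "continuous_on ({r\<^sub>1..r\<^sub>2} \<times> {-T..T} \<times> sphere 0 1) (\<lambda>(r, t, y). f r t y)" "r \<in> {r\<^sub>1..r\<^sub>2}" "t \<in> {-T..T}"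
    for f :: "real \<Rightarrow> real \<Rightarrow> real^3 \<Rightarrow> real" and r t
    using continuous_on_slice[OF continuous_on_slices(1)[OF that(1,2)] that(3)] .
  have deriv: "((\<lambda>r. slab_int T (A r)) has_field_derivative slab_int T (A' r)) (at r within {r\<^sub>1..r\<^sub>2})"
    if r: "r \<in> {r\<^sub>1..r\<^sub>2}" for r
    unfolding slab_int_def box_real[symmetric]
  proof (intro leibniz_rule_field_derivative[where f="\<lambda>r t. sphere_int (A r t)"])
    show "((\<lambda>r. sphere_int (A r t)) has_field_derivative sphere_int (A' r t)) (at r within cbox r\<^sub>1 r\<^sub>2)"
      if "r \<in> cbox r\<^sub>1 r\<^sub>2" "t \<in> cbox (-T) T" for r t
    proof (intro sphere_int_derivative)
      show "((\<lambda>r. A r t y) has_field_derivative A' r t y) (at r within cbox r\<^sub>1 r\<^sub>2)"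
        if "r \<in> cbox r\<^sub>1 r\<^sub>2" "norm y = 1" for r y
        using that \<open>t \<in> cbox (-T) T\<close> by (intro has_field_derivative_at_within[OF A]) auto
    qed (use that in \<open>auto intro!: slice[OF A_cont] continuous_on_slices(2)[OF A'_cont]\<close>)
    show "(\<lambda>t. sphere_int (A r t)) integrable_on cbox (- T) T" if "r \<in> cbox r\<^sub>1 r\<^sub>2" for r
      unfolding box_real
      by (intro integrable_continuous_interval sphere_int_continuous continuous_on_slices(1)[OF A_cont]) (use that in auto)
    show "continuous_on (cbox r\<^sub>1 r\<^sub>2 \<times> cbox (- T) T) (\<lambda>(r, t). sphere_int (A' r t))"
      using sphere_int_continuous[OF continuous_on_slices(3)[OF A'_cont]] by (simp add: split_beta)
  qed (use r in auto)
  have nonpos: "slab_int T (A' r) \<le> 0" if r: "r \<in> {r\<^sub>1..r\<^sub>2}" for r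
  proof -
    have W_sum: "continuous_on ({-T..T} \<times> sphere 0 1) (\<lambda>p. \<Sum>i\<in>UNIV. W r (fst p) (snd p) i i)"
      using continuous_on_slices(1)[OF W r] by (intro continuous_on_sum) (simp add: split_beta)
    have "slab_int T (A' r) \<le> slab_int T (\<lambda>t y. B' r t y + (\<Sum>i\<in>UNIV. W r t y i i))"
      using continuous_on_add[OF continuous_on_slices(1)[OF B'_cont r, unfolded split_beta] W_sum]
      by (intro slab_int_mono continuous_on_slices(1)[OF A'_cont r] le[OF r]) (auto simp: split_beta)
    also have "\<dots> = 0"
      by (rule slab_divergence_theorem[OF T B[OF r] slice[OF B_cont r] continuous_on_slices(1)[OF B'_cont r]
            B_ends[OF r] V[OF r] continuous_on_slices(1)[OF W r] tangential[OF r]]) auto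
    finally show ?thesis .
  qed
  have "((\<lambda>r. slab_int T (A' r)) has_integral (slab_int T (A r\<^sub>2) - slab_int T (A r\<^sub>1))) {r\<^sub>1..r\<^sub>2}"
    using r deriv by (intro fundamental_theorem_of_calculus) (auto simp: has_real_derivative_iff_has_vector_derivative)
  from has_integral_le[OF this has_integral_0 nonpos] show ?thesis by simp
qed

section \<open>Comparison with the Lebesgue integrals that define the energy\<close>

lemma nn_integral_open_interval:
  fixes g :: "real \<Rightarrow> real"
  assumes "continuous_on {a..b} g" "\<And>x. x \<in> {a<..<b} \<Longrightarrow> 0 \<le> g x"
  shows "(\<integral>\<^sup>+ x. ennreal (g x) * indicator {a<..<b} x \<partial>lborel) = ennreal (integral {a..b} g)"
proof -
  have "(g has_integral integral {a..b} g) (cbox a b)"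
    unfolding box_real by (intro integrable_integral integrable_continuous_interval assms(1))
  then have "(g has_integral integral {a..b} g) (box a b)"
    by (simp only: has_integral_open_interval)
  from nn_integral_has_integral_lebesgue[OF _ this] assms(2)
  have "(\<integral>\<^sup>+ x. ennreal (indicator {a<..<b} x * g x) \<partial>lborel) = ennreal (integral {a..b} g)" by simp
  moreover have "ennreal (indicator {a<..<b} x * g x) = ennreal (g x) * indicator {a<..<b} x" for x
    by (simp add: indicator_def)
  ultimately show ?thesis by simp
qed

lemma nn_integral_sphere:
  assumes "continuous_on (sphere 0 1) f" "\<And>y. norm y = 1 \<Longrightarrow> 0 \<le> f y"
  shows "(\<integral>\<^sup>+ \<theta>. (\<integral>\<^sup>+ \<phi>. ennreal (f (sph \<theta> \<phi>) * sin \<theta>) * indicator {0<..<2*pi} \<phi> \<partial>lborel)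
      * indicator {0<..<pi} \<theta> \<partial>lborel) = ennreal (sphere_int f)"
proof -
  have nonneg: "0 \<le> f (sph \<theta> \<phi>) * sin \<theta>" if "\<theta> \<in> {0<..<pi}" for \<theta> \<phi>
    using that assms(2) by (auto intro!: mult_nonneg_nonneg sin_ge_zero)
  have "(\<integral>\<^sup>+ \<phi>. ennreal (f (sph \<theta> \<phi>) * sin \<theta>) * indicator {0<..<2*pi} \<phi> \<partial>lborel) * indicator {0<..<pi} \<theta>
     = ennreal (integral {0..2*pi} (\<lambda>\<phi>. f (sph \<theta> \<phi>) * sin \<theta>)) * indicator {0<..<pi} \<theta>" for \<theta>
    using nn_integral_open_interval[OF continuous_on_meridian[OF assms(1)], of 0 "2*pi" \<theta>] nonneg[of \<theta>]
    by (cases "\<theta> \<in> {0<..<pi}") auto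
  then show ?thesis
    using nonneg
    by (simp only: sphere_int_def)
      (intro nn_integral_open_interval continuous_on_parallel_integral assms(1) integral_nonneg
        integrable_continuous_interval continuous_on_meridian nonneg)
qed

lemma int_tS2_eq:
  assumes "continuous_on (UNIV \<times> sphere 0 1) (\<lambda>(t, y). F t y)" "\<And>t y. norm y = 1 \<Longrightarrow> 0 \<le> F t y"
  shows "int_tS2 F = (\<integral>\<^sup>+ t. ennreal (sphere_int (F t)) \<partial>lborel)"
  unfolding int_tS2_def
  by (intro nn_integral_cong nn_integral_sphere continuous_on_slice[OF assms(1)] assms(2)) auto

lemma slab_int_le_int_tS2:
  assumes F: "continuous_on (UNIV \<times> sphere 0 1) (\<lambda>(t, y). F t y)" "\<And>t y. norm y = 1 \<Longrightarrow> 0 \<le> F t y"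
  shows "ennreal (slab_int T F) \<le> int_tS2 F"
proof -
  have "continuous_on {-T..T} (\<lambda>t. sphere_int (F t))"
    by (rule continuous_on_subset[OF sphere_int_continuous[OF F(1)]]) auto
  moreover have "0 \<le> sphere_int (F t)" for t
    by (intro sphere_int_nonneg continuous_on_slice[OF F(1)] F(2)) auto
  ultimately have "ennreal (slab_int T F) = (\<integral>\<^sup>+ t. ennreal (sphere_int (F t)) * indicator {-T<..<T} t \<partial>lborel)"
    unfolding slab_int_def by (intro nn_integral_open_interval[symmetric])
  also have "\<dots> \<le> (\<integral>\<^sup>+ t. ennreal (sphere_int (F t)) \<partial>lborel)"
    by (intro nn_integral_mono) (simp add: indicator_def)
  also have "\<dots> = int_tS2 F"
    by (rule int_tS2_eq[OF F, symmetric])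
  finally show ?thesis .
qed

text \<open>Fatou's lemma for the truncated products: a fixed time eventually lies inside the slab,
  and the cutoffs tend to 1 there. All integrals take values in the extended nonnegative reals, so
  slices of infinite energy are covered.\<close>

lemma int_tS2_le_of_cutoffs:
  fixes \<kappa> :: "nat \<Rightarrow> real \<Rightarrow> real"
  assumes F: "continuous_on (UNIV \<times> sphere 0 1) (\<lambda>(t, y). F t y)" "\<And>t y. norm y = 1 \<Longrightarrow> 0 \<le> F t y"
    and \<kappa>: "\<And>n. continuous_on UNIV (\<kappa> n)" "\<And>n t. 0 \<le> \<kappa> n t" "\<And>t. (\<lambda>n. \<kappa> n t) \<longlonglongrightarrow> 1"
    and T: "filterlim T at_top sequentially"
    and le: "\<And>n. ennreal (slab_int (T n) (\<lambda>t y. \<kappa> n t * F t y)) \<le> C"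
  shows "int_tS2 F \<le> C"
proof -
  define S where "S t = sphere_int (F t)" for t
  define u where "u n t = ennreal (\<kappa> n t * S t) * indicator {-T n<..<T n} t" for n t
  have S_cont: "continuous_on UNIV S" unfolding S_def by (rule sphere_int_continuous[OF F(1)])
  have S_nonneg: "0 \<le> S t" for t
    unfolding S_def by (intro sphere_int_nonneg continuous_on_slice[OF F(1)] F(2)) auto
  have "(\<lambda>n. u n t) \<longlonglongrightarrow> ennreal (S t)" for t
  proof (rule Lim_transform_eventually)
    have "(\<lambda>n. \<kappa> n t * S t) \<longlonglongrightarrow> 1 * S t" by (intro tendsto_intros \<kappa>(3))
    then show "(\<lambda>n. ennreal (\<kappa> n t * S t)) \<longlonglongrightarrow> ennreal (S t)" by (intro tendsto_ennrealI) simp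
    show "\<forall>\<^sub>F n in sequentially. ennreal (\<kappa> n t * S t) = u n t"
      using filterlim_at_top_dense[THEN iffD1, OF T, rule_format, of "\<bar>t\<bar>"]
      by eventually_elim (auto simp: u_def indicator_def)
  qed
  then have liminf: "ennreal (S t) = liminf (\<lambda>n. u n t)" for t
    by (metis lim_imp_Liminf trivial_limit_sequentially)
  have meas: "u n \<in> borel_measurable lborel" for n
    unfolding u_def
    by (intro borel_measurable_times_ennreal measurable_compose[OF _ measurable_ennreal] borel_measurable_indicator)
      (auto intro!: borel_measurable_continuous_onI continuous_on_mult \<kappa>(1) S_cont)
  have u_le: "(\<integral>\<^sup>+ t. u n t \<partial>lborel) \<le> C" for n
  proof -
    have "continuous_on {-T n..T n} (\<lambda>t. \<kappa> n t * S t)"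
      by (rule continuous_on_subset[OF continuous_on_mult[OF \<kappa>(1) S_cont]]) simp
    then have "(\<integral>\<^sup>+ t. u n t \<partial>lborel) = ennreal (integral {-T n..T n} (\<lambda>t. \<kappa> n t * S t))"
      unfolding u_def by (intro nn_integral_open_interval) (simp_all add: \<kappa>(2) S_nonneg)
    also have "\<dots> \<le> C" using le[of n] by (simp add: slab_int_def sphere_int_cmult S_def)
    finally show ?thesis .
  qed
  have "int_tS2 F = (\<integral>\<^sup>+ t. ennreal (S t) \<partial>lborel)"
    unfolding S_def by (rule int_tS2_eq[OF F])
  also have "\<dots> = (\<integral>\<^sup>+ t. liminf (\<lambda>n. u n t) \<partial>lborel)"
    by (simp only: liminf)
  also have "\<dots> \<le> liminf (\<lambda>n. \<integral>\<^sup>+ t. u n t \<partial>lborel)"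
    by (rule nn_integral_liminf[OF meas])
  also have "\<dots> \<le> liminf (\<lambda>n. C)" by (rule Liminf_mono) (simp add: u_le)
  also have "\<dots> = C" by (simp add: Liminf_const)
  finally show ?thesis .
qed

section \<open>Derivatives of functions of \<open>(r, t, y)\<close>\<close>

text \<open>Uncurrying turns \<open>d_r\<close>, \<open>d_t\<close> and \<open>d_x\<close> into
  \<open>pd\<close> along basis vectors of a single Euclidean space, so that smoothness and the
  symmetry of second derivatives carry over from \<open>Cinf_on\<close>.\<close>

definition unc :: "sfun \<Rightarrow> real \<times> real \<times> (real^3) \<Rightarrow> real" where
  "unc f p = f (fst p) (fst (snd p)) (snd (snd p))"

definition exterior :: "real \<Rightarrow> (real \<times> real \<times> (real^3)) set" where
  "exterior R = {R<..} \<times> UNIV \<times> (UNIV - {0})"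

definition smooth :: "real \<Rightarrow> sfun \<Rightarrow> bool" where
  "smooth R f \<longleftrightarrow> Cinf_on (exterior R) (unc f)"

lemma open_exterior: "open (exterior R)"
  unfolding exterior_def by (intro open_Times) auto

lemma mem_exterior [simp]: "(r, t, y) \<in> exterior R \<longleftrightarrow> R < r \<and> y \<noteq> 0"
  by (simp add: exterior_def)

lemma Basis_spacetime:
  "(1, 0, 0) \<in> (Basis :: (real \<times> real \<times> (real^3)) set)"
  "(0, 1, 0) \<in> (Basis :: (real \<times> real \<times> (real^3)) set)"
  "(0, 0, axis i 1) \<in> (Basis :: (real \<times> real \<times> (real^3)) set)"
  by (auto simp: Basis_prod_def image_iff zero_prod_def axis_in_Basis_iff)

lemma deriv_at_eq_deriv_at_0: "deriv (f :: real \<Rightarrow> real) x = deriv (\<lambda>s. f (x + s)) 0"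
  unfolding deriv_def using DERIV_shift[of f _ 0 x] by (simp add: add.commute)

lemma unc_d:
  "unc (d_r f) = pd (1, 0, 0) (unc f)"
  "unc (d_t f) = pd (0, 1, 0) (unc f)"
  "unc (d_x i f) = pd (0, 0, axis i 1) (unc f)"
  using deriv_at_eq_deriv_at_0[of "\<lambda>s. f s t y" r for t y r] deriv_at_eq_deriv_at_0[of "\<lambda>s. f r s y" t for r y t]
  by (simp_all add: fun_eq_iff unc_def pd_def d_r_def d_t_def d_x_def)

lemma smooth_d:
  assumes "smooth R f"
  shows smooth_d_r: "smooth R (d_r f)" and smooth_d_t: "smooth R (d_t f)" and smooth_d_x: "smooth R (d_x i f)"
  using assms by (auto simp: smooth_def unc_d intro!: Cinf_on_pd Basis_spacetime)

lemma smooth_continuous_on: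
  assumes "smooth R f" "X \<subseteq> exterior R"
  shows "continuous_on X (\<lambda>p. f (fst p) (fst (snd p)) (snd (snd p)))"
  using continuous_on_subset[OF Cinf_on_imp_continuous_on assms(2)] assms(1)
  by (simp add: smooth_def unc_def[abs_def])

lemma
  assumes f: "smooth R f" and p: "R < r" "y \<noteq> 0"
  shows d_r_derivative: "((\<lambda>r. f r t y) has_field_derivative d_r f r t y) (at r)"
    and d_t_derivative: "((\<lambda>t. f r t y) has_field_derivative d_t f r t y) (at t)"
    and d_x_derivative: "(f r t has_derivative (\<lambda>v. \<Sum>j\<in>UNIV. d_x j f r t y * v $ j)) (at y)"
proof -
  have diff: "unc f differentiable (at (r, t, y))"
    using f p by (intro Cinf_on_imp_differentiable[of "exterior R"]) (auto simp: smooth_def)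
  show "((\<lambda>r. f r t y) has_field_derivative d_r f r t y) (at r)"
    using pd_line[of "unc f" "(0, t, y)" r "(1, 0, 0)"] diff Basis_spacetime(1)
    by (simp add: unc_d[symmetric]) (simp add: unc_def)
  show "((\<lambda>t. f r t y) has_field_derivative d_t f r t y) (at t)"
    using pd_line[of "unc f" "(r, 0, y)" t "(0, 1, 0)"] diff Basis_spacetime(2)
    by (simp add: unc_d[symmetric]) (simp add: unc_def)
  have "(\<lambda>y. unc f (r, t, y)) differentiable (at y)"
    by (rule differentiable_compose[of "unc f" "\<lambda>y. (r, t, y)"])
      (use diff in \<open>auto simp: differentiable_def intro!: exI derivative_eq_intros\<close>)
  then have "f r t differentiable (at y)" by (simp add: unc_def[abs_def])
  from pd_has_derivative[OF this]
  have "(f r t has_derivative (\<lambda>v. \<Sum>b\<in>Basis. (v \<bullet> b) * pd b (f r t) y)) (at y)" .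
  moreover have "(\<Sum>b\<in>Basis. (v \<bullet> b) * pd b (f r t) y) = (\<Sum>j\<in>UNIV. d_x j f r t y * v $ j)" for v
  proof -
    have B: "(Basis :: (real^3) set) = range (\<lambda>j. axis j 1)" by (auto simp: Basis_vec_def)
    have "inj (\<lambda>j::3. axis j (1::real))" by (auto simp: inj_on_def axis_eq_axis)
    then show ?thesis
      unfolding B by (simp add: sum.reindex inner_axis pd_def d_x_def mult.commute)
  qed
  ultimately show "(f r t has_derivative (\<lambda>v. \<Sum>j\<in>UNIV. d_x j f r t y * v $ j)) (at y)" by simp
qed

lemma
  assumes f: "smooth R f" and p: "R < r" "y \<noteq> 0"
  shows d_r_d_t: "d_r (d_t f) r t y = d_t (d_r f) r t y"
    and d_r_d_x: "d_r (d_x i f) r t y = d_x i (d_r f) r t y"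
proof -
  have comm: "pd b (pd c (unc f)) (r, t, y) = pd c (pd b (unc f)) (r, t, y)" if "b \<in> Basis" "c \<in> Basis" for b c
    by (rule pd_commute[OF open_exterior[of R]]) (use assms that in \<open>auto simp: smooth_def\<close>)
  show "d_r (d_t f) r t y = d_t (d_r f) r t y"
    using comm[OF Basis_spacetime(1,2)] by (simp add: unc_d[symmetric]) (simp add: unc_def)
  show "d_r (d_x i f) r t y = d_x i (d_r f) r t y"
    using comm[OF Basis_spacetime(1) Basis_spacetime(3)[of i]] by (simp add: unc_d[symmetric]) (simp add: unc_def)
qed

text \<open>An identity that holds throughout the open exterior may be differentiated. This is how
  the symmetry of second derivatives is used one order higher.\<close>

lemma d_cong:
  assumes "\<And>r t y. R < r \<Longrightarrow> y \<noteq> 0 \<Longrightarrow> f r t y = g r t y" and p: "R < r" "y \<noteq> 0"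
  shows "d_r f r t y = d_r g r t y" and d_t_cong: "d_t f r t y = d_t g r t y" and d_x_cong: "d_x i f r t y = d_x i g r t y"
proof -
  have "pd b (unc f) (r, t, y) = pd b (unc g) (r, t, y)" for b
  proof (rule pd_cong_open[OF open_exterior[of R]])
    show "unc f x = unc g x" if "x \<in> exterior R" for x
      using that assms(1) by (cases x) (simp add: unc_def)
  qed (use p in simp)
  from this[folded unc_d, of "(1,0,0)"] this[folded unc_d, of "(0,1,0)"] this[folded unc_d, of "(0,0,axis i 1)"]
  show "d_r f r t y = d_r g r t y" "d_t f r t y = d_t g r t y" "d_x i f r t y = d_x i g r t y"
    by (simp_all add: unc_d[symmetric]) (simp_all add: unc_def)
qed

lemma d_cmult: 
  assumes "smooth R f" "R < r" "y \<noteq> 0"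
  shows "d_t (\<lambda>r t y. c r * f r t y) r t y = c r * d_t f r t y"
    and "d_x i (\<lambda>r t y. c r * f r t y) r t y = c r * d_x i f r t y"
proof -
  show "d_t (\<lambda>r t y. c r * f r t y) r t y = c r * d_t f r t y"
    unfolding d_t_def[of "\<lambda>r t y. c r * f r t y"]
    by (intro DERIV_imp_deriv DERIV_cmult d_t_derivative[OF assms])
  have "((\<lambda>s. f r t (y + s *\<^sub>R axis i 1)) has_field_derivative d_x i f r t y) (at 0)"
  proof -
    have "((\<lambda>s. f r t (y + s *\<^sub>R axis i 1)) has_derivative (\<lambda>h. \<Sum>j\<in>UNIV. d_x j f r t y * (h *\<^sub>R axis i 1) $ j)) (at 0)"
      by (rule has_derivative_compose[where g="f r t" and f="\<lambda>s. y + s *\<^sub>R axis i 1"])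
        (use d_x_derivative[OF assms] in \<open>auto intro!: derivative_eq_intros\<close>)
    moreover have "(\<lambda>h. \<Sum>j\<in>UNIV. d_x j f r t y * (h *\<^sub>R axis i 1) $ j) = (*) (d_x i f r t y)"
      by (auto simp: axis_def if_distrib[where f="\<lambda>x. _ * x"] sum.delta cong: if_cong)
    ultimately show ?thesis by (simp add: has_field_derivative_def)
  qed
  then show "d_x i (\<lambda>r t y. c r * f r t y) r t y = c r * d_x i f r t y"
    unfolding d_x_def[of i "\<lambda>r t y. c r * f r t y"]
    by (intro DERIV_imp_deriv DERIV_cmult)
qed

text \<open>Euler's relation for degree 0: \<open>f\<close> is constant along the ray through
  \<open>y\<close>. It makes the ambient gradient tangential to the spheres, as
  \<open>sphere_divergence_theorem\<close> demands.\<close>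

lemma radial_d_x_zero:
  assumes f: "smooth R f" and hom: "\<And>s. s > 0 \<Longrightarrow> f r t (s *\<^sub>R y) = f r t y" and p: "R < r" "y \<noteq> 0"
  shows "(\<Sum>j\<in>UNIV. d_x j f r t y * y $ j) = 0"
proof -
  have "((\<lambda>s. f r t (s *\<^sub>R y)) has_derivative (\<lambda>h. \<Sum>j\<in>UNIV. d_x j f r t y * (h *\<^sub>R y) $ j)) (at 1)"
    by (rule has_derivative_compose[where g="f r t" and f="\<lambda>s. s *\<^sub>R y"])
      (use d_x_derivative[OF f p] in \<open>auto intro!: derivative_eq_intros\<close>)
  moreover have "(\<lambda>h. \<Sum>j\<in>UNIV. d_x j f r t y * (h *\<^sub>R y) $ j) = (*) (\<Sum>j\<in>UNIV. d_x j f r t y * y $ j)"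
    by (auto simp: sum_distrib_left mult_ac)
  ultimately have "((\<lambda>s. f r t (s *\<^sub>R y)) has_field_derivative (\<Sum>j\<in>UNIV. d_x j f r t y * y $ j)) (at 1)"
    by (simp only: has_field_derivative_def)
  moreover have "((\<lambda>s. f r t (s *\<^sub>R y)) has_field_derivative 0) (at 1)"
  proof (rule DERIV_cong_ev[THEN iffD2, OF refl _ refl])
    have "\<forall>\<^sub>F s in nhds 1. s > (0::real)"
      by (rule order_tendstoD[OF filterlim_ident]) simp
    then show "\<forall>\<^sub>F s in nhds 1. f r t (s *\<^sub>R y) = f r t y"
      by eventually_elim (rule hom)
  qed simp
  ultimately show ?thesis using DERIV_unique by blast
qed

text \<open>Made for \<open>r * D r = \<Lambda> / 3 * r^3 - r + 2 * m\<close>: this factor is a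
  polynomial, so smoothness of \<open>Xs \<Lambda> m \<psi>\<close> follows from sums and products,
  without differentiating \<open>1 / r\<close>.\<close>

lemma smooth_polynomial_mult:
  assumes "smooth R f"
  shows "smooth R (\<lambda>r t y. (c * r ^ 3 - r + e) * f r t y)"
proof -
  have fst: "Ck k (exterior R) (\<lambda>p. fst p)" for k
    using Ck_inner[of k "exterior R" "(1, 0, 0)"] by (simp add: inner_prod_def)
  have "Ck k (exterior R) (\<lambda>p. (c * (fst p * (fst p * fst p)) + (-1) * fst p + e) * unc f p)" for k
    using assms by (intro Ck_mult Ck_add Ck_const fst open_exterior) (auto simp: smooth_def Cinf_on_def)
  then show ?thesis
    by (simp add: smooth_def Cinf_on_def unc_def[abs_def] power3_eq_cube mult.assoc)
qed

definition dot_x :: "sfun \<Rightarrow> sfun \<Rightarrow> sfun" where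
  "dot_x f g r t y = (\<Sum>i\<in>UNIV. d_x i f r t y * d_x i g r t y)"

lemma grad_sq_eq_dot_x: "grad_sq f = dot_x f f"
  by (simp add: fun_eq_iff grad_sq_def dot_x_def power2_eq_square)

lemma dot_x_commute: "dot_x f g r t y = dot_x g f r t y"
  by (simp add: dot_x_def mult.commute)

lemma dot_x_self_nonneg: "0 \<le> dot_x f f r t y"
  by (simp add: dot_x_def sum_nonneg)

lemma dot_x_young:
  assumes "k > 0"
  shows "2 * \<bar>dot_x f g r t y\<bar> \<le> k * dot_x f f r t y + dot_x g g r t y / k"
proof -
  have "2 * \<bar>a * b\<bar> \<le> k * (a * a) + (b * b) / k" for a b :: real
  proof -
    have "0 \<le> (k * \<bar>a\<bar> - \<bar>b\<bar>)\<^sup>2 / k" using assms by simp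
    also have "\<dots> = k * (a * a) + b * b / k - 2 * \<bar>a * b\<bar>"
      using assms by (simp add: field_simps power2_eq_square abs_mult)
    finally show ?thesis by simp
  qed
  then have "(\<Sum>i\<in>UNIV. 2 * \<bar>d_x i f r t y * d_x i g r t y\<bar>)
      \<le> (\<Sum>i\<in>UNIV. k * (d_x i f r t y * d_x i f r t y) + (d_x i g r t y * d_x i g r t y) / k)"
    by (rule sum_mono)
  moreover have "\<bar>dot_x f g r t y\<bar> \<le> (\<Sum>i\<in>UNIV. \<bar>d_x i f r t y * d_x i g r t y\<bar>)"
    unfolding dot_x_def by (rule sum_abs)
  ultimately have "2 * \<bar>dot_x f g r t y\<bar>
      \<le> (\<Sum>i\<in>UNIV. k * (d_x i f r t y * d_x i f r t y) + (d_x i g r t y * d_x i g r t y) / k)"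
    by (simp flip: sum_distrib_left)
  then show ?thesis
    unfolding dot_x_def by (simp add: sum.distrib sum_distrib_left sum_divide_distrib)
qed

lemma dot_x_derivative:
  assumes "smooth R f" "smooth R g" "R < r" "y \<noteq> 0"
  shows "((\<lambda>r. dot_x f g r t y) has_field_derivative dot_x (d_r f) g r t y + dot_x f (d_r g) r t y) (at r)"
proof -
  have "((\<lambda>r. d_x i f r t y * d_x i g r t y) has_field_derivative
      d_x i (d_r f) r t y * d_x i g r t y + d_x i f r t y * d_x i (d_r g) r t y) (at r)" for i
    using DERIV_mult[OF d_r_derivative[OF smooth_d_x[OF assms(1)] assms(3,4)]
        d_r_derivative[OF smooth_d_x[OF assms(2)] assms(3,4)], of i t i]
      d_r_d_x[OF assms(1,3,4)] d_r_d_x[OF assms(2,3,4)]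
    by (simp add: algebra_simps)
  from DERIV_sum[of UNIV, OF this] show ?thesis
    unfolding dot_x_def by (simp add: sum.distrib)
qed

section \<open>The metric function\<close>

locale subextremal =
  fixes \<Lambda> m :: real
  assumes \<Lambda>: "\<Lambda> > 0" and m: "m > 0" and subextremal: "3 * m < 1 / sqrt \<Lambda>"
begin

abbreviation D :: "real \<Rightarrow> real" where "D \<equiv> sdsD \<Lambda> m"

text \<open>Written as \<open>2 * D r / r\<close> plus a remainder. The first part is what exact
  quadratic growth would give; the remainder, which changes sign at \<open>3 * m\<close>, alone
  decides the monotonicity of \<open>D r / r^2\<close> and of \<open>r^2 / D r\<close>.\<close>

lemma D_derivative:
  "r > 0 \<Longrightarrow> (D has_field_derivative (2 * r * D r + 2 * (r - 3 * m)) / r\<^sup>2) (at r)"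
  unfolding sdsD_def[abs_def]
  by (auto intro!: derivative_eq_intros simp: field_simps power2_eq_square power3_eq_cube)

lemma isCont_D: "r > 0 \<Longrightarrow> isCont D r"
  using D_derivative DERIV_isCont by blast

text \<open>\<open>D (3 * m) = 3 * \<Lambda> * m^2 - 1/3\<close>, and the sign of this number is
  exactly the subextremality condition.\<close>

lemma D_3m_neg: "D (3 * m) < 0"
proof -
  have "(3 * m)\<^sup>2 < (1 / sqrt \<Lambda>)\<^sup>2" using m subextremal by (intro power_strict_mono) auto
  then have "\<Lambda> * (3 * m)\<^sup>2 < 1" using \<Lambda> by (simp add: power_divide field_simps)
  then show ?thesis using m by (simp add: sdsD_def field_simps)
qed

lemma D_pos_large: "\<exists>R. \<forall>r>R. D r > 0"
proof (intro exI allI impI)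
  fix r assume r: "r > max 1 (3 / \<Lambda>)"
  then have "r > 1" "r > 3 / \<Lambda>" by auto
  then have "\<Lambda> * r > 3" using \<Lambda> by (simp add: field_simps)
  then have "\<Lambda> / 3 * r * r > 1 * 1" using \<open>r > 1\<close> by (intro mult_strict_mono) auto
  then show "D r > 0" using m \<open>r > 1\<close> by (simp add: sdsD_def power2_eq_square add_pos_pos)
qed

text \<open>\<open>r * D r\<close> is a cubic polynomial. Finiteness is what gives
  \<open>Max\<close> in the definition of \<open>rC\<close> its meaning.\<close>

lemma finite_D_roots: "finite {r. r > 0 \<and> D r = 0}"
proof (rule finite_subset)
  let ?p = "[:2 * m, -1, 0, \<Lambda> / 3:]"
  show "finite {r. poly ?p r = 0}" using m by (intro poly_roots_finite) auto
  show "{r. r > 0 \<and> D r = 0} \<subseteq> {r. poly ?p r = 0}"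
    by (auto simp: sdsD_def field_simps power2_eq_square)
qed

lemma D_root_above:
  assumes "r > 0" "D r \<le> 0"
  shows "\<exists>s\<ge>r. D s = 0"
proof -
  obtain R where R: "\<And>r. r > R \<Longrightarrow> D r > 0" using D_pos_large by blast
  define b where "b = max r R + 1"
  have "D b > 0" "r \<le> b" using R[of b] by (auto simp: b_def)
  then have "\<exists>s. r \<le> s \<and> s \<le> b \<and> D s = 0"
    using assms by (intro IVT) (auto intro!: isCont_D)
  then show ?thesis by blast
qed

text \<open>\<open>D\<close> is negative at \<open>3 * m\<close> and positive far out, so a root
  lies strictly between. Hence \<open>r - 3 * m\<close> is positive on the whole exterior, which
  gives the damping terms their sign.\<close>

lemma rC_gt: "3 * m < rC \<Lambda> m"
proof -
  obtain s where s: "s \<ge> 3 * m" "D s = 0" using D_root_above[of "3 * m"] D_3m_neg m by auto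
  with D_3m_neg m have "3 * m < s" "0 < s" by (auto simp: less_le)
  moreover from \<open>0 < s\<close> s(2) have "s \<le> rC \<Lambda> m" unfolding rC_def by (intro Max_ge finite_D_roots) auto
  ultimately show ?thesis by linarith
qed

lemma D_pos:
  assumes "rC \<Lambda> m < r"
  shows "0 < D r"
proof (rule ccontr)
  assume "\<not> 0 < D r"
  moreover have "0 < r" using assms rC_gt m by linarith
  ultimately obtain s where "s \<ge> r" "D s = 0" using D_root_above[of r] by auto
  then have "s \<le> rC \<Lambda> m" unfolding rC_def using \<open>0 < r\<close> by (intro Max_ge finite_D_roots) auto
  with \<open>s \<ge> r\<close> assms show False by linarith
qed

text \<open>The derivative of the quotient is \<open>2 * (r - 3 * m) / r^4\<close>. The consequence
  \<open>D_ge\<close>, quadratic growth with a constant read off at \<open>r\<^sub>0\<close>, is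
  what makes the later bounds uniform in \<open>r\<close>.\<close>

lemma D_over_square_mono:
  assumes "3 * m < r" "r \<le> s"
  shows "D r / r\<^sup>2 \<le> D s / s\<^sup>2"
proof (rule DERIV_nonneg_imp_nondecreasing[OF assms(2)])
  fix x assume x: "r \<le> x" "x \<le> s"
  have "x > 0" using x assms m by linarith
  then have "((\<lambda>x. D x / x\<^sup>2) has_field_derivative 2 * (x - 3 * m) / x ^ 4) (at x)"
    by (auto intro!: derivative_eq_intros D_derivative simp: field_simps power2_eq_square power4_eq_xxxx)
  moreover have "0 \<le> 2 * (x - 3 * m) / x ^ 4" using x assms by simp
  ultimately show "\<exists>y. ((\<lambda>x. D x / x\<^sup>2) has_field_derivative y) (at x) \<and> 0 \<le> y" by blast
qed

lemma D_ge:
  assumes "rC \<Lambda> m < r\<^sub>0" "r\<^sub>0 \<le> r"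
  shows "D r\<^sub>0 / r\<^sub>0\<^sup>2 * r\<^sup>2 \<le> D r"
  using D_over_square_mono[of r\<^sub>0 r] assms rC_gt m by (simp add: field_simps)

definition edens :: "sfun \<Rightarrow> sfun" where
  "edens f r t y = 1/2 * (r\<^sup>2 * D r * (d_r f r t y)\<^sup>2 + r\<^sup>2 * (1 / D r) * (d_t f r t y)\<^sup>2 + dot_x f f r t y)"

lemma energy_eq: "energy \<Lambda> m f r = int_tS2 (edens f r)"
  by (simp add: energy_def edens_def[abs_def] grad_sq_eq_dot_x)

text \<open>This is the \<open>C\<close> of the factor \<open>exp (C / r)\<close>. Its summands pay,
  in this order, for the term with \<open>u^2\<close>, for the product of the two gradients and for
  the squared gradient of \<open>u\<close> in the bulk term. They are matched against
  \<open>w u^2 + 1/4 |grad u|^2 + 4 |grad \<psi>|^2\<close>, where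
  \<open>w \<ge> 1 - 3 * m / r\<^sub>0\<close>.\<close>

definition bulk_const :: "real \<Rightarrow> real" where
  "bulk_const r\<^sub>0 = 3 * m / (1 - 3 * m / r\<^sub>0) + 15 * m + 8 * r\<^sub>0 / D r\<^sub>0"

end

section \<open>The commuted wave equation and its energy current\<close>

text \<open>Multiplying the commuted wave equation \<open>w\<^sub>2\<close> by \<open>a = u\<^sub>r\<close> produces the terms
  \<open>- 2 w u a\<close> and \<open>2 w a \<Delta>\<psi>\<close>; both are removed by adding \<open>w u\<^sup>2 + 2 w \<nabla>u \<cdot> \<nabla>\<psi>\<close> to the energy.\<close>

lemma modified_energy_identity:
  fixes r d :: real
  assumes rd: "r \<noteq> 0" "d \<noteq> 0"
    and u: "u = r * d * x"
    and a: "a = (d + r * dd) * x + r * d * xr"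
    and w\<^sub>1: "u + r * a = r\<^sup>2 * (1 / d) * zt + Lp"
    and w\<^sub>2: "2 * a + r * ar = q' * zt + r\<^sup>2 * (1 / d) * (utt / (r * d)) + Lu / (r * d)"
    and dd: "r\<^sup>2 * dd = 2 * r * d + 2 * (r - 3 * m)"
    and q': "q' = - 2 * (r - 3 * m) / d\<^sup>2"
    and P': "P' = 4 * r * d + 2 * (r - 3 * m)"
    and w: "w = 1 - 3 * m / r"
    and q: "q = r\<^sup>2 * (1 / d)"
  shows "1/2 * (P' * a\<^sup>2 + r\<^sup>2 * d * (2 * a * ar) + q' * b\<^sup>2 + q * (2 * b * aT) + 2 * ga)
     + (3 * m / r\<^sup>2 * u\<^sup>2 + w * (2 * u * a)) + (2 * (3 * m / r\<^sup>2) * gh + 2 * w * (ha + gg / (r * d)))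
     + 16 * (1/2 * (P' * x\<^sup>2 + r\<^sup>2 * d * (2 * x * xr) + q' * z\<^sup>2 + q * (2 * z * (b / (r * d))) + 2 * (gh / (r * d))))
   = q * (utt * a + b * aT) + 16 * q * (b / (r * d) * z + x * zt)
     + (ga + a * Lu + 2 * w * (ha + a * Lp) + 16 * (gh / (r * d) + x * Lp))
     + (- (r - 3 * m) * a\<^sup>2 + 1/2 * q' * b\<^sup>2 + 3 * m / r\<^sup>2 * u\<^sup>2 + 6 * m / r\<^sup>2 * gh + 2 * w * gg / (r * d)
        + 16 * (- 1/2 * P' * x\<^sup>2 + 1/2 * q' * z\<^sup>2))"
proof -
  \<comment> \<open>Dictionary: \<open>x\<close>, \<open>xr\<close>, \<open>z\<close>,
    \<open>zt\<close>, \<open>Lp\<close> are \<open>\<psi>_r\<close>, \<open>\<psi>_rr\<close>,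
    \<open>\<psi>_t\<close>, \<open>\<psi>_tt\<close>, \<open>\<Delta>\<psi>\<close>;
    \<open>a\<close>, \<open>ar\<close>, \<open>b\<close>, \<open>aT\<close>, \<open>utt\<close>,
    \<open>Lu\<close> are \<open>u_r\<close>, \<open>u_rr\<close>, \<open>u_t\<close>,
    \<open>u_rt\<close>, \<open>u_tt\<close>, \<open>\<Delta>u\<close>. The gradient products are
    \<open>ga\<close> for \<open>u\<close> with \<open>u_r\<close>, \<open>ha\<close> for
    \<open>u_r\<close> with \<psi>, \<open>gh\<close> for \<open>u\<close> with \<psi>,
    \<open>gg\<close> for \<open>u\<close> with itself. Further, \<open>d\<close>, \<open>dd\<close>
    are \<open>D\<close> and its derivative, and \<open>P'\<close>, \<open>q'\<close> the
    derivatives of \<open>r^2 D\<close> and \<open>r^2 / D\<close>.\<close>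
  have wr: "w * r = r - 3 * m" using rd by (simp add: w field_simps)
  have "r * d * (2 * a + r * ar) = r * d * q' * zt + q * utt + Lu"
    unfolding w\<^sub>2 q using rd by (simp add: field_simps)
  moreover have "r * d * q' * zt = - 2 * w * (q * zt)"
    using rd by (simp add: q q' w field_simps power2_eq_square)
  \<comment> \<open>The wave equation removes \<open>\<psi>_tt\<close>, which no energy controls.
    This exchange is the origin of the errors \<open>- 2 w u a\<close> and \<open>2 w a Lp\<close>,
    and of the damping: it contributes \<open>- 2 (r - 3m) a^2\<close>, against
    \<open>+ (r - 3m) a^2\<close> from \<open>P'\<close>.\<close>
  moreover have qzt: "q * zt = u + r * a - Lp" using w\<^sub>1 q by simp
  ultimately have ar: "r\<^sup>2 * d * ar = - 2 * w * (u + r * a - Lp) + q * utt + Lu - 2 * r * d * a"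
    by (simp add: algebra_simps power2_eq_square)
  have "u + r * a = r * d * x + r * d * x + (r\<^sup>2 * dd) * x + r\<^sup>2 * d * xr"
    unfolding u a by (simp add: algebra_simps power2_eq_square)
  then have xr: "r\<^sup>2 * d * xr = u + r * a - P' * x"
    unfolding dd P' by (simp add: algebra_simps)
  have e: "1/2 * (P' * a\<^sup>2 + r\<^sup>2 * d * (2 * a * ar)) = 1/2 * P' * a\<^sup>2 + a * (r\<^sup>2 * d * ar)"
    "1/2 * (P' * x\<^sup>2 + r\<^sup>2 * d * (2 * x * xr)) = 1/2 * P' * x\<^sup>2 + x * (r\<^sup>2 * d * xr)"
    by (simp_all add: algebra_simps)
  have t\<^sub>1: "1/2 * (P' * a\<^sup>2 + r\<^sup>2 * d * (2 * a * ar)) = q * utt * a + a * Lu - 2 * w * (u * a) + 2 * w * (a * Lp)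
      - (r - 3 * m) * a\<^sup>2"
    unfolding e(1) unfolding ar P' wr[symmetric] by (simp add: algebra_simps power2_eq_square)
  have t\<^sub>2: "1/2 * (P' * x\<^sup>2 + r\<^sup>2 * d * (2 * x * xr)) = q * (x * zt) + x * Lp - 1/2 * P' * x\<^sup>2"
  proof -
    have "u + r * a = q * zt + Lp" using qzt by simp
    then show ?thesis unfolding e(2) unfolding xr by (simp add: algebra_simps power2_eq_square)
  qed
  have "X = 2 * e - c" if "1/2 * (c + X) = e" for X c e :: real
    using that by simp
  note X = this[OF t\<^sub>1] this[OF t\<^sub>2]
  have c: "6 * m / r\<^sup>2 * gh = 2 * (3 * m / r\<^sup>2) * gh" "2 * w * gg / (r * d) = 2 * w * (gg / (r * d))"
    by simp_all
  \<comment> \<open>With \<open>r - 3 * m\<close> and the quotients replaced by the atoms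
    \<open>s\<close>, \<open>k\<close>, \<open>B\<close>, \<open>G\<close>, \<open>H\<close>, a
    polynomial identity remains.\<close>
  have collect:
    "1/2 * (P' * a\<^sup>2 + (2 * (q * utt * a + a * Lu - 2 * w * (u * a) + 2 * w * (a * Lp) - s * a\<^sup>2) - P' * a\<^sup>2) + q' * b\<^sup>2 + q * (2 * b * aT) + 2 * ga)
     + (k * u\<^sup>2 + w * (2 * u * a)) + (2 * k * gh + 2 * w * (ha + G))
     + 16 * (1/2 * (P' * x\<^sup>2 + (2 * (q * (x * zt) + x * Lp - 1/2 * P' * x\<^sup>2) - P' * x\<^sup>2) + q' * z\<^sup>2 + q * (2 * z * B) + 2 * H))
   = q * (utt * a + b * aT) + 16 * q * (B * z + x * zt)
     + (ga + a * Lu + 2 * w * (ha + a * Lp) + 16 * (H + x * Lp))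
     + (- s * a\<^sup>2 + 1/2 * q' * b\<^sup>2 + k * u\<^sup>2 + 2 * k * gh + 2 * w * G
        + 16 * (- 1/2 * P' * x\<^sup>2 + 1/2 * q' * z\<^sup>2))" for s k B G H
    by algebra
  show ?thesis unfolding X c by (rule collect)
qed

section \<open>Solutions, the commuted field \<open>u\<close>, and the equations they
  satisfy\<close>

locale sds_wave = subextremal +
  fixes \<psi> :: sfun
  assumes solution: "sds_wave_solution \<Lambda> m \<psi>"
begin

abbreviation u :: sfun where "u \<equiv> Xs \<Lambda> m \<psi>"

lemma smooth_psi: "smooth (rC \<Lambda> m) \<psi>"
  using solution by (simp add: sds_wave_solution_def smooth_def sds_region_def exterior_def unc_def[abs_def])

lemma u_eq: "u = (\<lambda>r t y. (r * D r) * d_r \<psi> r t y)"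
  by (simp add: fun_eq_iff Xs_def)

lemma r_bounds:
  assumes "rC \<Lambda> m < r"
  shows "0 < r" "3 * m < r" "0 < D r" "r \<noteq> 0" "D r \<noteq> 0" "0 < r * D r"
  using assms rC_gt m D_pos[OF assms] by auto

lemma smooth_u: "smooth (rC \<Lambda> m) u"
proof -
  have "unc (\<lambda>r t y. (\<Lambda> / 3 * r ^ 3 - r + 2 * m) * d_r \<psi> r t y) p = unc u p" if "p \<in> exterior (rC \<Lambda> m)" for p
  proof -
    have "fst p > 0" using that r_bounds(1)[of "fst p"] by (auto simp: exterior_def)
    then show ?thesis by (simp add: unc_def Xs_def sdsD_def field_simps power2_eq_square power3_eq_cube)
  qed
  from Cinf_on_cong[OF open_exterior this smooth_polynomial_mult[OF smooth_d_r[OF smooth_psi], unfolded smooth_def]]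
  show ?thesis unfolding smooth_def .
qed

lemma homogeneous:
  assumes "s > 0" "rC \<Lambda> m < r" "y \<noteq> 0"
  shows psi_homogeneous: "\<psi> r t (s *\<^sub>R y) = \<psi> r t y" and u_homogeneous: "u r t (s *\<^sub>R y) = u r t y"
proof -
  have psi: "\<psi> r t (s *\<^sub>R y) = \<psi> r t y" if "rC \<Lambda> m < r" "y \<noteq> 0" for r t y
  proof -
    have sgn: "\<psi> r t z = \<psi> r t (sgn z)" if "z \<noteq> 0" for z
      using solution that \<open>rC \<Lambda> m < r\<close> by (simp add: sds_wave_solution_def)
    have "sgn (s *\<^sub>R y) = sgn y" using assms(1) by (simp add: sgn_scaleR)
    then show ?thesis using sgn[of "s *\<^sub>R y"] sgn[of y] that(2) assms(1) by simp
  qed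
  then show "\<psi> r t (s *\<^sub>R y) = \<psi> r t y" using assms by blast
  have "d_r (\<lambda>r t y. \<psi> r t (s *\<^sub>R y)) r t y = d_r \<psi> r t y"
    by (rule d_cong(1)[OF psi assms(2,3)])
  then show "u r t (s *\<^sub>R y) = u r t y" by (simp add: Xs_def d_r_def)
qed

context
  fixes r t :: real and y :: "real^3"
  assumes r: "rC \<Lambda> m < r" and y: "y \<noteq> 0"
begin

text \<open>The factor \<open>r * D r\<close> depends on neither \<open>t\<close> nor
  \<open>y\<close>, so it passes through tangential derivatives. This fact and the following ones
  eliminate \<open>\<psi>_r\<close> from differentiated expressions in favour of
  \<open>u\<close>.\<close>

lemma d_r_d_t_psi: "d_r (d_t \<psi>) r t y = d_t u r t y / (r * D r)"
  using d_cmult(1)[OF smooth_d_r[OF smooth_psi] r y, of "\<lambda>r. r * D r"] r_bounds[OF r]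
  by (simp add: d_r_d_t[OF smooth_psi r y] u_eq)

lemma d_x_d_r_psi: "d_x i (d_r \<psi>) r t y = d_x i u r t y / (r * D r)"
  using d_cmult(2)[OF smooth_d_r[OF smooth_psi] r y, of i "\<lambda>r. r * D r"] r_bounds[OF r]
  by (simp add: u_eq)

lemma dot_x_d_r_psi: "dot_x f (d_r \<psi>) r t y = dot_x f u r t y / (r * D r)"
  by (simp add: dot_x_def d_x_d_r_psi sum_divide_distrib)

lemma d_r_d_t_d_t_psi: "d_r (d_t (d_t \<psi>)) r t y = d_t (d_t u) r t y / (r * D r)"
proof -
  have "d_r (d_t (d_t \<psi>)) r t y = d_t (d_r (d_t \<psi>)) r t y"
    by (rule d_r_d_t[OF smooth_d_t[OF smooth_psi] r y])
  also have "\<dots> = d_t (d_t (d_r \<psi>)) r t y"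
    by (rule d_t_cong[OF d_r_d_t[OF smooth_psi] r y])
  also have "\<dots> = d_t (d_t u) r t y / (r * D r)"
  proof -
    have "d_t (d_t u) r t y = d_t (\<lambda>r t y. (r * D r) * d_t (d_r \<psi>) r t y) r t y"
      unfolding u_eq by (rule d_t_cong[OF d_cmult(1)[OF smooth_d_r[OF smooth_psi]] r y])
    also have "\<dots> = (r * D r) * d_t (d_t (d_r \<psi>)) r t y"
      by (rule d_cmult(1)[OF smooth_d_t[OF smooth_d_r[OF smooth_psi]] r y])
    finally show ?thesis using r_bounds[OF r] by simp
  qed
  finally show ?thesis .
qed

lemma d_r_d_x_d_x_psi: "d_r (d_x i (d_x i \<psi>)) r t y = d_x i (d_x i u) r t y / (r * D r)"
proof -
  have "d_r (d_x i (d_x i \<psi>)) r t y = d_x i (d_r (d_x i \<psi>)) r t y"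
    by (rule d_r_d_x[OF smooth_d_x[OF smooth_psi] r y])
  also have "\<dots> = d_x i (d_x i (d_r \<psi>)) r t y"
    by (rule d_x_cong[OF d_r_d_x[OF smooth_psi] r y])
  also have "\<dots> = d_x i (d_x i u) r t y / (r * D r)"
  proof -
    have "d_x i (d_x i u) r t y = d_x i (\<lambda>r t y. (r * D r) * d_x i (d_r \<psi>) r t y) r t y"
      unfolding u_eq by (rule d_x_cong[OF d_cmult(2)[OF smooth_d_r[OF smooth_psi]] r y])
    also have "\<dots> = (r * D r) * d_x i (d_x i (d_r \<psi>)) r t y"
      by (rule d_cmult(2)[OF smooth_d_x[OF smooth_d_r[OF smooth_psi]] r y])
    finally show ?thesis using r_bounds[OF r] by simp
  qed
  finally show ?thesis .
qed

lemma d_r_u: "d_r u r t y = (D r + r * ((2 * r * D r + 2 * (r - 3 * m)) / r\<^sup>2)) * d_r \<psi> r t y + r * D r * d_r (d_r \<psi>) r t y"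
proof -
  have "((\<lambda>r. u r t y) has_field_derivative
     (D r + r * ((2 * r * D r + 2 * (r - 3 * m)) / r\<^sup>2)) * d_r \<psi> r t y + r * D r * d_r (d_r \<psi>) r t y) (at r)"
    unfolding u_eq
    using DERIV_mult[OF DERIV_mult[OF DERIV_ident D_derivative[OF r_bounds(1)[OF r]]]
        d_r_derivative[OF smooth_d_r[OF smooth_psi] r y, of t]]
    by (simp add: algebra_simps)
  from DERIV_unique[OF d_r_derivative[OF smooth_u r y] this] show ?thesis .
qed

end

text \<open>The derivative of \<open>r^2\<close> cancels against the quadratic growth of
  \<open>D\<close>; only the remainder \<open>2 * (r - 3 * m)\<close> of \<open>D_derivative\<close>
  is left, so the result is negative and of order \<open>r^(-3)\<close>.\<close>

lemma q_derivative:
  assumes "rC \<Lambda> m < r"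
  shows "((\<lambda>r. r\<^sup>2 * (1 / D r)) has_field_derivative - 2 * (r - 3 * m) / (D r)\<^sup>2) (at r)"
proof -
  have "2 * r * inverse d + - (inverse d * ((2 * r * d + c) / r\<^sup>2) * inverse d) * r\<^sup>2 = - c / d\<^sup>2"
    if "d \<noteq> 0" for c d :: real
    using that r_bounds(4)[OF assms] by (simp add: field_simps power2_eq_square)
  from this[of "D r" "2 * (r - 3 * m)"]
    DERIV_mult[OF DERIV_pow[of 2 r] DERIV_inverse'[OF D_derivative[OF r_bounds(1)[OF assms]] r_bounds(5)[OF assms]]]
    r_bounds(5)[OF assms]
  show ?thesis by (simp add: inverse_eq_divide)
qed

lemma P_derivative:
  assumes "rC \<Lambda> m < r"
  shows "((\<lambda>r. r\<^sup>2 * D r) has_field_derivative 4 * r * D r + 2 * (r - 3 * m)) (at r)"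
  using r_bounds[OF assms]
  by (auto intro!: derivative_eq_intros D_derivative simp: field_simps)

lemma wave_equation:
  assumes r: "rC \<Lambda> m < r" and y: "norm y = 1"
  shows "u r t y + r * d_r u r t y = r\<^sup>2 * (1 / D r) * d_t (d_t \<psi>) r t y + lap \<psi> r t y"
proof -
  have y0: "y \<noteq> 0" using y by auto
  have "d_r (\<lambda>s t' y. s\<^sup>2 * D s * d_r \<psi> s t' y) = d_r (\<lambda>s t' y. s * u s t' y)"
    by (simp add: Xs_def power2_eq_square mult.assoc)
  moreover have "d_r (\<lambda>s t' y. s * u s t' y) r t y = u r t y + r * d_r u r t y"
    unfolding d_r_def[of "\<lambda>s t' y. s * u s t' y"]
    using DERIV_mult[OF DERIV_ident d_r_derivative[OF smooth_u r y0, of t]]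
    by (intro DERIV_imp_deriv) (simp add: algebra_simps)
  moreover have "(1 / D r) * d_t (d_t \<psi>) r t y - (1 / r\<^sup>2) * d_r (\<lambda>s t' y. s\<^sup>2 * D s * d_r \<psi> s t' y) r t y
      + (1 / r\<^sup>2) * lap \<psi> r t y = 0"
    using solution r y by (simp add: sds_wave_solution_def)
  ultimately have "(1 / D r) * d_t (d_t \<psi>) r t y - (1 / r\<^sup>2) * (u r t y + r * d_r u r t y) + (1 / r\<^sup>2) * lap \<psi> r t y = 0"
    by simp
  then have "r\<^sup>2 * ((1 / D r) * d_t (d_t \<psi>) r t y - (1 / r\<^sup>2) * (u r t y + r * d_r u r t y) + (1 / r\<^sup>2) * lap \<psi> r t y) = 0"
    by simp
  then show ?thesis using r_bounds[OF r] by (simp add: algebra_simps)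
qed

text \<open>At a fixed \<open>y\<close> on the unit sphere the wave equation holds for all nearby
  radii, so both sides may be differentiated in \<open>r\<close>. The term with
  \<open>d_t (d_t \<psi>)\<close> is kept here and exchanged only inside the energy
  identity.\<close>

lemma commuted_wave_equation:
  assumes r: "rC \<Lambda> m < r" and y: "norm y = 1"
  shows "2 * d_r u r t y + r * d_r (d_r u) r t y
    = - 2 * (r - 3 * m) / (D r)\<^sup>2 * d_t (d_t \<psi>) r t y + r\<^sup>2 * (1 / D r) * (d_t (d_t u) r t y / (r * D r)) + lap u r t y / (r * D r)"
proof -
  have y0: "y \<noteq> 0" using y by auto
  have lhs: "((\<lambda>r. u r t y + r * d_r u r t y) has_field_derivative d_r u r t y + (1 * d_r u r t y + d_r (d_r u) r t y * r)) (at r)"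
    by (intro DERIV_add DERIV_mult DERIV_ident d_r_derivative[OF smooth_u r y0] d_r_derivative[OF smooth_d_r[OF smooth_u] r y0])
  have rhs: "((\<lambda>r. u r t y + r * d_r u r t y) has_field_derivative
     - 2 * (r - 3 * m) / (D r)\<^sup>2 * d_t (d_t \<psi>) r t y + d_t (d_t u) r t y / (r * D r) * (r\<^sup>2 * (1 / D r)) + lap u r t y / (r * D r)) (at r)"
  proof (rule DERIV_cong_ev[THEN iffD2, OF refl _ refl])
    have "\<forall>\<^sub>F s in nhds r. rC \<Lambda> m < s"
      by (rule order_tendstoD[OF filterlim_ident r])
    then show "\<forall>\<^sub>F s in nhds r. u s t y + s * d_r u s t y = s\<^sup>2 * (1 / D s) * d_t (d_t \<psi>) s t y + lap \<psi> s t y"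
      by eventually_elim (rule wave_equation[OF _ y])
    have "((\<lambda>r. d_t (d_t \<psi>) r t y) has_field_derivative d_t (d_t u) r t y / (r * D r)) (at r)"
      using d_r_derivative[OF smooth_d_t[OF smooth_d_t[OF smooth_psi]] r y0] d_r_d_t_d_t_psi[OF r y0] by simp
    moreover have "((\<lambda>r. d_x i (d_x i \<psi>) r t y) has_field_derivative d_x i (d_x i u) r t y / (r * D r)) (at r)" for i
      using d_r_derivative[OF smooth_d_x[OF smooth_d_x[OF smooth_psi]] r y0, of i i t] d_r_d_x_d_x_psi[OF r y0, of i t] by simp
    then have "((\<lambda>r. lap \<psi> r t y) has_field_derivative (\<Sum>i\<in>UNIV. d_x i (d_x i u) r t y / (r * D r))) (at r)"
      unfolding lap_def by (intro DERIV_sum)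
    ultimately show "((\<lambda>s. s\<^sup>2 * (1 / D s) * d_t (d_t \<psi>) s t y + lap \<psi> s t y) has_field_derivative
       - 2 * (r - 3 * m) / (D r)\<^sup>2 * d_t (d_t \<psi>) r t y + d_t (d_t u) r t y / (r * D r) * (r\<^sup>2 * (1 / D r)) + lap u r t y / (r * D r)) (at r)"
      using q_derivative[OF r] unfolding lap_def[of u] sum_divide_distrib by (intro DERIV_add DERIV_mult)
  qed
  have "2 * a + r * b = X + Q * c + L" if "a + (1 * a + b * r) = X + c * Q + L" for a b c X Q L :: real
    using that by (simp add: algebra_simps)
  from this[OF DERIV_unique[OF lhs rhs]] show ?thesis .
qed

lemma edens_bounds:
  assumes "rC \<Lambda> m < r"
  shows edens_nonneg: "0 \<le> edens f r t y"
    and dot_x_le_edens: "dot_x f f r t y \<le> 2 * edens f r t y"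
    and d_r_le_edens: "r\<^sup>2 * D r * (d_r f r t y)\<^sup>2 \<le> 2 * edens f r t y"
    and d_t_le_edens: "r\<^sup>2 * (1 / D r) * (d_t f r t y)\<^sup>2 \<le> 2 * edens f r t y"
proof -
  have "0 \<le> r\<^sup>2 * D r * (d_r f r t y)\<^sup>2" "0 \<le> r\<^sup>2 * (1 / D r) * (d_t f r t y)\<^sup>2"
    using r_bounds[OF assms] by simp_all
  moreover have "0 \<le> 1/2 * (a + b + c) \<and> c \<le> 2 * (1/2 * (a + b + c)) \<and> a \<le> 2 * (1/2 * (a + b + c)) \<and> b \<le> 2 * (1/2 * (a + b + c))"
    if "0 \<le> a" "0 \<le> b" "0 \<le> c" for a b c :: real
    using that by auto
  ultimately show "0 \<le> edens f r t y" "dot_x f f r t y \<le> 2 * edens f r t y"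
    "r\<^sup>2 * D r * (d_r f r t y)\<^sup>2 \<le> 2 * edens f r t y" "r\<^sup>2 * (1 / D r) * (d_t f r t y)\<^sup>2 \<le> 2 * edens f r t y"
    using dot_x_self_nonneg[of f r t y] unfolding edens_def by blast+
qed

text \<open>Expand \<open>(D |f_r| - |f_t|)^2\<close>. The factor \<open>1 / D r\<close> is the
  slope \<open>|dt/dr|\<close> of radial null curves, hence the speed that the edge of the cutoff
  has to beat.\<close>

lemma flux_le_edens:
  assumes "rC \<Lambda> m < r"
  shows "r\<^sup>2 * (1 / D r) * \<bar>d_t f r t y * d_r f r t y\<bar> \<le> edens f r t y / D r"
proof -
  have "r\<^sup>2 * (1 / d) * \<bar>b * a\<bar> \<le> 1/2 * (r\<^sup>2 * d * a\<^sup>2 + r\<^sup>2 * (1 / d) * b\<^sup>2 + e) / d"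
    if "0 < d" "0 \<le> e" for a b d e :: real
  proof -
    have "0 \<le> 1/2 * (r\<^sup>2 / d\<^sup>2) * (d * \<bar>a\<bar> - \<bar>b\<bar>)\<^sup>2 + e / (2 * d)" using that by simp
    also have "\<dots> = 1/2 * (r\<^sup>2 * d * a\<^sup>2 + r\<^sup>2 * (1 / d) * b\<^sup>2 + e) / d - r\<^sup>2 * (1 / d) * \<bar>b * a\<bar>"
      using that(1) by (simp add: field_simps power2_eq_square abs_mult)
    finally show ?thesis by simp
  qed
  then show ?thesis unfolding edens_def using r_bounds(3)[OF assms] dot_x_self_nonneg by blast
qed

lemma edens_derivative:
  assumes f: "smooth (rC \<Lambda> m) f" and r: "rC \<Lambda> m < r" and y: "y \<noteq> 0"
  shows "((\<lambda>r. edens f r t y) has_field_derivative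
    1/2 * ((4 * r * D r + 2 * (r - 3 * m)) * (d_r f r t y)\<^sup>2 + r\<^sup>2 * D r * (2 * d_r f r t y * d_r (d_r f) r t y)
      + - 2 * (r - 3 * m) / (D r)\<^sup>2 * (d_t f r t y)\<^sup>2 + r\<^sup>2 * (1 / D r) * (2 * d_t f r t y * d_t (d_r f) r t y)
      + 2 * dot_x f (d_r f) r t y)) (at r)"
proof -
  have sq: "((\<lambda>r. (g r)\<^sup>2) has_field_derivative 2 * g r * g') (at r)" if "(g has_field_derivative g') (at r)"
    for g :: "real \<Rightarrow> real" and g'
    using that by (auto intro!: derivative_eq_intros)
  note dt = d_r_derivative[OF smooth_d_t[OF f] r y, of t, unfolded d_r_d_t[OF f r y]]
  note dr = d_r_derivative[OF smooth_d_r[OF f] r y, of t]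
  show ?thesis
    unfolding edens_def
    by (rule DERIV_cong[OF DERIV_cmult[OF DERIV_add[OF DERIV_add[OF DERIV_mult[OF P_derivative[OF r] sq[OF dr]]
        DERIV_mult[OF q_derivative[OF r] sq[OF dt]]] dot_x_derivative[OF f f r y]]]])
      (simp add: dot_x_commute[of "d_r f" f] algebra_simps)
qed

section \<open>The modified energy density, its currents and its bulk term\<close>

definition weight :: "real \<Rightarrow> real" where
  "weight r = 1 - 3 * m / r"

text \<open>The factor 16 secures coercivity: as \<open>weight r \<le> 1\<close>, Young's inequality
  bounds the indefinite term by \<open>1/4 |grad u|^2 + 4 |grad \<psi>|^2\<close>, which is at most
  half of \<open>edens u\<close> plus half of the last summand.\<close>

definition mdens :: sfun where
  "mdens r t y = edens u r t y + weight r * (u r t y)\<^sup>2 + 2 * weight r * dot_x u \<psi> r t y + 16 * edens \<psi> r t y"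

definition mdens' :: sfun where
  "mdens' r t y =
     1/2 * ((4 * r * D r + 2 * (r - 3 * m)) * (d_r u r t y)\<^sup>2 + r\<^sup>2 * D r * (2 * d_r u r t y * d_r (d_r u) r t y)
       + - 2 * (r - 3 * m) / (D r)\<^sup>2 * (d_t u r t y)\<^sup>2 + r\<^sup>2 * (1 / D r) * (2 * d_t u r t y * d_t (d_r u) r t y)
       + 2 * dot_x u (d_r u) r t y)
     + (3 * m / r\<^sup>2 * (u r t y)\<^sup>2 + weight r * (2 * u r t y * d_r u r t y))
     + (2 * (3 * m / r\<^sup>2) * dot_x u \<psi> r t y + 2 * weight r * (dot_x (d_r u) \<psi> r t y + dot_x u u r t y / (r * D r)))
     + 16 * (1/2 * ((4 * r * D r + 2 * (r - 3 * m)) * (d_r \<psi> r t y)\<^sup>2 + r\<^sup>2 * D r * (2 * d_r \<psi> r t y * d_r (d_r \<psi>) r t y)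
       + - 2 * (r - 3 * m) / (D r)\<^sup>2 * (d_t \<psi> r t y)\<^sup>2 + r\<^sup>2 * (1 / D r) * (2 * d_t \<psi> r t y * (d_t u r t y / (r * D r)))
       + 2 * (dot_x u \<psi> r t y / (r * D r))))"

lemma weight_derivative: "r > 0 \<Longrightarrow> (weight has_field_derivative 3 * m / r\<^sup>2) (at r)"
  unfolding weight_def[abs_def] by (auto intro!: derivative_eq_intros simp: power2_eq_square)

lemma mdens_derivative:
  assumes r: "rC \<Lambda> m < r" and y: "y \<noteq> 0"
  shows "((\<lambda>r. mdens r t y) has_field_derivative mdens' r t y) (at r)"
proof -
  have sq: "((\<lambda>r. (u r t y)\<^sup>2) has_field_derivative 2 * u r t y * d_r u r t y) (at r)"
    using d_r_derivative[OF smooth_u r y, of t] by (auto intro!: derivative_eq_intros)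
  note w = weight_derivative[OF r_bounds(1)[OF r]]
  have "d_t (d_r \<psi>) r t y = d_t u r t y / (r * D r)"
    using d_r_d_t_psi[OF r y] d_r_d_t[OF smooth_psi r y] by simp
  moreover have "dot_x \<psi> (d_r \<psi>) r t y = dot_x u \<psi> r t y / (r * D r)"
    using dot_x_d_r_psi[OF r y, of \<psi>] dot_x_commute by simp
  ultimately have e: "((\<lambda>r. edens \<psi> r t y) has_field_derivative
     1/2 * ((4 * r * D r + 2 * (r - 3 * m)) * (d_r \<psi> r t y)\<^sup>2 + r\<^sup>2 * D r * (2 * d_r \<psi> r t y * d_r (d_r \<psi>) r t y)
       + - 2 * (r - 3 * m) / (D r)\<^sup>2 * (d_t \<psi> r t y)\<^sup>2 + r\<^sup>2 * (1 / D r) * (2 * d_t \<psi> r t y * (d_t u r t y / (r * D r)))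
       + 2 * (dot_x u \<psi> r t y / (r * D r)))) (at r)"
    using edens_derivative[OF smooth_psi r y, of t] by (simp only:)
  have "dot_x u (d_r \<psi>) r t y = dot_x u u r t y / (r * D r)"
    by (rule dot_x_d_r_psi[OF r y])
  then have d: "((\<lambda>r. dot_x u \<psi> r t y) has_field_derivative dot_x (d_r u) \<psi> r t y + dot_x u u r t y / (r * D r)) (at r)"
    using dot_x_derivative[OF smooth_u smooth_psi r y, of t] by simp
  show ?thesis
    unfolding mdens_def mdens'_def
    by (rule DERIV_cong[OF DERIV_add[OF DERIV_add[OF DERIV_add[OF edens_derivative[OF smooth_u r y] DERIV_mult[OF w sq]]
        DERIV_mult[OF DERIV_cmult[OF w, of 2] d]] DERIV_cmult[OF e]]])
      (simp add: mult.commute)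
qed

text \<open>\<open>flux_t\<close> and \<open>flux_x\<close> are the currents of the multipliers
  \<open>u_r\<close> for the commuted equation and \<open>16 \<psi>_r\<close> for the wave equation.
  The correction of the density adds nothing to \<open>flux_t\<close>; it contributes
  \<open>2 w u_r grad \<psi>\<close> to \<open>flux_x\<close>.\<close>

definition flux_t :: sfun where
  "flux_t r t y = r\<^sup>2 * (1 / D r) * (d_t u r t y * d_r u r t y) + 16 * (r\<^sup>2 * (1 / D r)) * (d_t \<psi> r t y * d_r \<psi> r t y)"

definition flux_t' :: sfun where
  "flux_t' r t y = r\<^sup>2 * (1 / D r) * (d_t (d_t u) r t y * d_r u r t y + d_t u r t y * d_t (d_r u) r t y)
     + 16 * (r\<^sup>2 * (1 / D r)) * (d_t u r t y / (r * D r) * d_t \<psi> r t y + d_r \<psi> r t y * d_t (d_t \<psi>) r t y)"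

definition flux_x :: "real \<Rightarrow> real \<Rightarrow> real^3 \<Rightarrow> real^3" where
  "flux_x r t y = (\<chi> i. d_r u r t y * d_x i u r t y + 2 * weight r * (d_r u r t y * d_x i \<psi> r t y)
     + 16 * (d_r \<psi> r t y * d_x i \<psi> r t y))"

definition flux_x' :: "real \<Rightarrow> real \<Rightarrow> real^3 \<Rightarrow> 3 \<Rightarrow> 3 \<Rightarrow> real" where
  "flux_x' r t y i j = (d_x j (d_r u) r t y * d_x i u r t y + d_r u r t y * d_x j (d_x i u) r t y)
     + 2 * weight r * (d_x j (d_r u) r t y * d_x i \<psi> r t y + d_r u r t y * d_x j (d_x i \<psi>) r t y)
     + 16 * (d_x j u r t y / (r * D r) * d_x i \<psi> r t y + d_r \<psi> r t y * d_x j (d_x i \<psi>) r t y)"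

lemma flux_t_derivative:
  assumes r: "rC \<Lambda> m < r" and y: "y \<noteq> 0"
  shows "((\<lambda>t. flux_t r t y) has_field_derivative flux_t' r t y) (at t)"
proof -
  have "d_t (d_r \<psi>) r t y = d_t u r t y / (r * D r)"
    using d_r_d_t_psi[OF r y] d_r_d_t[OF smooth_psi r y] by simp
  then have psi: "((\<lambda>t. d_r \<psi> r t y) has_field_derivative d_t u r t y / (r * D r)) (at t)"
    using d_t_derivative[OF smooth_d_r[OF smooth_psi] r y, of t] by simp
  show ?thesis
    unfolding flux_t_def flux_t'_def
    by (rule DERIV_cong[OF DERIV_add[OF
        DERIV_cmult[OF DERIV_mult[OF d_t_derivative[OF smooth_d_t[OF smooth_u] r y] d_t_derivative[OF smooth_d_r[OF smooth_u] r y]]]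
        DERIV_cmult[OF DERIV_mult[OF d_t_derivative[OF smooth_d_t[OF smooth_psi] r y] psi]]]])
      (simp add: algebra_simps)
qed

lemma has_derivative_mult_d_x:
  assumes "(f has_derivative (\<lambda>v. \<Sum>j\<in>UNIV. f' j * v $ j)) (at (y::real^3))"
    and "(g has_derivative (\<lambda>v. \<Sum>j\<in>UNIV. g' j * v $ j)) (at y)"
  shows "((\<lambda>y. f y * g y) has_derivative (\<lambda>v. \<Sum>j\<in>UNIV. (f' j * g y + f y * g' j) * v $ j)) (at y)"
  by (rule has_derivative_eq_rhs[OF has_derivative_mult[OF assms]])
    (simp add: fun_eq_iff sum_distrib_left sum_distrib_right sum.distrib[symmetric] algebra_simps)

lemma flux_x_derivative:
  assumes r: "rC \<Lambda> m < r" and y: "y \<noteq> 0"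
  shows "((\<lambda>y. flux_x r t y $ i) has_derivative (\<lambda>v. \<Sum>j\<in>UNIV. flux_x' r t y i j * v $ j)) (at y)"
proof -
  note dx = d_x_derivative[OF _ r y, of _ t]
  have psi: "(d_r \<psi> r t has_derivative (\<lambda>v. \<Sum>j\<in>UNIV. d_x j u r t y / (r * D r) * v $ j)) (at y)"
    using dx[OF smooth_d_r[OF smooth_psi]] by (simp add: d_x_d_r_psi[OF r y])
  have 1: "((\<lambda>y. d_r u r t y * d_x i u r t y) has_derivative
     (\<lambda>v. \<Sum>j\<in>UNIV. (d_x j (d_r u) r t y * d_x i u r t y + d_r u r t y * d_x j (d_x i u) r t y) * v $ j)) (at y)"
    by (intro has_derivative_mult_d_x dx smooth_d smooth_u)
  have 2: "((\<lambda>y. 2 * weight r * (d_r u r t y * d_x i \<psi> r t y)) has_derivative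
     (\<lambda>v. 2 * weight r * (\<Sum>j\<in>UNIV. (d_x j (d_r u) r t y * d_x i \<psi> r t y + d_r u r t y * d_x j (d_x i \<psi>) r t y) * v $ j))) (at y)"
    by (intro has_derivative_mult_right has_derivative_mult_d_x dx smooth_d smooth_u smooth_psi)
  have 3: "((\<lambda>y. 16 * (d_r \<psi> r t y * d_x i \<psi> r t y)) has_derivative
     (\<lambda>v. 16 * (\<Sum>j\<in>UNIV. (d_x j u r t y / (r * D r) * d_x i \<psi> r t y + d_r \<psi> r t y * d_x j (d_x i \<psi>) r t y) * v $ j))) (at y)"
    by (intro has_derivative_mult_right has_derivative_mult_d_x psi dx smooth_d smooth_psi)
  show ?thesis
    unfolding flux_x_def flux_x'_def vec_lambda_beta
    by (rule has_derivative_eq_rhs[OF has_derivative_add[OF has_derivative_add[OF 1 2] 3]])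
      (simp add: fun_eq_iff sum_distrib_left sum.distrib[symmetric] algebra_simps)
qed

lemma flux_x_tangential:
  assumes r: "rC \<Lambda> m < r" and y: "y \<noteq> 0"
  shows "flux_x r t y \<bullet> y = 0"
proof -
  have "(\<Sum>j\<in>UNIV. d_x j u r t y * y $ j) = 0" "(\<Sum>j\<in>UNIV. d_x j \<psi> r t y * y $ j) = 0"
    by (rule radial_d_x_zero[OF smooth_u u_homogeneous[OF _ r y] r y] radial_d_x_zero[OF smooth_psi psi_homogeneous[OF _ r y] r y]; assumption)+
  moreover have "flux_x r t y \<bullet> y = d_r u r t y * (\<Sum>j\<in>UNIV. d_x j u r t y * y $ j)
     + 2 * weight r * d_r u r t y * (\<Sum>j\<in>UNIV. d_x j \<psi> r t y * y $ j) + 16 * d_r \<psi> r t y * (\<Sum>j\<in>UNIV. d_x j \<psi> r t y * y $ j)"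
    by (simp add: flux_x_def inner_vec_def sum_distrib_left sum.distrib[symmetric] algebra_simps)
  ultimately show ?thesis by simp
qed

text \<open>What remains of \<open>mdens'\<close> once the divergences are removed. Only
  \<open>u\<close> itself and first derivatives of \<open>u\<close> and \<psi> occur, and only the
  three summands in the middle, those with \<open>(u r t y)^2\<close> and \<open>dot_x\<close>, can
  be positive.\<close>

definition bulk :: sfun where
  "bulk r t y = - (r - 3 * m) * (d_r u r t y)\<^sup>2 + 1/2 * (- 2 * (r - 3 * m) / (D r)\<^sup>2) * (d_t u r t y)\<^sup>2
     + 3 * m / r\<^sup>2 * (u r t y)\<^sup>2 + 6 * m / r\<^sup>2 * dot_x u \<psi> r t y + 2 * weight r * dot_x u u r t y / (r * D r)
     + 16 * (- 1/2 * (4 * r * D r + 2 * (r - 3 * m)) * (d_r \<psi> r t y)\<^sup>2 + 1/2 * (- 2 * (r - 3 * m) / (D r)\<^sup>2) * (d_t \<psi> r t y)\<^sup>2)"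

lemma mdens'_eq:
  assumes r: "rC \<Lambda> m < r" and y: "norm y = 1"
  shows "mdens' r t y = flux_t' r t y + (\<Sum>i\<in>UNIV. flux_x' r t y i i) + bulk r t y"
proof -
  have y0: "y \<noteq> 0" using y by auto
  have div: "(\<Sum>i\<in>UNIV. flux_x' r t y i i) = dot_x u (d_r u) r t y + d_r u r t y * lap u r t y
     + 2 * weight r * (dot_x (d_r u) \<psi> r t y + d_r u r t y * lap \<psi> r t y)
     + 16 * (dot_x u \<psi> r t y / (r * D r) + d_r \<psi> r t y * lap \<psi> r t y)"
    unfolding flux_x'_def
    by (simp add: sum.distrib dot_x_def lap_def sum_distrib_left sum_divide_distrib distrib_left mult_ac)
  have dd: "r\<^sup>2 * ((2 * r * D r + 2 * (r - 3 * m)) / r\<^sup>2) = 2 * r * D r + 2 * (r - 3 * m)"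
    using r_bounds[OF r] by simp
  show ?thesis
    unfolding mdens'_def flux_t'_def div bulk_def
    by (rule modified_energy_identity[OF r_bounds(4,5)[OF r] _ d_r_u[OF r y0] wave_equation[OF r y]
        commuted_wave_equation[OF r y] dd refl refl weight_def refl])
      (simp add: Xs_def)
qed

section \<open>Coercivity of the density and absorption of the bulk term\<close>

lemma weight_bounds: "rC \<Lambda> m < r \<Longrightarrow> 0 \<le> weight r" "rC \<Lambda> m < r \<Longrightarrow> weight r \<le> 1"
  using r_bounds[of r] m by (auto simp: weight_def)

text \<open>Three uses: the first bound recovers the energies and controls the flux, the second
  isolates the quantities that occur in \<open>bulk\<close>, the third returns to the data, where
  \<open>(u r t y)^2\<close> still has to be estimated.\<close>

lemma mdens_lower:
  assumes r: "rC \<Lambda> m < r"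
  shows "1/2 * edens u r t y + weight r * (u r t y)\<^sup>2 + 8 * edens \<psi> r t y \<le> mdens r t y"
    and "weight r * (u r t y)\<^sup>2 + 1/4 * dot_x u u r t y + 4 * dot_x \<psi> \<psi> r t y \<le> mdens r t y"
    and "mdens r t y \<le> 2 * edens u r t y + (u r t y)\<^sup>2 + 24 * edens \<psi> r t y"
proof -
  note w = weight_bounds[OF r]
  have "\<bar>2 * weight r * dot_x u \<psi> r t y\<bar> \<le> 2 * \<bar>dot_x u \<psi> r t y\<bar>"
    using w mult_right_mono[OF w(2), of "\<bar>dot_x u \<psi> r t y\<bar>"] by (simp add: abs_mult)
  also have "\<dots> \<le> 1/4 * dot_x u u r t y + 4 * dot_x \<psi> \<psi> r t y"
    using dot_x_young[of "1/4" u \<psi> r t y] by simp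
  finally have cross: "\<bar>2 * weight r * dot_x u \<psi> r t y\<bar> \<le> 1/4 * dot_x u u r t y + 4 * dot_x \<psi> \<psi> r t y" .
  have wu: "weight r * (u r t y)\<^sup>2 \<le> (u r t y)\<^sup>2"
    using mult_right_mono[OF w(2), of "(u r t y)\<^sup>2"] by simp
  note b = dot_x_le_edens[OF r, of u t y] dot_x_le_edens[OF r, of \<psi> t y] edens_nonneg[OF r, of u t y] edens_nonneg[OF r, of \<psi> t y]
    dot_x_self_nonneg[of u r t y] dot_x_self_nonneg[of \<psi> r t y]
  show "1/2 * edens u r t y + weight r * (u r t y)\<^sup>2 + 8 * edens \<psi> r t y \<le> mdens r t y"
    using cross b unfolding mdens_def by linarith
  show "weight r * (u r t y)\<^sup>2 + 1/4 * dot_x u u r t y + 4 * dot_x \<psi> \<psi> r t y \<le> mdens r t y"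
    using cross b unfolding mdens_def by linarith
  show "mdens r t y \<le> 2 * edens u r t y + (u r t y)\<^sup>2 + 24 * edens \<psi> r t y"
    using cross b wu unfolding mdens_def by linarith
qed

lemma mdens_nonneg: "rC \<Lambda> m < r \<Longrightarrow> 0 \<le> mdens r t y"
  using mdens_lower(2)[of r t y] dot_x_self_nonneg[of u r t y] dot_x_self_nonneg[of \<psi> r t y] r_bounds[of r]
  by (simp add: weight_def add_nonneg_nonneg order_trans[rotated])

text \<open>The factor 2 arises because \<open>mdens\<close> dominates only half of
  \<open>edens u\<close>. It reappears in the constant \<open>k\<close> of the cutoff.\<close>

lemma flux_t_le:
  assumes r: "rC \<Lambda> m < r"
  shows "\<bar>flux_t r t y\<bar> \<le> 2 / D r * mdens r t y"
proof -
  note [simp] = r_bounds[OF r]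
  have "\<bar>flux_t r t y\<bar> \<le> \<bar>r\<^sup>2 * (1 / D r) * (d_t u r t y * d_r u r t y)\<bar> + \<bar>16 * (r\<^sup>2 * (1 / D r)) * (d_t \<psi> r t y * d_r \<psi> r t y)\<bar>"
    unfolding flux_t_def by (rule abs_triangle_ineq)
  also have "\<dots> = r\<^sup>2 * (1 / D r) * \<bar>d_t u r t y * d_r u r t y\<bar> + 16 * (r\<^sup>2 * (1 / D r) * \<bar>d_t \<psi> r t y * d_r \<psi> r t y\<bar>)"
    by (simp add: abs_mult abs_of_pos[OF r_bounds(3)[OF r]])
  also have "\<dots> \<le> edens u r t y / D r + 16 * (edens \<psi> r t y / D r)"
    using flux_le_edens[OF r, of u t y] flux_le_edens[OF r, of \<psi> t y] by linarith
  also have "\<dots> = (edens u r t y + 16 * edens \<psi> r t y) / D r" by (simp add: add_divide_distrib)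
  also have "\<dots> \<le> 2 * mdens r t y / D r"
  proof (rule divide_right_mono)
    have "0 \<le> weight r * (u r t y)\<^sup>2" using weight_bounds[OF r] by simp
    then show "edens u r t y + 16 * edens \<psi> r t y \<le> 2 * mdens r t y" using mdens_lower(1)[OF r, of t y] by linarith
  qed (simp add: less_imp_le)
  finally show ?thesis by simp
qed

lemma bulk_le:
  assumes r\<^sub>0: "rC \<Lambda> m < r\<^sub>0" and r: "r\<^sub>0 \<le> r"
  shows "bulk r t y \<le> bulk_const r\<^sub>0 / r\<^sup>2 * mdens r t y"
proof -
  have rr: "rC \<Lambda> m < r" using assms by linarith
  note r0_bounds = r_bounds[OF r\<^sub>0]
  define U G H K where "U = (u r t y)\<^sup>2" and "G = dot_x u u r t y" and "H = dot_x \<psi> \<psi> r t y" and "K = 2 * r\<^sub>0 / D r\<^sub>0"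
  have nonneg: "0 \<le> U" "0 \<le> G" "0 \<le> H" by (simp_all add: U_def G_def H_def dot_x_self_nonneg)
  have w: "0 < 1 - 3 * m / r\<^sub>0" "1 - 3 * m / r\<^sub>0 \<le> weight r" "weight r \<le> 1" "0 \<le> weight r"
    using r0_bounds r m by (auto simp: weight_def field_simps)
  have bulk_0: "bulk r t y \<le> 3 * m / r\<^sup>2 * U + 6 * m / r\<^sup>2 * dot_x u \<psi> r t y + 2 * weight r * G / (r * D r)"
  proof -
    have "0 \<le> r - 3 * m" using r_bounds(2)[OF rr] by linarith
    moreover have "0 \<le> 4 * r * D r + 2 * (r - 3 * m)" by (rule add_nonneg_nonneg) (use r_bounds(1-3)[OF rr] in auto)
    ultimately have "0 \<le> (r - 3 * m) * (d_r u r t y)\<^sup>2" "0 \<le> (r - 3 * m) / (D r)\<^sup>2 * (d_t u r t y)\<^sup>2"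
      "0 \<le> (4 * r * D r + 2 * (r - 3 * m)) * (d_r \<psi> r t y)\<^sup>2" "0 \<le> (r - 3 * m) / (D r)\<^sup>2 * (d_t \<psi> r t y)\<^sup>2"
      by - (intro mult_nonneg_nonneg divide_nonneg_nonneg zero_le_power2; assumption)+
    moreover have "- s * a + 1/2 * (- 2 * s / e) * b + X + Y + Z + 16 * (- 1/2 * p * x + 1/2 * (- 2 * s / e) * z) \<le> X + Y + Z"
      if "0 \<le> s * a" "0 \<le> s / e * b" "0 \<le> p * x" "0 \<le> s / e * z" for s a e b p x z X Y Z :: real
    proof -
      have eqs: "1/2 * (- 2 * s / e) * b = - (s / e * b)" "1/2 * (- 2 * s / e) * z = - (s / e * z)"
        "- 1/2 * p * x = - (1/2) * (p * x)" "- s * a = - (s * a)" by simp_all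
      have "- A + - B + X + Y + Z + 16 * (- (1/2) * C + - E) \<le> X + Y + Z"
        if "0 \<le> A" "0 \<le> B" "0 \<le> C" "0 \<le> E" for A B C E :: real
        using that by argo
      from this[OF that] show ?thesis unfolding eqs .
    qed
    ultimately show ?thesis unfolding bulk_def U_def G_def by blast
  qed
  note [simp] = r_bounds[OF rr]
  note bulk_0
  also have "6 * m / r\<^sup>2 * dot_x u \<psi> r t y \<le> 3 * m / r\<^sup>2 * (G + H)"
  proof -
    have "2 * dot_x u \<psi> r t y \<le> G + H"
      using dot_x_young[of 1 u \<psi> r t y] abs_ge_self[of "dot_x u \<psi> r t y"] unfolding G_def H_def by simp
    from mult_left_mono[OF this, of "3 * m / r\<^sup>2"] show ?thesis using m by simp
  qed
  also have "2 * weight r * G / (r * D r) \<le> K / r\<^sup>2 * G"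
  proof -
    \<comment> \<open>\<open>r * D r\<close> grows cubically; one power of \<open>r\<close> is given
      up against \<open>r\<^sub>0\<close> to reach the common rate
      \<open>1 / r\<^sup>2\<close>.\<close>
    have "1 / (r * D r) \<le> r\<^sub>0 / D r\<^sub>0 / r\<^sup>2"
    proof -
      have "D r\<^sub>0 / r\<^sub>0 * r\<^sup>2 \<le> D r\<^sub>0 / r\<^sub>0\<^sup>2 * r\<^sup>2 * r"
        using r r0_bounds by (simp add: field_simps power2_eq_square)
      also have "\<dots> \<le> D r * r" using D_ge[OF r\<^sub>0 r] by (intro mult_right_mono) (auto simp: less_imp_le)
      finally have le: "D r\<^sub>0 / r\<^sub>0 * r\<^sup>2 \<le> r * D r" by (simp add: mult.commute)
      have "0 < D r\<^sub>0 / r\<^sub>0 * r\<^sup>2" using r0_bounds by simp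
      then have "1 / (r * D r) \<le> 1 / (D r\<^sub>0 / r\<^sub>0 * r\<^sup>2)" by (intro divide_left_mono[OF le] mult_pos_pos[OF r_bounds(6)[OF rr]]) simp_all
      then show ?thesis by simp
    qed
    then have "weight r * (1 / (r * D r)) \<le> 1 * (r\<^sub>0 / D r\<^sub>0 / r\<^sup>2)"
      using w by (intro mult_mono) (auto simp: less_imp_le)
    from mult_right_mono[OF this, of "2 * G"] show ?thesis using nonneg by (simp add: K_def mult_ac)
  qed
  finally have "bulk r t y \<le> 3 * m / r\<^sup>2 * U + 3 * m / r\<^sup>2 * (G + H) + K / r\<^sup>2 * G" by simp
  also have "\<dots> = (3 * m * U + 3 * m * (G + H) + K * G) / r\<^sup>2" by (simp add: add_divide_distrib)
  also have "\<dots> \<le> bulk_const r\<^sub>0 * mdens r t y / r\<^sup>2"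
  proof (rule divide_right_mono)
    define c where "c = 3 * m / (1 - 3 * m / r\<^sub>0)"
    have c: "0 < c" "c * (1 - 3 * m / r\<^sub>0) = 3 * m" using w(1) m by (auto simp: c_def)
    have K: "0 < K" using r0_bounds by (simp add: K_def)
    define M where "M = (1 - 3 * m / r\<^sub>0) * U + 1/4 * G + 4 * H"
    have "M \<le> mdens r t y"
      using mult_right_mono[OF w(2) nonneg(1)] mdens_lower(2)[OF rr, of t y] unfolding M_def U_def G_def H_def by linarith
    have bc: "bulk_const r\<^sub>0 = c + 15 * m + 4 * K" by (simp add: bulk_const_def c_def K_def)
    have "3 * m * U + 3 * m * (G + H) + K * G \<le> c * ((1 - 3 * m / r\<^sub>0) * U) + 15 * m * (1/4 * G + 4 * H) + 4 * K * (1/4 * G)"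
    proof (intro add_mono)
      show "3 * m * U \<le> c * ((1 - 3 * m / r\<^sub>0) * U)" by (simp only: mult.assoc[symmetric] c(2) order_refl)
      have "3 * m * (G + H) \<le> 15 * m * (1/4 * (G + H))" using nonneg m by simp
      also have "\<dots> \<le> 15 * m * (1/4 * G + 4 * H)" using nonneg m by (intro mult_left_mono) auto
      finally show "3 * m * (G + H) \<le> 15 * m * (1/4 * G + 4 * H)" .
    qed simp
    also have "\<dots> \<le> c * M + 15 * m * M + 4 * K * M"
      unfolding M_def using c(1) K nonneg m w(1) by (intro add_mono mult_left_mono) auto
    also have "\<dots> = bulk_const r\<^sub>0 * M" by (simp add: bc algebra_simps)
    also have "\<dots> \<le> bulk_const r\<^sub>0 * mdens r t y"
      using \<open>M \<le> mdens r t y\<close> c(1) K m by (intro mult_left_mono) (auto simp: bc)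
    finally show "3 * m * U + 3 * m * (G + H) + K * G \<le> bulk_const r\<^sub>0 * mdens r t y" .
  qed simp
  finally show ?thesis by simp
qed

end

section \<open>The energy estimate\<close>

text \<open>At 0 the difference quotient is at most \<open>|h|\<close>. Squaring the positive part
  thus gives a cutoff with continuous first derivatives, which is all that the integrations by parts
  use.\<close>

lemma max_0_square_derivative:
  "((\<lambda>x::real. (max 0 x)\<^sup>2) has_field_derivative 2 * max 0 x) (at x)"
proof -
  consider "x < 0" | "x = 0" | "x > 0" by linarith
  then show ?thesis
  proof cases
    case 1
    have "\<forall>\<^sub>F z in nhds x. (max 0 z)\<^sup>2 = 0"
      using order_tendstoD(2)[OF filterlim_ident[of "nhds x"] 1] by eventually_elim auto
    from DERIV_cong_ev[OF refl this refl] 1 show ?thesis by simp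
  next
    case 3
    have "\<forall>\<^sub>F z in nhds x. (max 0 z)\<^sup>2 = z\<^sup>2"
      using order_tendstoD(1)[OF filterlim_ident[of "nhds x"] 3] by eventually_elim auto
    from DERIV_cong_ev[OF refl this refl] 3 show ?thesis by (auto intro!: derivative_eq_intros)
  next
    case 2
    have "((\<lambda>h::real. (max 0 h)\<^sup>2 / h) \<longlongrightarrow> 0) (at 0)"
    proof (rule Lim_null_comparison)
      show "\<forall>\<^sub>F h in at 0. norm ((max 0 h)\<^sup>2 / h) \<le> \<bar>h::real\<bar>"
        by (intro always_eventually allI) (auto simp: max_def power2_eq_square)
      show "((\<lambda>h::real. \<bar>h\<bar>) \<longlongrightarrow> 0) (at 0)"
        by (intro tendsto_rabs_zero tendsto_ident_at)
    qed
    then show ?thesis using 2 by (simp add: DERIV_def)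
  qed
qed

text \<open>The support \<open>\<bar>t\<bar> \<le> c + k / r\<close> of this cutoff shrinks faster than the light cones
  \<open>\<bar>dt/dr\<bar> = 1/D\<close> when \<open>k / r\<^sup>2 \<ge> 2 / D\<close>, so that its \<open>r\<close>-derivative absorbs the flux through
  its \<open>t\<close>-gradient.\<close>

definition cutoff :: "real \<Rightarrow> real \<Rightarrow> real \<Rightarrow> real \<Rightarrow> real" where
  "cutoff c k r t = (max 0 ((c + k / r)\<^sup>2 - t\<^sup>2))\<^sup>2"

definition cutoff_r :: "real \<Rightarrow> real \<Rightarrow> real \<Rightarrow> real \<Rightarrow> real" where
  "cutoff_r c k r t = 2 * max 0 ((c + k / r)\<^sup>2 - t\<^sup>2) * (2 * (c + k / r) * (- (k / r\<^sup>2)))"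

definition cutoff_t :: "real \<Rightarrow> real \<Rightarrow> real \<Rightarrow> real \<Rightarrow> real" where
  "cutoff_t c k r t = 2 * max 0 ((c + k / r)\<^sup>2 - t\<^sup>2) * (- (2 * t))"

lemma cutoff_r_derivative: "r \<noteq> 0 \<Longrightarrow> ((\<lambda>r. cutoff c k r t) has_field_derivative cutoff_r c k r t) (at r)"
  unfolding cutoff_def cutoff_r_def
  by (rule DERIV_chain'[OF _ max_0_square_derivative])
    (auto intro!: derivative_eq_intros simp: power2_eq_square field_simps)

lemma cutoff_t_derivative: "(cutoff c k r has_field_derivative cutoff_t c k r t) (at t)"
  unfolding cutoff_def[abs_def] cutoff_t_def
  by (rule DERIV_chain'[OF _ max_0_square_derivative]) (auto intro!: derivative_eq_intros)

lemma cutoff_nonneg: "0 \<le> cutoff c k r t"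
  by (simp add: cutoff_def)

lemma cutoff_eq_0:
  assumes "0 \<le> c + k / r" "c + k / r \<le> T"
  shows "cutoff c k r T = 0" "cutoff c k r (- T) = 0"
  using power_mono[OF assms(2,1), of 2] by (simp_all add: cutoff_def)

lemma cutoff_le: "0 \<le> c + k / r \<Longrightarrow> cutoff c k r t \<le> (c + k / r) ^ 4"
proof -
  have "max 0 ((c + k / r)\<^sup>2 - t\<^sup>2) \<le> (c + k / r)\<^sup>2" by simp
  from power_mono[OF this, of 2] show ?thesis by (simp add: cutoff_def flip: power_mult)
qed

text \<open>On the support \<open>|t|\<close> is at most the edge \<open>c + k / r\<close>, and the
  edge moves inwards at speed \<open>k / r^2\<close>, at least \<open>e\<close>. Off the support
  both sides vanish.\<close>

lemma cutoff_r_le: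
  assumes "0 \<le> c" "0 \<le> k" "0 < r" "e \<le> k / r\<^sup>2" "0 \<le> e"
  shows "cutoff_r c k r t \<le> - (\<bar>cutoff_t c k r t\<bar> * e)"
proof (cases "t\<^sup>2 < (c + k / r)\<^sup>2")
  case True
  define M where "M = max 0 ((c + k / r)\<^sup>2 - t\<^sup>2)"
  have M: "0 \<le> M" by (simp add: M_def)
  have b: "0 \<le> c + k / r" using assms by simp
  from True b have t: "\<bar>t\<bar> \<le> c + k / r" using power2_less_imp_less[of "\<bar>t\<bar>" "c + k / r"] by simp
  have "\<bar>t\<bar> * e \<le> (c + k / r) * (k / r\<^sup>2)" using t assms b by (intro mult_mono) auto
  then have "4 * M * (\<bar>t\<bar> * e) \<le> 4 * M * ((c + k / r) * (k / r\<^sup>2))" using M by (intro mult_left_mono) auto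
  moreover have "\<bar>cutoff_t c k r t\<bar> = 4 * M * \<bar>t\<bar>" by (simp add: cutoff_t_def M_def abs_mult)
  moreover have "cutoff_r c k r t = - (4 * M * ((c + k / r) * (k / r\<^sup>2)))" by (simp add: cutoff_r_def M_def)
  ultimately show ?thesis by (simp add: mult.assoc)
qed (simp add: cutoff_r_def cutoff_t_def)

section \<open>Continuity of the fields and propagation of the weighted energy\<close>

context sds_wave
begin

lemma continuous_on_D: "continuous_on (exterior (rC \<Lambda> m)) (\<lambda>p. D (fst p))"
proof (rule continuous_on_compose2[of "{rC \<Lambda> m<..}" D])
  show "continuous_on {rC \<Lambda> m<..} D"
    using r_bounds(1) by (intro continuous_at_imp_continuous_on ballI isCont_D) auto
qed (auto simp: exterior_def intro!: continuous_intros)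

lemmas continuous_on_fields =
  smooth_continuous_on[OF smooth_u subset_refl]
  smooth_continuous_on[OF smooth_d_r[OF smooth_u] subset_refl]
  smooth_continuous_on[OF smooth_d_t[OF smooth_u] subset_refl]
  smooth_continuous_on[OF smooth_d_x[OF smooth_u] subset_refl]
  smooth_continuous_on[OF smooth_d_r[OF smooth_d_r[OF smooth_u]] subset_refl]
  smooth_continuous_on[OF smooth_d_t[OF smooth_d_r[OF smooth_u]] subset_refl]
  smooth_continuous_on[OF smooth_d_t[OF smooth_d_t[OF smooth_u]] subset_refl]
  smooth_continuous_on[OF smooth_d_x[OF smooth_d_r[OF smooth_u]] subset_refl]
  smooth_continuous_on[OF smooth_d_x[OF smooth_d_x[OF smooth_u]] subset_refl]
  smooth_continuous_on[OF smooth_d_r[OF smooth_psi] subset_refl]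
  smooth_continuous_on[OF smooth_d_t[OF smooth_psi] subset_refl]
  smooth_continuous_on[OF smooth_d_x[OF smooth_psi] subset_refl]
  smooth_continuous_on[OF smooth_d_r[OF smooth_d_r[OF smooth_psi]] subset_refl]
  smooth_continuous_on[OF smooth_d_t[OF smooth_d_t[OF smooth_psi]] subset_refl]
  smooth_continuous_on[OF smooth_d_x[OF smooth_d_x[OF smooth_psi]] subset_refl]

lemma exterior_nonzero:
  "\<forall>p\<in>exterior (rC \<Lambda> m). fst p \<noteq> 0" "\<forall>p\<in>exterior (rC \<Lambda> m). D (fst p) \<noteq> 0"
  using r_bounds by (auto simp: exterior_def)

lemmas continuous_on_rules =
  continuous_on_const continuous_on_fields continuous_on_D continuous_on_add continuous_on_diff continuous_on_minus
  continuous_on_mult continuous_on_divide continuous_on_power continuous_on_sum continuous_on_fst[OF continuous_on_id]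

lemma continuous_on_densities:
  shows "continuous_on (exterior (rC \<Lambda> m)) (\<lambda>p. edens u (fst p) (fst (snd p)) (snd (snd p)))"
    and "continuous_on (exterior (rC \<Lambda> m)) (\<lambda>p. edens \<psi> (fst p) (fst (snd p)) (snd (snd p)))"
    and "continuous_on (exterior (rC \<Lambda> m)) (\<lambda>p. mdens (fst p) (fst (snd p)) (snd (snd p)))"
    and "continuous_on (exterior (rC \<Lambda> m)) (\<lambda>p. mdens' (fst p) (fst (snd p)) (snd (snd p)))"
    and "continuous_on (exterior (rC \<Lambda> m)) (\<lambda>p. flux_t (fst p) (fst (snd p)) (snd (snd p)))"
    and "continuous_on (exterior (rC \<Lambda> m)) (\<lambda>p. flux_t' (fst p) (fst (snd p)) (snd (snd p)))"
    and "continuous_on (exterior (rC \<Lambda> m)) (\<lambda>p. flux_x' (fst p) (fst (snd p)) (snd (snd p)) i j)"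
  using exterior_nonzero
  unfolding mdens_def mdens'_def edens_def dot_x_def weight_def flux_t_def flux_t'_def flux_x'_def
  by - (rule continuous_on_rules | simp)+

lemma slab_subset_exterior:
  "rC \<Lambda> m < r\<^sub>1 \<Longrightarrow> {r\<^sub>1..r\<^sub>2} \<times> I \<times> sphere 0 1 \<subseteq> exterior (rC \<Lambda> m)"
  by (auto simp: exterior_def)

text \<open>The two weights work separately: differentiating \<open>exp (C / r)\<close> supplies
  \<open>- C / r^2\<close> times the density and pays for \<open>bulk\<close>, while the
  \<open>r\<close>-derivative of the cutoff pays for the flux through its time gradient. The slab
  has the half-width of the support at \<open>r\<^sub>1\<close>, which contains the supports at all
  larger radii.\<close>

lemma weighted_energy_antimono:
  assumes r\<^sub>0: "rC \<Lambda> m < r\<^sub>0" and r\<^sub>1: "r\<^sub>0 \<le> r\<^sub>1" and r\<^sub>2: "r\<^sub>1 \<le> r\<^sub>2" and c: "0 \<le> c"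
  defines "C \<equiv> bulk_const r\<^sub>0" and "k \<equiv> 2 * r\<^sub>0\<^sup>2 / D r\<^sub>0"
  shows "slab_int (c + k / r\<^sub>1) (\<lambda>t y. exp (C / r\<^sub>2) * cutoff c k r\<^sub>2 t * mdens r\<^sub>2 t y)
       \<le> slab_int (c + k / r\<^sub>1) (\<lambda>t y. exp (C / r\<^sub>1) * cutoff c k r\<^sub>1 t * mdens r\<^sub>1 t y)"
proof -
  define g where "g r t = exp (C / r) * cutoff c k r t" for r t
  define g_r where "g_r r t = exp (C / r) * (- (C / r\<^sup>2)) * cutoff c k r t + cutoff_r c k r t * exp (C / r)" for r t
  define g_t where "g_t r t = exp (C / r) * cutoff_t c k r t" for r t
  define T where "T = c + k / r\<^sub>1"
  have k: "0 < k" using r_bounds[OF r\<^sub>0] by (simp add: k_def)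
  have T: "0 \<le> T" using k c r_bounds(1)[OF r\<^sub>0] r\<^sub>1 by (simp add: T_def)
  have ext: "rC \<Lambda> m < r" if "r \<in> {r\<^sub>1..r\<^sub>2}" for r using that r\<^sub>0 r\<^sub>1 by auto
  have sub: "{r\<^sub>1..r\<^sub>2} \<times> {-T..T} \<times> sphere (0::real^3) 1 \<subseteq> exterior (rC \<Lambda> m)"
    by (rule slab_subset_exterior) (use r\<^sub>0 r\<^sub>1 in auto)
  have nz: "\<forall>p\<in>{r\<^sub>1..r\<^sub>2} \<times> {-T..T} \<times> sphere (0::real^3) 1. fst p \<noteq> 0"
    using exterior_nonzero(1) sub by blast
  have conts: "continuous_on ({r\<^sub>1..r\<^sub>2} \<times> {-T..T} \<times> sphere (0::real^3) 1) (\<lambda>p. g (fst p) (fst (snd p)))"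
    "continuous_on ({r\<^sub>1..r\<^sub>2} \<times> {-T..T} \<times> sphere (0::real^3) 1) (\<lambda>p. g_r (fst p) (fst (snd p)))"
    "continuous_on ({r\<^sub>1..r\<^sub>2} \<times> {-T..T} \<times> sphere (0::real^3) 1) (\<lambda>p. g_t (fst p) (fst (snd p)))"
    using nz unfolding g_def g_r_def g_t_def cutoff_def cutoff_r_def cutoff_t_def
    by - (intro continuous_intros; simp)+
  note dens = continuous_on_densities[THEN continuous_on_subset, OF sub]
  have g_nonneg: "0 \<le> g r t" for r t by (simp add: g_def cutoff_nonneg)
  have g_r_deriv: "((\<lambda>r. g r t) has_field_derivative g_r r t) (at r)" if "r \<in> {r\<^sub>1..r\<^sub>2}" for r t
  proof -
    have r: "r \<noteq> 0" using r_bounds(4)[OF ext[OF that]] .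
    then have "((\<lambda>r. exp (C / r)) has_field_derivative exp (C / r) * (- (C / r\<^sup>2))) (at r)"
      by (auto intro!: derivative_eq_intros simp: power2_eq_square)
    from DERIV_mult[OF this cutoff_r_derivative[OF r]] show ?thesis unfolding g_def g_r_def .
  qed
  have g_t_deriv: "((\<lambda>t. g r t) has_field_derivative g_t r t) (at t)" for r t
    unfolding g_def g_t_def by (intro DERIV_cmult cutoff_t_derivative)
  have "slab_int T (\<lambda>t y. g r\<^sub>2 t * mdens r\<^sub>2 t y) \<le> slab_int T (\<lambda>t y. g r\<^sub>1 t * mdens r\<^sub>1 t y)"
  proof (rule slab_int_current_antimono[where A="\<lambda>r t y. g r t * mdens r t y"
        and A'="\<lambda>r t y. g_r r t * mdens r t y + mdens' r t y * g r t"
        and B="\<lambda>r t y. g r t * flux_t r t y" and B'="\<lambda>r t y. g_t r t * flux_t r t y + flux_t' r t y * g r t"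
        and V="\<lambda>r t y. g r t *\<^sub>R flux_x r t y" and W="\<lambda>r t y i j. g r t * flux_x' r t y i j"])
    show "continuous_on ({r\<^sub>1..r\<^sub>2} \<times> {-T..T} \<times> sphere 0 1) (\<lambda>(r, t, y). g r t * mdens r t y)"
      "continuous_on ({r\<^sub>1..r\<^sub>2} \<times> {-T..T} \<times> sphere 0 1) (\<lambda>(r, t, y). g_r r t * mdens r t y + mdens' r t y * g r t)"
      "continuous_on ({r\<^sub>1..r\<^sub>2} \<times> {-T..T} \<times> sphere 0 1) (\<lambda>(r, t, y). g r t * flux_t r t y)"
      "continuous_on ({r\<^sub>1..r\<^sub>2} \<times> {-T..T} \<times> sphere 0 1) (\<lambda>(r, t, y). g_t r t * flux_t r t y + flux_t' r t y * g r t)"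
      "\<And>i j. continuous_on ({r\<^sub>1..r\<^sub>2} \<times> {-T..T} \<times> sphere 0 1) (\<lambda>(r, t, y). g r t * flux_x' r t y i j)"
      unfolding split_beta by (intro continuous_on_add continuous_on_mult conts dens)+
  next
    fix r t :: real and y :: "real^3"
    assume r: "r \<in> {r\<^sub>1..r\<^sub>2}" and y: "norm y = 1"
    then have y0: "y \<noteq> 0" by auto
    note rr = ext[OF r]
    show "((\<lambda>r. g r t * mdens r t y) has_field_derivative g_r r t * mdens r t y + mdens' r t y * g r t) (at r)"
      by (rule DERIV_mult[OF g_r_deriv[OF r] mdens_derivative[OF rr y0]])
    show "((\<lambda>t. g r t * flux_t r t y) has_field_derivative g_t r t * flux_t r t y + flux_t' r t y * g r t) (at t)"
      by (rule DERIV_mult[OF g_t_deriv flux_t_derivative[OF rr y0]])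
    show "((\<lambda>y. (g r t *\<^sub>R flux_x r t y) $ i) has_derivative (\<lambda>v. \<Sum>j\<in>UNIV. g r t * flux_x' r t y i j * v $ j)) (at y)" for i
      using has_derivative_mult_right[OF flux_x_derivative[OF rr y0, of t i], of "g r t"]
      by (simp add: sum_distrib_left mult.assoc)
    have "D r\<^sub>0 / r\<^sub>0\<^sup>2 * r\<^sup>2 \<le> D r" using D_ge[OF r\<^sub>0] r r\<^sub>1 by auto
    \<comment> \<open>The purpose of the choice of \<open>k\<close>: equality at
      \<open>r\<^sub>0\<close>, and \<open>D_ge\<close> beyond.\<close>
    then have e: "2 / D r \<le> k / r\<^sup>2"
      using r_bounds[OF r\<^sub>0] r_bounds[OF rr] by (simp add: k_def field_simps)
    have "cutoff_r c k r t \<le> - (\<bar>cutoff_t c k r t\<bar> * (2 / D r))"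
      using e c k r_bounds[OF rr] by (intro cutoff_r_le) auto
    then have "cutoff_r c k r t * mdens r t y \<le> - (\<bar>cutoff_t c k r t\<bar> * (2 / D r)) * mdens r t y"
      by (rule mult_right_mono[OF _ mdens_nonneg[OF rr]])
    also have "\<dots> = - (\<bar>cutoff_t c k r t\<bar> * (2 / D r * mdens r t y))" by simp
    also have "\<dots> \<le> - (\<bar>cutoff_t c k r t\<bar> * \<bar>flux_t r t y\<bar>)"
      using mult_left_mono[OF flux_t_le[OF rr], of "\<bar>cutoff_t c k r t\<bar>"] by simp
    also have "\<dots> \<le> cutoff_t c k r t * flux_t r t y"
      by (simp flip: abs_mult)
    finally have cut: "exp (C / r) * (cutoff_r c k r t * mdens r t y) \<le> exp (C / r) * (cutoff_t c k r t * flux_t r t y)"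
      by (intro mult_left_mono) auto
    have bulk: "g r t * bulk r t y \<le> g r t * (C / r\<^sup>2 * mdens r t y)"
      using bulk_le[OF r\<^sub>0, of r t y] r r\<^sub>1 g_nonneg unfolding C_def by (intro mult_left_mono) auto
    have "g_r r t * mdens r t y + mdens' r t y * g r t
       = exp (C / r) * (cutoff_r c k r t * mdens r t y) - g r t * (C / r\<^sup>2 * mdens r t y)
         + g r t * bulk r t y + (flux_t' r t y + (\<Sum>i\<in>UNIV. flux_x' r t y i i)) * g r t"
      unfolding mdens'_eq[OF rr y] by (simp add: g_def g_r_def algebra_simps)
    also have "\<dots> \<le> exp (C / r) * (cutoff_t c k r t * flux_t r t y) + (flux_t' r t y + (\<Sum>i\<in>UNIV. flux_x' r t y i i)) * g r t"
      using cut bulk by linarith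
    also have "\<dots> = g_t r t * flux_t r t y + flux_t' r t y * g r t + (\<Sum>i\<in>UNIV. g r t * flux_x' r t y i i)"
      by (simp add: g_t_def sum_distrib_left[symmetric] algebra_simps)
    finally show "g_r r t * mdens r t y + mdens' r t y * g r t
      \<le> g_t r t * flux_t r t y + flux_t' r t y * g r t + (\<Sum>i\<in>UNIV. g r t * flux_x' r t y i i)" .
  next
    fix r t :: real and y :: "real^3"
    assume "r \<in> {r\<^sub>1..r\<^sub>2}" "y \<noteq> 0"
    then show "g r t *\<^sub>R flux_x r t y \<bullet> y = 0" using flux_x_tangential[OF ext] by simp
  next
    fix r and y :: "real^3" assume r: "r \<in> {r\<^sub>1..r\<^sub>2}"
    have "0 \<le> c + k / r" "c + k / r \<le> T"
      using c k r r_bounds(1)[OF ext[OF r]] r_bounds(1)[OF r\<^sub>0] r\<^sub>1 by (auto simp: T_def intro!: divide_left_mono)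
    then show "g r T * flux_t r T y = 0" "g r (-T) * flux_t r (-T) y = 0"
      by (simp_all add: g_def cutoff_eq_0)
  qed (use r\<^sub>2 T in auto)
  then show ?thesis by (simp add: g_def T_def)
qed

text \<open>The integral of \<open>u\<^sup>2\<close> over a slice is not controlled by the energies term by term; instead the wave
  equation \<open>u = - r u\<^sub>r + (r\<^sup>2/D) \<psi>\<^sub>t\<^sub>t + \<Delta>\<psi>\<close> is tested against \<open>u\<close> and integrated by parts on the slice.\<close>

lemma cutoff_u_square_pointwise:
  assumes r\<^sub>0: "rC \<Lambda> m < r\<^sub>0" and r: "r\<^sub>0 \<le> r" and c: "1 \<le> c" and k: "0 \<le> k"
    and t: "\<bar>t\<bar> \<le> c + k / r" and y: "norm y = 1"
  shows "1/2 * (cutoff c k r t * (u r t y)\<^sup>2)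
     \<le> (cutoff_t c k r t * (r\<^sup>2 * (1 / D r) * (u r t y * d_t \<psi> r t y))
         + r\<^sup>2 * (1 / D r) * (d_t u r t y * d_t \<psi> r t y + u r t y * d_t (d_t \<psi>) r t y) * cutoff c k r t
         + cutoff c k r t * (dot_x u \<psi> r t y + u r t y * lap \<psi> r t y))
       + (c + k / r) ^ 4 * ((2 + 2 / D r\<^sub>0 + 32 * r\<^sub>0\<^sup>2 / D r\<^sub>0) * (edens u r t y + edens \<psi> r t y))"
proof -
  have rr: "rC \<Lambda> m < r" using assms by linarith
  note rb = r_bounds[OF rr] and r0b = r_bounds[OF r\<^sub>0]
  define T where "T = c + k / r"
  define \<eta> where "\<eta> = max 0 (T\<^sup>2 - t\<^sup>2)"
  define q where "q = r\<^sup>2 * (1 / D r)"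
  define U a b z where "U = u r t y" and "a = d_r u r t y" and "b = d_t u r t y" and "z = d_t \<psi> r t y"
  define eu ep where "eu = edens u r t y" and "ep = edens \<psi> r t y"
  have T: "1 \<le> T" using c k rb by (simp add: T_def add_increasing2)
  have \<eta>: "0 \<le> \<eta>" "\<eta> \<le> T\<^sup>2" by (simp_all add: \<eta>_def)
  have \<chi>: "cutoff c k r t = \<eta>\<^sup>2" "cutoff_t c k r t = - (4 * t * \<eta>)"
    by (simp_all add: cutoff_def cutoff_t_def \<eta>_def T_def)
  have \<chi>_le: "\<eta>\<^sup>2 \<le> T ^ 4" using power_mono[OF \<eta>(2,1), of 2] by (simp flip: power_mult)
  \<comment> \<open>Here \<open>1 \<le> c\<close> enters: the factor \<open>t\<^sup>2\<close>
    produced by the time derivative of the cutoff must also be measured against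
    \<open>T ^ 4\<close>.\<close>
  have T24: "T\<^sup>2 \<le> T ^ 4" using T by (intro power_increasing) auto
  have D0: "D r\<^sub>0 \<le> D r"
  proof -
    have "r\<^sub>0\<^sup>2 \<le> r\<^sup>2" using r r0b by (intro power_mono) auto
    then have "D r\<^sub>0 / r\<^sub>0\<^sup>2 * r\<^sub>0\<^sup>2 \<le> D r\<^sub>0 / r\<^sub>0\<^sup>2 * r\<^sup>2" using r0b by (intro mult_left_mono) (auto simp: less_imp_le)
    then show ?thesis using D_ge[OF r\<^sub>0 r] r0b by simp
  qed
  have q: "0 < q" "q \<le> r\<^sub>0\<^sup>2 / D r\<^sub>0"
    using D_ge[OF r\<^sub>0 r] rb r0b by (auto simp: q_def field_simps)
  have e: "0 \<le> eu" "0 \<le> ep" "q * b\<^sup>2 \<le> 2 * eu" "q * z\<^sup>2 \<le> 2 * ep"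
    "dot_x u u r t y \<le> 2 * eu" "dot_x \<psi> \<psi> r t y \<le> 2 * ep" "r\<^sup>2 * D r * a\<^sup>2 \<le> 2 * eu"
    unfolding eu_def ep_def q_def b_def z_def a_def
    using edens_bounds[OF rr] by blast+
  \<comment> \<open>The energy of \<open>u\<close> controls
    \<open>r\<^sup>2 * D r * a\<^sup>2\<close>, and \<open>D\<close> does not fall below its value
    at \<open>r\<^sub>0\<close>; this keeps the bound uniform in \<open>r\<close>.\<close>
  have ra: "r\<^sup>2 * a\<^sup>2 \<le> 2 / D r\<^sub>0 * eu"
  proof -
    have "r\<^sup>2 * a\<^sup>2 * D r\<^sub>0 \<le> r\<^sup>2 * a\<^sup>2 * D r" using D0 by (intro mult_left_mono) auto
    also have "\<dots> \<le> 2 * eu" using e(7) by (simp add: mult_ac)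
    finally show ?thesis using r0b by (simp add: field_simps)
  qed
  have i1: "- (\<eta>\<^sup>2 * (r * U * a)) \<le> 1/4 * (\<eta>\<^sup>2 * U\<^sup>2) + T ^ 4 * (2 / D r\<^sub>0 * eu)"
  proof -
    have "0 \<le> (\<eta> * (1/2 * U + r * a))\<^sup>2" by simp
    also have "\<dots> = 1/4 * (\<eta>\<^sup>2 * U\<^sup>2) + \<eta>\<^sup>2 * (r * U * a) + \<eta>\<^sup>2 * (r\<^sup>2 * a\<^sup>2)" by (simp add: power2_eq_square algebra_simps)
    also have "\<eta>\<^sup>2 * (r\<^sup>2 * a\<^sup>2) \<le> T ^ 4 * (2 / D r\<^sub>0 * eu)" by (rule mult_mono[OF \<chi>_le ra]) auto
    finally show ?thesis by simp
  qed
  \<comment> \<open>The time derivative of the cutoff retains one power of \<eta>, just enough to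
    complete the square with \<open>1/2 * \<eta> * U\<close>. What is left over is
    \<open>16 * t\<^sup>2 * q\<^sup>2 * z\<^sup>2\<close>, and
    \<open>q * z\<^sup>2 \<le> 2 * ep\<close> makes this the 32 of the constant.\<close>
  have i2: "4 * t * \<eta> * (q * (U * z)) \<le> 1/4 * (\<eta>\<^sup>2 * U\<^sup>2) + T ^ 4 * (32 * r\<^sub>0\<^sup>2 / D r\<^sub>0 * ep)"
  proof -
    have "0 \<le> (1/2 * \<eta> * U - 4 * t * q * z)\<^sup>2" by simp
    also have "\<dots> = 1/4 * (\<eta>\<^sup>2 * U\<^sup>2) - 4 * t * \<eta> * (q * (U * z)) + t\<^sup>2 * (16 * q * (q * z\<^sup>2))"
      by (simp add: power2_eq_square algebra_simps)
    also have "t\<^sup>2 * (16 * q * (q * z\<^sup>2)) \<le> T ^ 4 * (16 * (r\<^sub>0\<^sup>2 / D r\<^sub>0) * (2 * ep))"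
    proof (rule mult_mono)
      show "16 * q * (q * z\<^sup>2) \<le> 16 * (r\<^sub>0\<^sup>2 / D r\<^sub>0) * (2 * ep)"
        by (rule mult_mono[OF mult_left_mono[OF q(2)] e(4)]) (use q r0b in auto)
      have "t\<^sup>2 \<le> T\<^sup>2" using t unfolding T_def by (simp add: abs_le_square_iff[symmetric])
      then show "t\<^sup>2 \<le> T ^ 4" using T24 by linarith
    qed (use q e T in auto)
    finally show ?thesis by simp
  qed
  have i3: "- (q * (b * z) * \<eta>\<^sup>2) \<le> T ^ 4 * (eu + ep)"
  proof -
    have "- (b * z) \<le> 1/2 * (b\<^sup>2 + z\<^sup>2)"
      using zero_le_power2[of "b + z"] by (simp add: power2_eq_square algebra_simps)
    then have "q * - (b * z) \<le> q * (1/2 * (b\<^sup>2 + z\<^sup>2))" using q by (intro mult_left_mono) auto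
    also have "\<dots> \<le> eu + ep" using e(3,4) by (simp add: algebra_simps)
    finally have "\<eta>\<^sup>2 * (q * - (b * z)) \<le> \<eta>\<^sup>2 * (eu + ep)" by (intro mult_left_mono) auto
    also have "\<dots> \<le> T ^ 4 * (eu + ep)" using \<chi>_le e by (intro mult_right_mono) auto
    finally show ?thesis by (simp add: mult_ac)
  qed
  have i4: "- (\<eta>\<^sup>2 * dot_x u \<psi> r t y) \<le> T ^ 4 * (eu + ep)"
  proof -
    have "- dot_x u \<psi> r t y \<le> eu + ep"
      using dot_x_young[of 1 u \<psi> r t y] e(5,6) by auto
    then have "\<eta>\<^sup>2 * - dot_x u \<psi> r t y \<le> \<eta>\<^sup>2 * (eu + ep)" by (intro mult_left_mono) auto
    also have "\<dots> \<le> T ^ 4 * (eu + ep)" using \<chi>_le e by (intro mult_right_mono) auto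
    finally show ?thesis by simp
  qed
  have wave: "U * (q * d_t (d_t \<psi>) r t y + lap \<psi> r t y) = U * (U + r * a)"
    using wave_equation[OF rr y, of t] by (simp add: U_def a_def q_def)
  \<comment> \<open>The parenthesis is the divergence part. Of the four other products, those
    bounded by \<open>i1\<close> and \<open>i2\<close> cost a quarter of the left side each, so half
    of it survives.\<close>
  have split: "\<eta>\<^sup>2 * U\<^sup>2 = (- (4 * t * \<eta>) * (q * (U * z)) + q * (b * z + U * d_t (d_t \<psi>) r t y) * \<eta>\<^sup>2 + \<eta>\<^sup>2 * (dot_x u \<psi> r t y + U * lap \<psi> r t y))
     + 4 * t * \<eta> * (q * (U * z)) + - (q * (b * z) * \<eta>\<^sup>2) + - (\<eta>\<^sup>2 * dot_x u \<psi> r t y) + - (\<eta>\<^sup>2 * (r * U * a))"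
  proof -
    have "\<eta>\<^sup>2 * (U * (q * d_t (d_t \<psi>) r t y + lap \<psi> r t y)) = \<eta>\<^sup>2 * (U * (U + r * a))" by (simp only: wave)
    then show ?thesis by (simp add: algebra_simps power2_eq_square)
  qed
  have bound: "T ^ 4 * (2 / D r\<^sub>0 * eu) + T ^ 4 * (32 * r\<^sub>0\<^sup>2 / D r\<^sub>0 * ep) + T ^ 4 * (eu + ep) + T ^ 4 * (eu + ep)
     \<le> T ^ 4 * ((2 + 2 / D r\<^sub>0 + 32 * r\<^sub>0\<^sup>2 / D r\<^sub>0) * (eu + ep))"
  proof -
    have "2 / D r\<^sub>0 * eu + 32 * r\<^sub>0\<^sup>2 / D r\<^sub>0 * ep + (eu + ep) + (eu + ep)
       \<le> 2 / D r\<^sub>0 * (eu + ep) + 32 * r\<^sub>0\<^sup>2 / D r\<^sub>0 * (eu + ep) + (eu + ep) + (eu + ep)"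
      using e r0b by (intro add_mono mult_left_mono) (auto simp: less_imp_le)
    also have "\<dots> = (2 + 2 / D r\<^sub>0 + 32 * r\<^sub>0\<^sup>2 / D r\<^sub>0) * (eu + ep)" by (simp add: algebra_simps)
    finally have "T ^ 4 * (2 / D r\<^sub>0 * eu + 32 * r\<^sub>0\<^sup>2 / D r\<^sub>0 * ep + (eu + ep) + (eu + ep))
       \<le> T ^ 4 * ((2 + 2 / D r\<^sub>0 + 32 * r\<^sub>0\<^sup>2 / D r\<^sub>0) * (eu + ep))" using T by (intro mult_left_mono) auto
    then show ?thesis by (simp only: distrib_left)
  qed
  have "1/2 * A \<le> X + R"
    if "A = X + p\<^sub>2 + p\<^sub>3 + p\<^sub>4 + p\<^sub>1" "p\<^sub>1 \<le> 1/4 * A + e\<^sub>1" "p\<^sub>2 \<le> 1/4 * A + e\<^sub>2" "p\<^sub>3 \<le> e\<^sub>3" "p\<^sub>4 \<le> e\<^sub>3" "e\<^sub>1 + e\<^sub>2 + e\<^sub>3 + e\<^sub>3 \<le> R"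
    for A X R p\<^sub>1 p\<^sub>2 p\<^sub>3 p\<^sub>4 e\<^sub>1 e\<^sub>2 e\<^sub>3 :: real
    using that by linarith
  from this[OF split i1 i2 i3 i4 bound] have "1/2 * (\<eta>\<^sup>2 * U\<^sup>2) \<le> (- (4 * t * \<eta>) * (q * (U * z)) + q * (b * z + U * d_t (d_t \<psi>) r t y) * \<eta>\<^sup>2 + \<eta>\<^sup>2 * (dot_x u \<psi> r t y + U * lap \<psi> r t y))
     + T ^ 4 * ((2 + 2 / D r\<^sub>0 + 32 * r\<^sub>0\<^sup>2 / D r\<^sub>0) * (eu + ep))"
    .
  then show ?thesis
    unfolding \<chi> unfolding T_def q_def U_def b_def z_def eu_def ep_def .
qed

lemma slice_subset_exterior:
  "rC \<Lambda> m < r \<Longrightarrow> Pair r ` (I \<times> sphere 0 1) \<subseteq> exterior (rC \<Lambda> m)"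
  by (auto simp: exterior_def)

lemma continuous_on_slab:
  assumes "continuous_on (exterior (rC \<Lambda> m)) (\<lambda>p. f (fst p) (fst (snd p)) (snd (snd p)))" "rC \<Lambda> m < r"
  shows "continuous_on (I \<times> sphere 0 1) (\<lambda>(t, y). f r t y)"
proof -
  have "continuous_on (I \<times> sphere 0 1) (Pair r)" by (intro continuous_intros)
  from continuous_on_compose2[OF assms(1) this slice_subset_exterior[OF assms(2)]]
  show ?thesis by (simp add: split_beta)
qed

lemma continuous_on_cutoff:
  fixes X :: "(real \<times> (real^3)) set"
  shows "continuous_on X (\<lambda>p. cutoff c k r (fst p))" "continuous_on X (\<lambda>p. cutoff_t c k r (fst p))"
  unfolding cutoff_def cutoff_t_def by (intro continuous_intros)+

text \<open>The divergence integrates to zero because the cutoff vanishes at both ends of the slab;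
  doubling the rest gives the constant. It depends on \<open>r\<^sub>0\<close> and the metric alone,
  and the width enters only through \<open>T ^ 4\<close> and the slab itself.\<close>

lemma slab_int_cutoff_u_square:
  assumes r\<^sub>0: "rC \<Lambda> m < r\<^sub>0" and r: "r\<^sub>0 \<le> r" and c: "1 \<le> c" and k: "0 \<le> k"
  defines "T \<equiv> c + k / r"
  shows "slab_int T (\<lambda>t y. cutoff c k r t * (u r t y)\<^sup>2)
    \<le> T ^ 4 * ((4 + 4 / D r\<^sub>0 + 64 * r\<^sub>0\<^sup>2 / D r\<^sub>0) * slab_int T (\<lambda>t y. edens u r t y + edens \<psi> r t y))"
proof -
  have rr: "rC \<Lambda> m < r" using assms by linarith
  note rb = r_bounds[OF rr]
  have T: "0 \<le> T" using c k rb by (simp add: T_def)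
  define B where "B t y = cutoff c k r t * (r\<^sup>2 * (1 / D r) * (u r t y * d_t \<psi> r t y))" for t y
  define B' where "B' t y = cutoff_t c k r t * (r\<^sup>2 * (1 / D r) * (u r t y * d_t \<psi> r t y))
         + r\<^sup>2 * (1 / D r) * (d_t u r t y * d_t \<psi> r t y + u r t y * d_t (d_t \<psi>) r t y) * cutoff c k r t" for t y
  define V where "V t y = (\<chi> i. cutoff c k r t * (u r t y * d_x i \<psi> r t y))" for t y
  define W where "W t y i j = cutoff c k r t * (d_x j u r t y * d_x i \<psi> r t y + u r t y * d_x j (d_x i \<psi>) r t y)" for t y i j
  define K where "K = 2 + 2 / D r\<^sub>0 + 32 * r\<^sub>0\<^sup>2 / D r\<^sub>0"
  define e where "e t y = edens u r t y + edens \<psi> r t y" for t y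
  note fields = continuous_on_fields[THEN continuous_on_slab, OF rr, unfolded split_beta]
  note rules = continuous_on_cutoff fields continuous_on_add continuous_on_mult continuous_on_power continuous_on_sum continuous_on_const
  have B_cont: "continuous_on ({-T..T} \<times> sphere 0 1) (\<lambda>(t, y). B t y)"
    and B'_cont: "continuous_on ({-T..T} \<times> sphere 0 1) (\<lambda>(t, y). B' t y)"
    and W_cont: "continuous_on ({-T..T} \<times> sphere 0 1) (\<lambda>(t, y). W t y i j)"
    and div_cont: "continuous_on ({-T..T} \<times> sphere 0 1) (\<lambda>(t, y). B' t y + (\<Sum>i\<in>UNIV. W t y i i))"
    and u_cont: "continuous_on ({-T..T} \<times> sphere 0 1) (\<lambda>(t, y). 1/2 * (cutoff c k r t * (u r t y)\<^sup>2))"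
    for i j
    unfolding B_def B'_def W_def split_beta by (rule rules)+
  have e_cont: "continuous_on ({-T..T} \<times> sphere 0 1) (\<lambda>(t, y). T ^ 4 * (K * e t y))"
    unfolding e_def split_beta
    by (intro continuous_on_mult continuous_on_add continuous_on_const
        continuous_on_densities(1,2)[THEN continuous_on_slab, OF rr, unfolded split_beta])
  have "slab_int T (\<lambda>t y. 1/2 * (cutoff c k r t * (u r t y)\<^sup>2))
     \<le> slab_int T (\<lambda>t y. (B' t y + (\<Sum>i\<in>UNIV. W t y i i)) + T ^ 4 * (K * e t y))"
  proof (rule slab_int_mono[OF u_cont])
    show "continuous_on ({-T..T} \<times> sphere 0 1) (\<lambda>(t, y). (B' t y + (\<Sum>i\<in>UNIV. W t y i i)) + T ^ 4 * (K * e t y))"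
      using continuous_on_add[OF div_cont e_cont] by (simp add: split_beta)
    fix t and y :: "real^3" assume t: "\<bar>t\<bar> \<le> T" and y: "norm y = 1"
    have "(\<Sum>i\<in>UNIV. W t y i i) = cutoff c k r t * (dot_x u \<psi> r t y + u r t y * lap \<psi> r t y)"
      by (simp add: W_def dot_x_def lap_def sum_distrib_left sum.distrib distrib_left)
    then show "1/2 * (cutoff c k r t * (u r t y)\<^sup>2) \<le> (B' t y + (\<Sum>i\<in>UNIV. W t y i i)) + T ^ 4 * (K * e t y)"
      using cutoff_u_square_pointwise[OF r\<^sub>0 r c k t[unfolded T_def] y]
      by (simp only: B'_def K_def e_def T_def)
  qed
  also have "\<dots> = slab_int T (\<lambda>t y. B' t y + (\<Sum>i\<in>UNIV. W t y i i)) + slab_int T (\<lambda>t y. T ^ 4 * (K * e t y))"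
    by (rule slab_int_add[OF div_cont e_cont])
  also have "slab_int T (\<lambda>t y. B' t y + (\<Sum>i\<in>UNIV. W t y i i)) = 0"
  proof (rule slab_divergence_theorem[OF T, where B=B and V=V and W=W])
    fix t and y :: "real^3" assume "norm y = 1"
    then have y0: "y \<noteq> 0" by auto
    show "((\<lambda>t. B t y) has_field_derivative B' t y) (at t)"
      unfolding B_def B'_def
      by (rule DERIV_cong[OF DERIV_mult[OF cutoff_t_derivative DERIV_cmult[OF DERIV_mult[OF
            d_t_derivative[OF smooth_u rr y0] d_t_derivative[OF smooth_d_t[OF smooth_psi] rr y0]]]]])
        (simp add: algebra_simps)
    show "((\<lambda>y. V t y $ i) has_derivative (\<lambda>v. \<Sum>j\<in>UNIV. W t y i j * v $ j)) (at y)" for i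
      using has_derivative_mult_right[OF has_derivative_mult_d_x[OF d_x_derivative[OF smooth_u rr y0, of t]
          d_x_derivative[OF smooth_d_x[OF smooth_psi] rr y0, of i t]], of "cutoff c k r t"]
      by (simp add: V_def W_def sum_distrib_left mult.assoc)
  next
    fix y :: "real^3"
    show "B T y = 0" "B (-T) y = 0"
      unfolding B_def using cutoff_eq_0[of c k r T] T by (simp_all only: T_def order_refl mult_zero_left)
  next
    fix t and y :: "real^3" assume y: "y \<noteq> 0"
    have "(\<Sum>j\<in>UNIV. d_x j \<psi> r t y * y $ j) = 0"
      by (rule radial_d_x_zero[OF smooth_psi psi_homogeneous[OF _ rr y] rr y])
    moreover have "V t y \<bullet> y = cutoff c k r t * (u r t y * (\<Sum>j\<in>UNIV. d_x j \<psi> r t y * y $ j))"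
      by (simp add: V_def inner_vec_def sum_distrib_left mult.assoc)
    ultimately show "V t y \<bullet> y = 0" by simp
  next
    show "continuous_on (sphere 0 1) (B t)" if "\<bar>t\<bar> \<le> T" for t
      by (rule continuous_on_slice[OF B_cont]) (use that in auto)
  qed (rule B'_cont W_cont)+
  finally have "1/2 * slab_int T (\<lambda>t y. cutoff c k r t * (u r t y)\<^sup>2) \<le> T ^ 4 * (K * slab_int T e)"
    by (simp only: slab_int_cmult add_0)
  then have "slab_int T (\<lambda>t y. cutoff c k r t * (u r t y)\<^sup>2) \<le> T ^ 4 * (2 * K * slab_int T e)" by simp
  moreover have "2 * K = 4 + 4 / D r\<^sub>0 + 64 * r\<^sub>0\<^sup>2 / D r\<^sub>0" by (simp add: K_def)
  ultimately show ?thesis by (simp only: e_def[abs_def])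
qed

text \<open>Origin of the constants: the leading 2 is the loss in
  \<open>edens u \<le> 2 * mdens\<close> at \<open>r\<^sub>2\<close>; the exponential comes from
  \<open>exp (C / r\<^sub>2) \<ge> 1\<close> and
  \<open>exp (C / r\<^sub>1) \<le> exp (C / r\<^sub>0)\<close>; in \<open>28 = 24 + 4\<close>, the
  24 belongs to the upper bound of \<open>mdens\<close> and the 4 to the integral of
  \<open>u^2\<close>.\<close>

lemma slab_int_cutoff_edens:
  assumes r\<^sub>0: "rC \<Lambda> m < r\<^sub>0" and r\<^sub>1: "r\<^sub>0 \<le> r\<^sub>1" and r\<^sub>2: "r\<^sub>1 \<le> r\<^sub>2" and c: "1 \<le> c"
  defines "k \<equiv> 2 * r\<^sub>0\<^sup>2 / D r\<^sub>0"
  defines "T \<equiv> c + k / r\<^sub>1"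
  shows "slab_int T (\<lambda>t y. cutoff c k r\<^sub>2 t * edens u r\<^sub>2 t y)
    \<le> T ^ 4 * (2 * exp (bulk_const r\<^sub>0 / r\<^sub>0) * (28 + 4 / D r\<^sub>0 + 64 * r\<^sub>0\<^sup>2 / D r\<^sub>0)
        * slab_int T (\<lambda>t y. edens u r\<^sub>1 t y + edens \<psi> r\<^sub>1 t y))"
proof -
  define C where "C = bulk_const r\<^sub>0"
  define e where "e t y = edens u r\<^sub>1 t y + edens \<psi> r\<^sub>1 t y" for t y
  define K where "K = 4 + 4 / D r\<^sub>0 + 64 * r\<^sub>0\<^sup>2 / D r\<^sub>0"
  have rr: "rC \<Lambda> m < r\<^sub>1" "rC \<Lambda> m < r\<^sub>2" using assms by linarith+
  note r0b = r_bounds[OF r\<^sub>0] and r1b = r_bounds[OF rr(1)] and r2b = r_bounds[OF rr(2)]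
  have k: "0 \<le> k" using r0b by (simp add: k_def)
  have T: "0 \<le> T" using c k r1b by (simp add: T_def)
  have C: "0 \<le> C"
    using r0b m by (auto simp: C_def bulk_const_def intro!: add_nonneg_nonneg divide_nonneg_nonneg)
  note dens = continuous_on_densities(1,2,3)[THEN continuous_on_slab, unfolded split_beta]
  note u_cont = smooth_continuous_on[OF smooth_u subset_refl, THEN continuous_on_slab, unfolded split_beta]
  note rules = continuous_on_cutoff dens[OF rr(1)] dens[OF rr(2)] u_cont[OF rr(1)]
    continuous_on_add continuous_on_mult continuous_on_power continuous_on_const
  have "slab_int T (\<lambda>t y. cutoff c k r\<^sub>2 t * edens u r\<^sub>2 t y)
     \<le> slab_int T (\<lambda>t y. 2 * (exp (C / r\<^sub>2) * cutoff c k r\<^sub>2 t * mdens r\<^sub>2 t y))"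
  proof (rule slab_int_mono)
    fix t and y :: "real^3"
    have "edens u r\<^sub>2 t y \<le> 2 * mdens r\<^sub>2 t y"
    proof -
      have "0 \<le> weight r\<^sub>2 * (u r\<^sub>2 t y)\<^sup>2" using weight_bounds[OF rr(2)] by simp
      then show ?thesis using mdens_lower(1)[OF rr(2), of t y] edens_nonneg[OF rr(2), of \<psi> t y] by linarith
    qed
    then have "cutoff c k r\<^sub>2 t * edens u r\<^sub>2 t y \<le> cutoff c k r\<^sub>2 t * (2 * mdens r\<^sub>2 t y)"
      by (rule mult_left_mono[OF _ cutoff_nonneg])
    also have "\<dots> \<le> exp (C / r\<^sub>2) * (cutoff c k r\<^sub>2 t * (2 * mdens r\<^sub>2 t y))"
      using mult_right_mono[of 1 "exp (C / r\<^sub>2)" "cutoff c k r\<^sub>2 t * (2 * mdens r\<^sub>2 t y)"]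
        C r2b mdens_nonneg[OF rr(2), of t y] cutoff_nonneg[of c k r\<^sub>2 t] by (simp add: less_imp_le)
    finally show "cutoff c k r\<^sub>2 t * edens u r\<^sub>2 t y \<le> 2 * (exp (C / r\<^sub>2) * cutoff c k r\<^sub>2 t * mdens r\<^sub>2 t y)"
      by (simp add: mult_ac)
  qed (unfold split_beta, (rule rules)+)
  also have "\<dots> = 2 * slab_int T (\<lambda>t y. exp (C / r\<^sub>2) * cutoff c k r\<^sub>2 t * mdens r\<^sub>2 t y)"
    by (rule slab_int_cmult)
  also have "\<dots> \<le> 2 * slab_int T (\<lambda>t y. exp (C / r\<^sub>1) * cutoff c k r\<^sub>1 t * mdens r\<^sub>1 t y)"
    unfolding C_def T_def k_def using c
    by (intro mult_left_mono weighted_energy_antimono[OF r\<^sub>0 r\<^sub>1 r\<^sub>2]) auto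
  also have "slab_int T (\<lambda>t y. exp (C / r\<^sub>1) * cutoff c k r\<^sub>1 t * mdens r\<^sub>1 t y)
     \<le> slab_int T (\<lambda>t y. exp (C / r\<^sub>0) * (cutoff c k r\<^sub>1 t * (u r\<^sub>1 t y)\<^sup>2 + T ^ 4 * (24 * e t y)))"
  proof (rule slab_int_mono)
    fix t and y :: "real^3"
    have "exp (C / r\<^sub>1) \<le> exp (C / r\<^sub>0)" using C r\<^sub>1 r0b r1b by (auto intro!: divide_left_mono)
    moreover have "cutoff c k r\<^sub>1 t * mdens r\<^sub>1 t y \<le> cutoff c k r\<^sub>1 t * (u r\<^sub>1 t y)\<^sup>2 + T ^ 4 * (24 * e t y)"
    proof -
      have le: "mdens r\<^sub>1 t y \<le> (u r\<^sub>1 t y)\<^sup>2 + 24 * e t y" and e: "0 \<le> e t y"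
        using mdens_lower(3)[OF rr(1), of t y] edens_nonneg[OF rr(1), of u t y] edens_nonneg[OF rr(1), of \<psi> t y]
        by (auto simp: e_def)
      have "cutoff c k r\<^sub>1 t * mdens r\<^sub>1 t y \<le> cutoff c k r\<^sub>1 t * ((u r\<^sub>1 t y)\<^sup>2 + 24 * e t y)"
        by (rule mult_left_mono[OF le cutoff_nonneg])
      also have "\<dots> = cutoff c k r\<^sub>1 t * (u r\<^sub>1 t y)\<^sup>2 + cutoff c k r\<^sub>1 t * (24 * e t y)" by (rule distrib_left)
      also have "cutoff c k r\<^sub>1 t * (24 * e t y) \<le> T ^ 4 * (24 * e t y)"
        using e T unfolding T_def by (intro mult_right_mono cutoff_le) auto
      finally show ?thesis by simp
    qed
    ultimately have "exp (C / r\<^sub>1) * (cutoff c k r\<^sub>1 t * mdens r\<^sub>1 t y)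
       \<le> exp (C / r\<^sub>0) * (cutoff c k r\<^sub>1 t * (u r\<^sub>1 t y)\<^sup>2 + T ^ 4 * (24 * e t y))"
      using mdens_nonneg[OF rr(1), of t y] cutoff_nonneg[of c k r\<^sub>1 t] by (intro mult_mono) auto
    then show "exp (C / r\<^sub>1) * cutoff c k r\<^sub>1 t * mdens r\<^sub>1 t y
       \<le> exp (C / r\<^sub>0) * (cutoff c k r\<^sub>1 t * (u r\<^sub>1 t y)\<^sup>2 + T ^ 4 * (24 * e t y))" by (simp add: mult.assoc)
  qed (unfold e_def split_beta, (rule rules)+)
  also have "\<dots> = exp (C / r\<^sub>0) * (slab_int T (\<lambda>t y. cutoff c k r\<^sub>1 t * (u r\<^sub>1 t y)\<^sup>2) + T ^ 4 * (24 * slab_int T e))"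
    unfolding slab_int_cmult
    by (subst slab_int_add) (unfold slab_int_cmult e_def split_beta, (rule rules)+, rule refl)
  also have "slab_int T (\<lambda>t y. cutoff c k r\<^sub>1 t * (u r\<^sub>1 t y)\<^sup>2) \<le> T ^ 4 * (K * slab_int T e)"
    unfolding T_def K_def e_def[abs_def] by (rule slab_int_cutoff_u_square[OF r\<^sub>0 r\<^sub>1 c k])
  finally have "slab_int T (\<lambda>t y. cutoff c k r\<^sub>2 t * edens u r\<^sub>2 t y)
     \<le> 2 * (exp (C / r\<^sub>0) * (T ^ 4 * (K * slab_int T e) + T ^ 4 * (24 * slab_int T e)))" by simp
  also have "\<dots> = T ^ 4 * (2 * exp (C / r\<^sub>0) * (K + 24) * slab_int T e)" by (simp add: algebra_simps)
  also have "K + 24 = 28 + 4 / D r\<^sub>0 + 64 * r\<^sub>0\<^sup>2 / D r\<^sub>0" by (simp add: K_def)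
  finally show ?thesis by (simp only: C_def e_def[abs_def])
qed

section \<open>Removing the cutoffs\<close>

lemma filterlim_affine_sequentially: "filterlim (\<lambda>n. 1 + real n + b) at_top sequentially"
proof -
  have "filterlim (\<lambda>n. (1 + b) + real n) at_top sequentially"
    by (rule filterlim_tendsto_add_at_top[OF tendsto_const filterlim_real_sequentially])
  moreover have "(\<lambda>n. (1 + b) + real n) = (\<lambda>n. 1 + real n + b)" by (simp add: fun_eq_iff)
  ultimately show ?thesis by (simp only:)
qed

text \<open>The edges at \<open>r\<^sub>1\<close> and \<open>r\<^sub>2\<close> differ by an amount
  independent of \<open>n\<close>, so their quotient tends to 1. The cutoff at
  \<open>r\<^sub>2\<close> may therefore be normalised by the fourth power of the edge at
  \<open>r\<^sub>1\<close>.\<close>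

lemma cutoff_tendsto:
  assumes "0 < r\<^sub>1" "0 < r\<^sub>2"
  shows "(\<lambda>n. cutoff (1 + real n) k r\<^sub>2 t / (1 + real n + k / r\<^sub>1) ^ 4) \<longlonglongrightarrow> 1"
proof -
  define T where "T n = 1 + real n + k / r\<^sub>1" for n
  have T: "filterlim T at_top sequentially"
    unfolding T_def
    by (rule filterlim_affine_sequentially)
  have inv: "(\<lambda>n. x / T n) \<longlonglongrightarrow> 0" for x :: real
    by (rule tendsto_divide_0[OF tendsto_const filterlim_at_top_imp_at_infinity[OF T]])
  have "(\<lambda>n. (max 0 ((1 + (k / r\<^sub>2 - k / r\<^sub>1) / T n)\<^sup>2 - (t / T n)\<^sup>2))\<^sup>2) \<longlonglongrightarrow> (max 0 ((1 + 0)\<^sup>2 - 0\<^sup>2))\<^sup>2"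
    by (intro tendsto_intros inv)
  then have lim: "(\<lambda>n. (max 0 ((1 + (k / r\<^sub>2 - k / r\<^sub>1) / T n)\<^sup>2 - (t / T n)\<^sup>2))\<^sup>2) \<longlonglongrightarrow> 1" by simp
  have "\<forall>\<^sub>F n in sequentially. 0 < T n"
    using T by (simp add: filterlim_at_top_dense)
  then have "\<forall>\<^sub>F n in sequentially. (max 0 ((1 + (k / r\<^sub>2 - k / r\<^sub>1) / T n)\<^sup>2 - (t / T n)\<^sup>2))\<^sup>2
      = cutoff (1 + real n) k r\<^sub>2 t / T n ^ 4"
  proof eventually_elim
    fix n assume pos: "0 < T n"
    have "(1 + (k / r\<^sub>2 - k / r\<^sub>1) / T n) = (1 + real n + k / r\<^sub>2) / T n" using pos by (simp add: T_def field_simps)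
    then have "max 0 ((1 + (k / r\<^sub>2 - k / r\<^sub>1) / T n)\<^sup>2 - (t / T n)\<^sup>2) = max 0 (((1 + real n + k / r\<^sub>2)\<^sup>2 - t\<^sup>2) / (T n)\<^sup>2)"
      by (simp add: power_divide diff_divide_distrib)
    also have "\<dots> = max 0 ((1 + real n + k / r\<^sub>2)\<^sup>2 - t\<^sup>2) / (T n)\<^sup>2"
      using pos by (simp add: max_def zero_le_divide_iff)
    finally show "(max 0 ((1 + (k / r\<^sub>2 - k / r\<^sub>1) / T n)\<^sup>2 - (t / T n)\<^sup>2))\<^sup>2 = cutoff (1 + real n) k r\<^sub>2 t / T n ^ 4"
      by (simp add: cutoff_def power_divide flip: power_mult)
  qed
  from Lim_transform_eventually[OF lim this] show ?thesis by (simp add: T_def)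
qed

lemma energy_estimate:
  assumes r\<^sub>0: "rC \<Lambda> m < r\<^sub>0" and r\<^sub>1: "r\<^sub>0 \<le> r\<^sub>1" and r\<^sub>2: "r\<^sub>1 \<le> r\<^sub>2"
  shows "energy \<Lambda> m u r\<^sub>2
    \<le> ennreal (2 * exp (bulk_const r\<^sub>0 / r\<^sub>0) * (28 + 4 / D r\<^sub>0 + 64 * r\<^sub>0\<^sup>2 / D r\<^sub>0))
       * (energy \<Lambda> m u r\<^sub>1 + energy \<Lambda> m \<psi> r\<^sub>1)"
proof -
  define k where "k = 2 * r\<^sub>0\<^sup>2 / D r\<^sub>0"
  define T where "T n = 1 + real n + k / r\<^sub>1" for n
  define M where "M = 2 * exp (bulk_const r\<^sub>0 / r\<^sub>0) * (28 + 4 / D r\<^sub>0 + 64 * r\<^sub>0\<^sup>2 / D r\<^sub>0)"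
  have rr: "rC \<Lambda> m < r\<^sub>1" "rC \<Lambda> m < r\<^sub>2" using assms by linarith+
  note r0b = r_bounds[OF r\<^sub>0] and r1b = r_bounds[OF rr(1)] and r2b = r_bounds[OF rr(2)]
  have k: "0 \<le> k" using r0b by (simp add: k_def)
  have T: "0 < T n" for n using k r1b by (simp add: T_def add_pos_nonneg)
  have M: "0 \<le> M" using r0b by (simp add: M_def)
  note dens = continuous_on_densities(1,2)[THEN continuous_on_slab]
  have "int_tS2 (edens u r\<^sub>2) \<le> ennreal M * (energy \<Lambda> m u r\<^sub>1 + energy \<Lambda> m \<psi> r\<^sub>1)"
  \<comment> \<open>Dividing by \<open>T n ^ 4\<close> cancels the power on the right of the slab
    estimate, so the remaining constant \<open>M\<close> is the same for all
    \<open>n\<close>.\<close>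
  proof (rule int_tS2_le_of_cutoffs[where \<kappa>="\<lambda>n t. cutoff (1 + real n) k r\<^sub>2 t / T n ^ 4" and T=T])
    show "continuous_on UNIV (\<lambda>t. cutoff (1 + real n) k r\<^sub>2 t / T n ^ 4)" for n
      using T[of n] unfolding cutoff_def by (intro continuous_intros) auto
    show "0 \<le> cutoff (1 + real n) k r\<^sub>2 t / T n ^ 4" for n t
      using T[of n] by (simp add: cutoff_nonneg)
    show "(\<lambda>n. cutoff (1 + real n) k r\<^sub>2 t / T n ^ 4) \<longlonglongrightarrow> 1" for t
      unfolding T_def by (rule cutoff_tendsto[OF r1b(1) r2b(1)])
    show "filterlim T at_top sequentially"
      unfolding T_def
      by (rule filterlim_affine_sequentially)
    show "continuous_on (UNIV \<times> sphere 0 1) (\<lambda>(t, y). edens u r\<^sub>2 t y)" by (rule dens(1)[OF rr(2)])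
    show "0 \<le> edens u r\<^sub>2 t y" for t y by (rule edens_nonneg[OF rr(2)])
    fix n
    define e where "e t y = edens u r\<^sub>1 t y + edens \<psi> r\<^sub>1 t y" for t y
    have "T n ^ 4 * slab_int (T n) (\<lambda>t y. cutoff (1 + real n) k r\<^sub>2 t / T n ^ 4 * edens u r\<^sub>2 t y)
        = slab_int (T n) (\<lambda>t y. cutoff (1 + real n) k r\<^sub>2 t * edens u r\<^sub>2 t y)"
      using T[of n] by (simp flip: slab_int_cmult)
    also have "\<dots> \<le> T n ^ 4 * (M * slab_int (T n) e)"
      unfolding T_def k_def M_def e_def[abs_def] by (rule slab_int_cutoff_edens[OF r\<^sub>0 r\<^sub>1 r\<^sub>2]) simp
    finally have "slab_int (T n) (\<lambda>t y. cutoff (1 + real n) k r\<^sub>2 t / T n ^ 4 * edens u r\<^sub>2 t y) \<le> M * slab_int (T n) e"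
      using T[of n] by simp
    then have "ennreal (slab_int (T n) (\<lambda>t y. cutoff (1 + real n) k r\<^sub>2 t / T n ^ 4 * edens u r\<^sub>2 t y))
       \<le> ennreal M * ennreal (slab_int (T n) e)"
      using M by (simp add: ennreal_leI flip: ennreal_mult')
    also have "ennreal (slab_int (T n) e) \<le> ennreal (slab_int (T n) (edens u r\<^sub>1)) + ennreal (slab_int (T n) (edens \<psi> r\<^sub>1))"
      unfolding e_def by (subst slab_int_add[OF dens(1)[OF rr(1)] dens(2)[OF rr(1)]]) (intro eq_refl ennreal_plus slab_int_nonneg dens[OF rr(1)] edens_nonneg[OF rr(1)])
    also have "\<dots> \<le> energy \<Lambda> m u r\<^sub>1 + energy \<Lambda> m \<psi> r\<^sub>1"
      unfolding energy_eq
      by (intro add_mono slab_int_le_int_tS2 dens[OF rr(1)] edens_nonneg[OF rr(1)])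
    finally show "ennreal (slab_int (T n) (\<lambda>t y. cutoff (1 + real n) k r\<^sub>2 t / T n ^ 4 * edens u r\<^sub>2 t y))
       \<le> ennreal M * (energy \<Lambda> m u r\<^sub>1 + energy \<Lambda> m \<psi> r\<^sub>1)"
      by (simp add: mult_left_mono)
  qed
  then show ?thesis by (simp only: energy_eq M_def)
qed

end

theorem theorem4p2:
  fixes \<Lambda> m r\<^sub>0 :: real
  assumes "\<Lambda> > 0" and "m > 0" and "3 * m < 1 / sqrt \<Lambda>" and "r\<^sub>0 > rC \<Lambda> m"
  shows "\<exists>C>0. \<forall>\<psi>. sds_wave_solution \<Lambda> m \<psi> \<longrightarrow>
           (\<forall>r\<^sub>1 r\<^sub>2. r\<^sub>0 \<le> r\<^sub>1 \<and> r\<^sub>1 < r\<^sub>2 \<longrightarrow>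
              energy \<Lambda> m (Xs \<Lambda> m \<psi>) r\<^sub>2
                \<le> ennreal C * (energy \<Lambda> m (Xs \<Lambda> m \<psi>) r\<^sub>1 + energy \<Lambda> m \<psi> r\<^sub>1))"
proof -
  interpret subextremal \<Lambda> m using assms by unfold_locales
  have wave: "sds_wave \<Lambda> m \<psi>" if "sds_wave_solution \<Lambda> m \<psi>" for \<psi>
    using that by unfold_locales
  have "D r\<^sub>0 > 0" by (rule D_pos[OF assms(4)])
  then have "2 * exp (bulk_const r\<^sub>0 / r\<^sub>0) * (28 + 4 / D r\<^sub>0 + 64 * r\<^sub>0\<^sup>2 / D r\<^sub>0) > 0"
    by (intro mult_pos_pos add_pos_nonneg) auto
  then show ?thesis
    using sds_wave.energy_estimate[OF wave assms(4)] by (blast intro: less_imp_le)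
qed

end
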